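(* Let $A\subset\mathbf R^{n+1}$ be a closed set with $\mathrm{reach}(A)>0$ and let $a\in\partial^vA$ with $N(A,a)=\{u\}$, $u\in\mathbf S^n$. Then: (a) there are $\varepsilon,\delta>0$ and a semiconvex Lipschitz function $f:a+u^\perp\to\mathbf R$ with $f(a)=0$, $f$ differentiable at $a$ with $Df(a)=0$, and $$\mathrm{graph}(f)\cap U_{\varepsilon,\delta}(a,u)=\partial A\cap U_{\varepsilon,\delta}(a,u),\qquad\mathrm{epi}(f)\cap U_{\varepsilon,\delta}(a,u)=A\cap U_{\varepsilon,\delta}(a,u);$$ (b) for $f$ as in (a): $(a,\nabla\phi(u))\in\widetilde N^\phi_n(A)$ if and only if $f$ is pointwise twice differentiable at $a$. In this case every map $\nu:a+u^\perp\to\mathbf S^n$ with $\nu(b)\in N(\mathrm{epi}(f),b-f(b)u)$ for every $b\in a+u^\perp$ is differentiable at $a$ and $$D^2f(a)(\tau_1,D(\nabla\phi)(u)(\tau_2))=D(\nabla\phi\circ\nu)(a)(\tau_1)\bullet\tau_2\quad\text{for }\tau_1,\tau_2\in u^\perp.$$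
   Context: Notation. $n\ge1$; $\mathbf{R}^{n+1}$ with Euclidean inner product $\bullet$, norm $|\cdot|$, unit sphere $\mathbf S^n$; $\mathcal L^{n+1}$ Lebesgue measure. For $a\in\mathbf R^{n+1}$, $u\in\mathbf S^n$, $\varepsilon,\delta>0$: $U_{\varepsilon,\delta}(a,u)=\{x+tu:x\in a+u^\perp,|x-a|<\varepsilon,|t|<\delta\}$; for $f:a+u^\perp\to\mathbf R$, $\mathrm{graph}(f)=\{x-f(x)u:x\in a+u^\perp\}$ and $\mathrm{epi}(f)=\{x-su:x\in a+u^\perp,s\ge f(x)\}$. A function $f$ on (an open convex subset of) $a+u^\perp\cong\mathbf R^n$ is semiconvex if $x\mapsto\kappa|x|^2+f(x)$ is convex for some $\kappa\ge0$. Euclidean objects: $N(E)=\{(b,v)\in E\times\mathbf S^n:\mathrm{dist}(b+rv,E)=r$ for some $r>0\}$ with fibres $N(E,b)$, for closed $E$; $\partial^vE$ is the set of $b\in\partial E$ with $N(E,b)$ a singleton; $\mathrm{reach}(A)$ is the supremum of $\rho\ge0$ such that every point at Euclidean distance $<\rho$ from $A$ has a unique nearest point in $A$. $\phi$ is a norm on $\mathbf R^{n+1}$ of class $C^2$ on $\mathbf R^{n+1}\setminus\{0\}$, uniformly convex (there is $\gamma>0$ with $u\mapsto\phi(u)-\gamma|u|$ convex). $\phi^*(u)=\sup\{v\bullet u:\phi(v)=1\}$; $\mathcal W^\phi=\{x:\phi^*(x)\le1\}$; $\mathbf n^\phi:\partial\mathcal W^\phi\to\mathbf S^n$ its Euclidean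 exterior unit normal. For nonempty closed $A$: $\delta^\phi_A(x)=\min\{\phi^*(x-c):c\in A\}$; $\xi^\phi_A(x)=\{c\in A:\phi^*(x-c)=\delta^\phi_A(x)\}$; for $x\notin A$, $\nu^\phi_A(x)=\{\delta^\phi_A(x)^{-1}(x-c):c\in\xi^\phi_A(x)\}$. $\nu^\phi_A$ is differentiable at $x\notin A$ if $\nu^\phi_A(x)$ is a singleton and there is linear $L$ such that for every $\varepsilon>0$ there is $\delta>0$ with $|w-\nu^\phi_A(x)-L(y-x)|\le\varepsilon|y-x|$ for $y\notin A$, $|y-x|<\delta$, $w\in\nu^\phi_A(y)$; $D\nu^\phi_A(x)=L$; $\mathrm{dmn}D\nu^\phi_A$ the set of such $x$. $N^\phi(A)=\{(a,\eta)\in A\times\partial\mathcal W^\phi:\delta^\phi_A(a+r\eta)=r$ for some $r>0\}$; $\mathbf r^\phi_A(a,\eta)=\sup\{s>0:\delta^\phi_A(a+s\eta)=s\}$; for $x\notin A$, $a\in\xi^\phi_A(x)$: $\rho^\phi_A(x)=\sup\{s\ge0:\delta^\phi_A(a+s(x-a))=s\delta^\phi_A(x)\}$; $\underline{\mathbf r}^\phi_A(a,\eta)$ is the supremum of $\{0\}$ and all $\sigma r$ with $\sigma>1$, $0<r<\mathbf r^\phi_A(a,\eta)$, such that $\{x\notin A:\rho^\phi_A(x)\ge\sigma\}$ has Lebesgue density $1$ at $a+r\eta$. For $x\in\mathrm{dmn}D\nu^\phi_A$, $D\nu^\phi_A(x)$ maps $\mathbf n^\phi(\nu^\phi_A(x))^\perp$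 into itself with real eigenvalues $\chi^\phi_{A,1}(x)\le\dots\le\chi^\phi_{A,n}(x)$. $\widetilde N^\phi(A)$: $(a,\eta)\in N^\phi(A)$ with $a+r\eta\in\mathrm{dmn}D\nu^\phi_A$ for some (then all) $r\in(0,\underline{\mathbf r}^\phi_A(a,\eta))$; $\kappa^\phi_{A,i}(a,\eta)=\chi^\phi_{A,i}(a+r\eta)/(1-r\chi^\phi_{A,i}(a+r\eta))\in(-\infty,+\infty]$; $\widetilde N^\phi_n(A)$ the set of $(a,\eta)\in\widetilde N^\phi(A)$ with all $\kappa^\phi_{A,i}$ finite. *)

theory Defs
  imports "HOL-Analysis.Analysis"
begin

definition unit_sphere :: "'a::euclidean_space set" where
  "unit_sphere = sphere 0 1"

definition normal_fibre :: "'a::euclidean_space set \<Rightarrow> 'a \<Rightarrow> 'a set" where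
  "normal_fibre E b = {v \<in> unit_sphere. b \<in> E \<and> (\<exists>r>0. infdist (b + r *\<^sub>R v) E = r)}"

definition vfrontier :: "'a::euclidean_space set \<Rightarrow> 'a set" where
  "vfrontier E = {b \<in> frontier E. \<exists>v. normal_fibre E b = {v}}"

definition reach :: "'a::euclidean_space set \<Rightarrow> ereal" where
  "reach A = Sup {ereal \<rho> | \<rho>. \<rho> \<ge> 0 \<and>
      (\<forall>x. infdist x A < \<rho> \<longrightarrow> (\<exists>!c. c \<in> A \<and> dist x c = infdist x A))}"

definition hplane :: "'a::euclidean_space \<Rightarrow> 'a \<Rightarrow> 'a set" where
  "hplane a u = {x. (x - a) \<bullet> u = 0}"

definition cyl :: "real \<Rightarrow> real \<Rightarrow> 'a::euclidean_space \<Rightarrow> 'a \<Rightarrow> 'a set" where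
  "cyl \<epsilon> \<delta> a u = {x + t *\<^sub>R u | x t. x \<in> hplane a u \<and> norm (x - a) < \<epsilon> \<and> \<bar>t\<bar> < \<delta>}"

definition fgraph :: "'a::euclidean_space \<Rightarrow> 'a \<Rightarrow> ('a \<Rightarrow> real) \<Rightarrow> 'a set" where
  "fgraph a u f = {x - f x *\<^sub>R u | x. x \<in> hplane a u}"

definition fepi :: "'a::euclidean_space \<Rightarrow> 'a \<Rightarrow> ('a \<Rightarrow> real) \<Rightarrow> 'a set" where
  "fepi a u f = {x - s *\<^sub>R u | x s. x \<in> hplane a u \<and> s \<ge> f x}"

text \<open>Semiconvexity on the (convex) plane a + u^\<bottom>, identified with R^n via x \<mapsto> x - a.\<close>
definition semiconvex_on :: "'a::euclidean_space set \<Rightarrow> 'a \<Rightarrow> ('a \<Rightarrow> real) \<Rightarrow> bool" where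
  "semiconvex_on P a f \<longleftrightarrow> (\<exists>\<kappa>\<ge>0. convex_on P (\<lambda>x. \<kappa> * (norm (x - a))\<^sup>2 + f x))"

definition second_order_at ::
  "'a::euclidean_space set \<Rightarrow> ('a \<Rightarrow> real) \<Rightarrow> 'a \<Rightarrow> ('a \<Rightarrow> real) \<Rightarrow> ('a \<Rightarrow> 'a \<Rightarrow> real) \<Rightarrow> bool" where
  "second_order_at P f a L Q \<longleftrightarrow> linear L \<and> bilinear Q \<and> (\<forall>x y. Q x y = Q y x) \<and>
     ((\<lambda>x. (f x - f a - L (x - a) - Q (x - a) (x - a) / 2) / (norm (x - a))\<^sup>2) \<longlongrightarrow> 0)
       (at a within P)"

definition pt_twice_diff :: "'a::euclidean_space set \<Rightarrow> ('a \<Rightarrow> real) \<Rightarrow> 'a \<Rightarrow> bool" where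
  "pt_twice_diff P f a \<longleftrightarrow> (\<exists>L Q. second_order_at P f a L Q)"

definition admissible_norm ::
  "('a::euclidean_space \<Rightarrow> real) \<Rightarrow> ('a \<Rightarrow> 'a) \<Rightarrow> ('a \<Rightarrow> 'a \<Rightarrow>\<^sub>L 'a) \<Rightarrow> bool" where
  "admissible_norm \<phi> g Dg \<longleftrightarrow>
     (\<forall>x y. \<phi> (x + y) \<le> \<phi> x + \<phi> y) \<and> (\<forall>c x. \<phi> (c *\<^sub>R x) = \<bar>c\<bar> * \<phi> x) \<and>
     (\<forall>x. \<phi> x = 0 \<longleftrightarrow> x = 0) \<and>
     (\<forall>x. x \<noteq> 0 \<longrightarrow> (\<phi> has_derivative (\<lambda>h. g x \<bullet> h)) (at x)) \<and>
     (\<forall>x. x \<noteq> 0 \<longrightarrow> (g has_derivative blinfun_apply (Dg x)) (at x)) \<and>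
     continuous_on (UNIV - {0}) Dg \<and>
     (\<exists>\<gamma>>0. convex_on UNIV (\<lambda>v. \<phi> v - \<gamma> * norm v))"

definition dual_norm :: "('a::euclidean_space \<Rightarrow> real) \<Rightarrow> 'a \<Rightarrow> real" where
  "dual_norm \<phi> u = Sup {v \<bullet> u | v. \<phi> v = 1}"

definition Wulff :: "('a::euclidean_space \<Rightarrow> real) \<Rightarrow> 'a set" where
  "Wulff \<phi> = {x. dual_norm \<phi> x \<le> 1}"

definition Wnormal :: "('a::euclidean_space \<Rightarrow> real) \<Rightarrow> 'a \<Rightarrow> 'a" where
  "Wnormal \<phi> \<eta> = (THE v. norm v = 1 \<and> (\<forall>y\<in>Wulff \<phi>. v \<bullet> (y - \<eta>) \<le> 0))"

definition adist :: "('a::euclidean_space \<Rightarrow> real) \<Rightarrow> 'a set \<Rightarrow> 'a \<Rightarrow> real" where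
  "adist \<phi> A x = Inf ((\<lambda>c. dual_norm \<phi> (x - c)) ` A)"

definition aproj :: "('a::euclidean_space \<Rightarrow> real) \<Rightarrow> 'a set \<Rightarrow> 'a \<Rightarrow> 'a set" where
  "aproj \<phi> A x = {c \<in> A. dual_norm \<phi> (x - c) = adist \<phi> A x}"

definition anu :: "('a::euclidean_space \<Rightarrow> real) \<Rightarrow> 'a set \<Rightarrow> 'a \<Rightarrow> 'a set" where
  "anu \<phi> A x = {(1 / adist \<phi> A x) *\<^sub>R (x - c) | c. c \<in> aproj \<phi> A x}"

definition anu_deriv :: "('a::euclidean_space \<Rightarrow> real) \<Rightarrow> 'a set \<Rightarrow> 'a \<Rightarrow> ('a \<Rightarrow> 'a) \<Rightarrow> bool" where
  "anu_deriv \<phi> A x L \<longleftrightarrow> x \<notin> A \<and> linear L \<and>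
     (\<exists>w. anu \<phi> A x = {w} \<and>
        (\<forall>\<epsilon>>0. \<exists>\<delta>>0. \<forall>y w'. y \<notin> A \<and> norm (y - x) < \<delta> \<and> w' \<in> anu \<phi> A y \<longrightarrow>
            norm (w' - w - L (y - x)) \<le> \<epsilon> * norm (y - x)))"

definition anu_dmn :: "('a::euclidean_space \<Rightarrow> real) \<Rightarrow> 'a set \<Rightarrow> 'a set" where
  "anu_dmn \<phi> A = {x. \<exists>L. anu_deriv \<phi> A x L}"

definition aNor :: "('a::euclidean_space \<Rightarrow> real) \<Rightarrow> 'a set \<Rightarrow> ('a \<times> 'a) set" where
  "aNor \<phi> A = {(a, \<eta>). a \<in> A \<and> \<eta> \<in> frontier (Wulff \<phi>) \<and>
                  (\<exists>r>0. adist \<phi> A (a + r *\<^sub>R \<eta>) = r)}"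

definition areach :: "('a::euclidean_space \<Rightarrow> real) \<Rightarrow> 'a set \<Rightarrow> 'a \<Rightarrow> 'a \<Rightarrow> ereal" where
  "areach \<phi> A a \<eta> = Sup {ereal s | s. s > 0 \<and> adist \<phi> A (a + s *\<^sub>R \<eta>) = s}"

definition arho :: "('a::euclidean_space \<Rightarrow> real) \<Rightarrow> 'a set \<Rightarrow> 'a \<Rightarrow> ereal" where
  "arho \<phi> A x = (let a = (SOME a. a \<in> aproj \<phi> A x) in
     Sup {ereal s | s. s \<ge> 0 \<and> adist \<phi> A (a + s *\<^sub>R (x - a)) = s * adist \<phi> A x})"

definition outer_lmeasure :: "'a::euclidean_space set \<Rightarrow> ennreal" where
  "outer_lmeasure S = Inf {emeasure lebesgue T | T. T \<in> sets lebesgue \<and> S \<subseteq> T}"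

definition density_one :: "'a::euclidean_space set \<Rightarrow> 'a \<Rightarrow> bool" where
  "density_one S p \<longleftrightarrow>
     ((\<lambda>t. enn2real (outer_lmeasure (S \<inter> ball p t)) / measure lebesgue (ball p t)) \<longlongrightarrow> 1)
       (at_right 0)"

definition areach_low :: "('a::euclidean_space \<Rightarrow> real) \<Rightarrow> 'a set \<Rightarrow> 'a \<Rightarrow> 'a \<Rightarrow> ereal" where
  "areach_low \<phi> A a \<eta> = Sup ({0} \<union> {ereal (\<sigma> * r) | \<sigma> r. \<sigma> > 1 \<and> 0 < r \<and>
       ereal r < areach \<phi> A a \<eta> \<and>
       density_one {x. x \<notin> A \<and> arho \<phi> A x \<ge> ereal \<sigma>} (a + r *\<^sub>R \<eta>)})"

definition aNor_tilde :: "('a::euclidean_space \<Rightarrow> real) \<Rightarrow> 'a set \<Rightarrow> ('a \<times> 'a) set" where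
  "aNor_tilde \<phi> A = {(a, \<eta>). (a, \<eta>) \<in> aNor \<phi> A \<and>
     (\<exists>r. 0 < r \<and> ereal r < areach_low \<phi> A a \<eta> \<and> a + r *\<^sub>R \<eta> \<in> anu_dmn \<phi> A)}"

text \<open>\<kappa>_i = \<chi>_i/(1 - r \<chi>_i) is finite for all i iff no eigenvalue \<chi> of
  D\<nu>(a + r\<eta>) on n^\<phi>(\<nu>)^\<bottom> satisfies 1 - r \<chi> = 0.\<close>
definition aNor_n :: "('a::euclidean_space \<Rightarrow> real) \<Rightarrow> 'a set \<Rightarrow> ('a \<times> 'a) set" where
  "aNor_n \<phi> A = {(a, \<eta>). (a, \<eta>) \<in> aNor \<phi> A \<and>
     (\<exists>r. 0 < r \<and> ereal r < areach_low \<phi> A a \<eta> \<and> a + r *\<^sub>R \<eta> \<in> anu_dmn \<phi> A \<and>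
        (\<forall>L. anu_deriv \<phi> A (a + r *\<^sub>R \<eta>) L \<longrightarrow>
           (\<forall>w k v. anu \<phi> A (a + r *\<^sub>R \<eta>) = {w} \<and> v \<noteq> 0 \<and> Wnormal \<phi> w \<bullet> v = 0 \<and>
               L v = k *\<^sub>R v \<longrightarrow> 1 - r * k \<noteq> 0)))}"

end

theory Submission
  imports Defs
begin

text \<open>If \<open>reach A > 0\<close>, every normal of \<open>A\<close> is realised by touching balls of a uniform radius, so
  normals depend upper semicontinuously on the base point. With a single normal \<open>u\<close> at \<open>a\<close>, all
  normals near \<open>a\<close> are close to \<open>u\<close>, and moving into the cone around \<open>-u\<close> never leaves \<open>A\<close>: near
  \<open>a\<close> the set is the epigraph of a Lipschitz function, and the uniform touching balls make that
  function semiconvex.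

  For the second order statement, let \<open>y\<close> be near \<open>a + r \<nabla>\<phi>(u)\<close>, let \<open>c\<close> be its anisotropic nearest
  point, \<open>w = \<nabla>\<phi>(v)\<close> the anisotropic normal, \<open>z\<close> the tangential part of \<open>c - a\<close> and \<open>q\<close> the slope of
  the graph over \<open>z\<close>. Then, up to lower order terms, \<open>y - a - r \<nabla>\<phi>(u)\<close> is \<open>z + r (w - \<nabla>\<phi>(u))\<close> plus a
  multiple of \<open>\<nabla>\<phi>(u)\<close>, and \<open>w - \<nabla>\<phi>(u) = D(\<nabla>\<phi>)(u) q\<close>. If the slope is \<open>q = D z + o(z)\<close>, then \<open>z\<close>, and
  hence \<open>w\<close>, is differentiable in \<open>y\<close> for small \<open>r\<close>. Conversely, if \<open>w\<close> is differentiable with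
  derivative \<open>L\<close>, then \<open>z = (I - r L) \<tau> + o(\<tau>)\<close> along tangential \<open>\<tau>\<close>; finiteness of the curvatures is
  invertibility of \<open>I - r L\<close>, so the slopes have a first order expansion at asymptotically all
  points, and hypomonotonicity of subgradients turns this into a second order expansion of \<open>f\<close>.\<close>

section \<open>Uniformly convex norms\<close>

text \<open>The Euclidean and the anisotropic geometry meet only through balls: uniform convexity
  puts a Euclidean ball of radius \<gamma> inside the Wulff shape at every boundary point, and the
  bound on \<open>Dg\<close> puts the shape inside a touching ball of some radius R. Hence
  anisotropic nearest points carry Euclidean normals, and for t < \<rho> / (2 R) a Euclidean normal
  v of A gives the anisotropic normal \<open>g v\<close> with touching radius t. The hard direction
  goes from the normal to f. Slopes are then known only at nearest points of the slice a + r
  \<open>g u\<close> + \<open>V\<close>; these are shown to come within o(|x|) of every x in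
  \<open>V\<close>, not to fill a neighbourhood, and the linear map D found there is not known to be
  symmetric. So subgradients must carry the estimate, and only the quadratic form D z . z enters the
  expansion of f. The lower reach is defined by density. Two facts about it suffice: it has a
  positive lower bound, since near the ray all points can be pushed out by the factor 2; and a
  radius below it is below the ordinary reach, which makes a the unique nearest point at the radius
  given by \<open>aNor_n\<close>.\<close>

lemma convex_above_tangent:
  fixes \<psi> :: "'a::real_normed_vector \<Rightarrow> real"
  assumes cvx: "convex_on UNIV \<psi>" and D: "(\<psi> has_derivative D) (at v)"
  shows "\<psi> p \<ge> \<psi> v + D (p - v)"
proof -
  let ?h = "\<lambda>t::real. \<psi> (v + t *\<^sub>R (p - v))"
  have "convex_on UNIV ?h"
  proof (rule convex_onI)
    fix t x y :: real assume t: "0 < t" "t < 1"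
    have "v + ((1 - t) *\<^sub>R x + t *\<^sub>R y) *\<^sub>R (p - v)
        = (1 - t) *\<^sub>R (v + x *\<^sub>R (p - v)) + t *\<^sub>R (v + y *\<^sub>R (p - v))"
      by (simp add: algebra_simps)
    then show "?h ((1 - t) *\<^sub>R x + t *\<^sub>R y) \<le> (1 - t) * ?h x + t * ?h y"
      using convex_onD[OF cvx, of t] t by simp
  qed auto
  moreover have "(?h has_real_derivative D (p - v)) (at 0 within UNIV)"
  proof -
    have 1: "((\<lambda>t::real. v + t *\<^sub>R (p - v)) has_derivative (\<lambda>t. t *\<^sub>R (p - v))) (at 0)"
      by (auto intro!: derivative_eq_intros)
    have "(?h has_derivative (\<lambda>t. D (t *\<^sub>R (p - v)))) (at 0)"
      by (rule has_derivative_compose[OF 1]) (use D in simp)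
    moreover have "(\<lambda>t. D (t *\<^sub>R (p - v))) = (*) (D (p - v))"
      using linear_cmul[OF has_derivative_linear[OF D]] by (auto simp: mult.commute)
    ultimately show ?thesis by (simp add: has_field_derivative_def)
  qed
  ultimately have "?h 1 - ?h 0 \<ge> D (p - v) * (1 - 0)"
    by (intro convex_on_imp_above_tangent[where A = UNIV]) auto
  then show ?thesis by simp
qed

lemma unit_dist_sq:
  assumes "norm v = 1" "norm w = 1"
  shows "(norm (v - w))\<^sup>2 = 2 * (1 - v \<bullet> (w::'a::real_inner))"
  using assms unfolding power2_norm_eq_inner inner_diff_left inner_diff_right
  by (simp add: inner_commute[of w v] norm_eq_1)

locale wulff_norm =
  fixes \<phi> :: "'a::euclidean_space \<Rightarrow> real" and g :: "'a \<Rightarrow> 'a"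
    and Dg :: "'a \<Rightarrow> 'a \<Rightarrow>\<^sub>L 'a" and \<gamma> :: real
  assumes adm: "admissible_norm \<phi> g Dg"
    and gamma_pos: "\<gamma> > 0"
    and gamma_convex: "convex_on UNIV (\<lambda>v. \<phi> v - \<gamma> * norm v)"
begin

lemma phi_add: "\<phi> (x + y) \<le> \<phi> x + \<phi> y"
  and phi_scale: "\<phi> (c *\<^sub>R x) = \<bar>c\<bar> * \<phi> x"
  and phi_eq_0: "\<phi> x = 0 \<longleftrightarrow> x = 0"
  and phi_deriv: "x \<noteq> 0 \<Longrightarrow> (\<phi> has_derivative (\<lambda>h. g x \<bullet> h)) (at x)"
  and g_deriv: "x \<noteq> 0 \<Longrightarrow> (g has_derivative blinfun_apply (Dg x)) (at x)"
  and Dg_cont: "continuous_on (UNIV - {0}) Dg"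
  using adm unfolding admissible_norm_def by auto

lemma phi_minus: "\<phi> (- x) = \<phi> x"
  using phi_scale[of "-1" x] by simp

lemma phi_0 [simp]: "\<phi> 0 = 0"
  using phi_eq_0 by auto

lemma phi_nonneg: "0 \<le> \<phi> x"
  using phi_add[of x "- x"] phi_minus[of x] by simp

lemma phi_pos: "x \<noteq> 0 \<Longrightarrow> 0 < \<phi> x"
  using phi_nonneg[of x] phi_eq_0[of x] by linarith

lemma euler: assumes "x \<noteq> 0" shows "g x \<bullet> x = \<phi> x"
proof -
  have 1: "((\<lambda>t::real. t *\<^sub>R x) has_derivative (\<lambda>t. t *\<^sub>R x)) (at 1)"
    by (auto intro!: derivative_eq_intros)
  have "((\<lambda>t. \<phi> (t *\<^sub>R x)) has_derivative (\<lambda>t. g (1 *\<^sub>R x) \<bullet> (t *\<^sub>R x))) (at 1)"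
    by (rule has_derivative_compose[OF 1]) (use phi_deriv assms in simp)
  moreover have "((\<lambda>t. t * \<phi> x) has_derivative (\<lambda>t. t * \<phi> x)) (at 1)"
    by (auto intro!: derivative_eq_intros)
  then have "((\<lambda>t. \<phi> (t *\<^sub>R x)) has_derivative (\<lambda>t. t * \<phi> x)) (at 1)"
    by (rule has_derivative_transform_within_open[of _ _ _ _ "{0<..}"])
       (auto simp: phi_scale)
  ultimately have "(\<lambda>t. g (1 *\<^sub>R x) \<bullet> (t *\<^sub>R x)) = (\<lambda>t. t * \<phi> x)"
    by (rule has_derivative_unique)
  from fun_cong[OF this, of 1] show ?thesis by simp
qed

lemma g_scale: assumes "x \<noteq> 0" "t > 0" shows "g (t *\<^sub>R x) = g x"
proof -
  have 1: "((\<lambda>y. t *\<^sub>R y) has_derivative (\<lambda>y. t *\<^sub>R y)) (at x)"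
    by (auto intro!: derivative_eq_intros)
  have "((\<lambda>y. \<phi> (t *\<^sub>R y)) has_derivative (\<lambda>h. g (t *\<^sub>R x) \<bullet> (t *\<^sub>R h))) (at x)"
    by (rule has_derivative_compose[OF 1]) (use phi_deriv assms in simp)
  moreover have "(\<lambda>y. \<phi> (t *\<^sub>R y)) = (\<lambda>y. t * \<phi> y)"
    using assms by (auto simp: phi_scale)
  moreover have "((\<lambda>y. t * \<phi> y) has_derivative (\<lambda>h. t * (g x \<bullet> h))) (at x)"
    using phi_deriv[OF assms(1)] by (auto intro!: derivative_eq_intros)
  ultimately have "(\<lambda>h. g (t *\<^sub>R x) \<bullet> (t *\<^sub>R h)) = (\<lambda>h. t * (g x \<bullet> h))"
    by (metis has_derivative_unique)
  then have "g (t *\<^sub>R x) \<bullet> h = g x \<bullet> h" for h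
    using assms by (auto dest!: fun_cong[of _ _ h])
  then show ?thesis by (metis vector_eq_rdot)
qed

text \<open>Differentiating Euler's identity \<open>g x \<bullet> x = \<phi> x\<close> returns
  \<open>g x \<bullet> h\<close> on both sides, so the remaining term must vanish.\<close>

lemma Dg_orth: assumes "x \<noteq> 0" shows "Dg x h \<bullet> x = 0"
proof -
  have "((\<lambda>x. g x \<bullet> x) has_derivative (\<lambda>h. g x \<bullet> h + Dg x h \<bullet> x)) (at x)"
    using g_deriv[OF assms] by (auto intro!: derivative_eq_intros)
  then have "(\<phi> has_derivative (\<lambda>h. g x \<bullet> h + Dg x h \<bullet> x)) (at x)"
    by (rule has_derivative_transform_within_open[of _ _ _ _ "UNIV - {0}"])
       (use assms euler in auto)
  from has_derivative_unique[OF this phi_deriv[OF assms]] show ?thesis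
    by (auto dest!: fun_cong[of _ _ h])
qed

lemma unit_ne_0: "norm (v::'a) = 1 \<Longrightarrow> v \<noteq> 0" by auto

text \<open>The tangent inequality of the convex function \<phi> - \<gamma> |.| at v. As \<phi> is
  the support function of the Wulff shape and the right side that of the ball of radius \<gamma>
  about \<open>g v - \<gamma> *\<^sub>R v\<close>, this ball lies in the shape and touches its
  boundary at \<open>g v\<close>.\<close>

lemma phi_inner_ball:
  assumes "norm v = 1" shows "\<phi> p \<ge> g v \<bullet> p + \<gamma> * (norm p - v \<bullet> p)"
proof -
  have v: "v \<noteq> 0" using assms by auto
  have "((\<lambda>v. \<phi> v - \<gamma> * norm v) has_derivative (\<lambda>h. g v \<bullet> h - \<gamma> * (sgn v \<bullet> h))) (at v)"
    using phi_deriv[OF v] has_derivative_norm[OF v]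
    by (auto intro!: derivative_eq_intros simp: inner_commute)
  from convex_above_tangent[OF gamma_convex this, of p]
  show ?thesis using assms euler[OF v]
    by (simp add: sgn_div_norm algebra_simps dot_square_norm)
qed

lemma phi_ge: "\<phi> p \<ge> \<gamma> * norm p"
proof -
  obtain v :: 'a where v: "norm v = 1" using vector_choose_size[of 1] by auto
  show ?thesis using phi_inner_ball[OF v, of p] phi_inner_ball[OF v, of "- p"] phi_minus[of p]
    by (simp add: algebra_simps)
qed

text \<open>Adding the inner ball inequality of v at w to that of w at v leaves 2 \<gamma> (1 - v .
  w), which is \<gamma> |v - w|^2 on the sphere.\<close>

lemma g_mono:
  assumes v: "norm v = 1" and w: "norm w = 1"
  shows "(g v - g w) \<bullet> (v - w) \<ge> \<gamma> * (norm (v - w))\<^sup>2"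
proof -
  show ?thesis
    unfolding unit_dist_sq[OF v w]
    using phi_inner_ball[OF v, of w] phi_inner_ball[OF w, of v] euler[of v] euler[of w] v w
      unit_ne_0[OF v] unit_ne_0[OF w]
    by (simp add: algebra_simps inner_commute[of w v])
qed

lemma g_expand:
  assumes v: "norm v = 1" and w: "norm w = 1"
  shows "\<gamma> * norm (v - w) \<le> norm (g v - g w)"
proof -
  have "\<gamma> * norm (v - w) * norm (v - w) \<le> norm (g v - g w) * norm (v - w)"
    using g_mono[OF assms] norm_cauchy_schwarz[of "g v - g w" "v - w"]
    by (simp add: power2_eq_square algebra_simps)
  then show ?thesis by (cases "v = w") auto
qed

lemma g_cont: "continuous_on (UNIV - {0}) g"
  by (rule has_derivative_continuous_on[where f' = "\<lambda>x. blinfun_apply (Dg x)"])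
     (simp add: g_deriv has_derivative_at_withinI)

lemma g_bound: "\<exists>B>0. \<forall>v. norm v = 1 \<longrightarrow> norm (g v) \<le> B"
proof -
  have "compact (g ` sphere 0 1)"
    by (intro compact_continuous_image continuous_on_subset[OF g_cont]) auto
  from compact_imp_bounded[OF this] obtain B where "B > 0" "\<forall>y\<in>g ` sphere 0 1. norm y \<le> B"
    by (auto simp: bounded_pos)
  then show ?thesis by auto
qed

lemma g_lipschitz: "\<exists>B>0. \<forall>v w. norm v = 1 \<and> norm w = 1 \<longrightarrow> norm (g v - g w) \<le> B * norm (v - w)"
proof -
  obtain B where B: "B > 0" "\<And>v. norm v = 1 \<Longrightarrow> norm (g v) \<le> B" using g_bound by blast
  \<comment> \<open>The annulus avoids the origin, where \<open>Dg\<close> is uncontrolled; chords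
    of length at most 1/2 between unit vectors stay in it. Longer chords need only the bound B on
    |g|, as then 2 B \<le> 4 B |v - w|.\<close>
  let ?K = "cball (0::'a) 1 - ball 0 (1/2)"
  have "compact (Dg ` ?K)"
    by (intro compact_continuous_image continuous_on_subset[OF Dg_cont]) (auto intro: compact_diff)
  from compact_imp_bounded[OF this] obtain M where M: "M > 0" "\<And>x. x \<in> ?K \<Longrightarrow> norm (Dg x) \<le> M"
    by (fastforce simp: bounded_pos)
  show ?thesis
  proof (intro exI[of _ "max M (4 * B)"] conjI allI impI)
    show "max M (4 * B) > 0" using M by auto
    fix v w :: 'a assume vw: "norm v = 1 \<and> norm w = 1"
    show "norm (g v - g w) \<le> max M (4 * B) * norm (v - w)"
    proof (cases "norm (v - w) \<le> 1/2")
      case True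
      have sub: "x \<in> ?K" if x: "x \<in> closed_segment v w" for x
      proof -
        have "norm x \<le> 1"
          using closed_segment_subset[of v "cball 0 1" w] x vw by auto
        moreover have "norm (x - v) \<le> norm (w - v)" using segment_bound(1)[OF x] .
        then have "norm x \<ge> 1/2" using True vw norm_triangle_ineq2[of v "v - x"]
          by (simp add: norm_minus_commute)
        ultimately show ?thesis by auto
      qed
      have "norm (g v - g w) \<le> M * norm (v - w)"
      proof (rule differentiable_bound[of "closed_segment v w" g "\<lambda>x. blinfun_apply (Dg x)"])
        fix x assume "x \<in> closed_segment v w"
        then have x: "x \<in> ?K" by (rule sub)
        then have "x \<noteq> 0" by auto
        then show "(g has_derivative blinfun_apply (Dg x)) (at x within closed_segment v w)"
          using g_deriv has_derivative_at_withinI by blast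
        show "onorm (blinfun_apply (Dg x)) \<le> M" using M(2)[OF x] by (simp add: norm_blinfun.rep_eq)
      qed auto
      also have "\<dots> \<le> max M (4 * B) * norm (v - w)" by (intro mult_right_mono) auto
      finally show ?thesis .
    next
      case False
      have "norm (g v - g w) \<le> B + B"
        using B(2)[of v] B(2)[of w] vw norm_triangle_ineq4[of "g v" "g w"] by linarith
      also have "\<dots> \<le> 4 * B * norm (v - w)" using False B(1) by simp
      also have "\<dots> \<le> max M (4 * B) * norm (v - w)" by (intro mult_right_mono) auto
      finally show ?thesis .
    qed
  qed
qed

lemma g_inner_le: assumes "v \<noteq> 0" "p \<noteq> 0" shows "g v \<bullet> p \<le> \<phi> p"
proof -
  let ?v = "(1 / norm v) *\<^sub>R v"
  have "g ?v = g v" using g_scale[of v "1 / norm v"] assms by simp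
  moreover have "norm ?v = 1" using assms by simp
  moreover have "?v \<bullet> p \<le> norm p" using norm_cauchy_schwarz[of ?v p] \<open>norm ?v = 1\<close> by simp
  ultimately show ?thesis
    using phi_inner_ball[of ?v p] gamma_pos mult_nonneg_nonneg[of \<gamma> "norm p - ?v \<bullet> p"] by (metis add_increasing2 diff_ge_0_iff_ge dual_order.trans less_imp_le order_refl)
qed

text \<open>Counterpart of \<open>phi_inner_ball\<close>: the Wulff shape lies in a ball of radius R
  that touches it at \<open>g v\<close>. R does not depend on v because g is Lipschitz on the
  sphere.\<close>

lemma phi_outer_ball:
  "\<exists>R>0. \<forall>v p. norm v = 1 \<longrightarrow> \<phi> p \<le> g v \<bullet> p + R * (norm p - v \<bullet> p)"
proof -
  obtain B where B: "B > 0" "\<And>v w. norm v = 1 \<Longrightarrow> norm w = 1 \<Longrightarrow> norm (g v - g w) \<le> B * norm (v - w)"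
    using g_lipschitz by blast
  show ?thesis
  proof (intro exI[of _ "2 * B"] conjI allI impI)
    fix v p :: 'a assume v: "norm v = 1"
    show "\<phi> p \<le> g v \<bullet> p + 2 * B * (norm p - v \<bullet> p)"
    proof (cases "p = 0")
      case False
      obtain n q where q: "norm q = 1" "p = n *\<^sub>R q" and n: "n > 0"
        by (rule that[of "(1 / norm p) *\<^sub>R p" "norm p"]) (use False in auto)
      have ne: "q \<noteq> 0" "v \<noteq> 0" using q v by auto
      have "\<phi> q - g v \<bullet> q = (g q - g v) \<bullet> q" using euler[OF ne(1)] by (simp add: algebra_simps)
      \<comment> \<open>Inserting v makes both factors of the first product small; the second
        product is \<le> 0 because \<open>g v\<close> maximises the pairing with v over the Wulff
        shape.\<close>
      also have "\<dots> = (g q - g v) \<bullet> (q - v) + (g q - g v) \<bullet> v" by (simp add: algebra_simps)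
      also have "\<dots> \<le> norm (g q - g v) * norm (q - v)"
        using g_inner_le[OF ne] euler[OF ne(2)] norm_cauchy_schwarz[of "g q - g v" "q - v"]
        by (simp add: algebra_simps)
      also have "\<dots> \<le> B * norm (q - v) * norm (q - v)"
        using B(2)[OF q(1) v] by (intro mult_right_mono) auto
      also have "\<dots> = B * (norm (q - v))\<^sup>2" by (simp add: power2_eq_square)
      also have "(norm (q - v))\<^sup>2 = 2 * (1 - v \<bullet> q)"
        using unit_dist_sq[OF v q(1)] by (simp add: norm_minus_commute)
      finally have "\<phi> q - g v \<bullet> q \<le> B * (2 * (1 - v \<bullet> q))" .
      then have "n * (\<phi> q - g v \<bullet> q) \<le> n * (B * (2 * (1 - v \<bullet> q)))"
        using n by (intro mult_left_mono) auto
      then show ?thesis using n q by (simp add: algebra_simps phi_scale)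
    qed simp
  qed (use B in simp)
qed

text \<open>Young's theorem by second differences. The second difference of \<phi> along t h and t k
  does not depend on their order; a mean value in one direction and the expansion of g at x evaluate
  it as t^2 times either mixed derivative, up to o(t^2).\<close>

lemma Dg_symmetric:
  assumes x: "x \<noteq> 0" shows "Dg x h \<bullet> k = Dg x k \<bullet> h"
proof -
  have lin: "linear (blinfun_apply (Dg x))" by (simp add: blinfun.bounded_linear_right bounded_linear.linear)
  have key: "\<exists>t0>0. \<forall>t. 0 < t \<and> t < t0 \<longrightarrow>
      \<bar>(\<phi> (x + t *\<^sub>R h + t *\<^sub>R k) - \<phi> (x + t *\<^sub>R h) - \<phi> (x + t *\<^sub>R k) + \<phi> x) - t\<^sup>2 * (Dg x k \<bullet> h)\<bar>
        \<le> \<epsilon> * t\<^sup>2" if e: "\<epsilon> > 0" for \<epsilon> h k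
  proof -
    \<comment> \<open>M dominates the error factor |h| (2 |h| + |k|), and N below controls the size
      of the steps; adding 1 keeps both positive when h and k vanish.\<close>
    define M where "M = norm h * (2 * norm h + norm k) + 1"
    have M: "M > 0" unfolding M_def by (simp add: add_nonneg_pos)
    from has_derivative_at_alt[THEN iffD1, OF g_deriv[OF x]]
    obtain d where d: "d > 0" "\<And>y. norm (y - x) < d \<Longrightarrow> norm (g y - g x - Dg x (y - x)) \<le> \<epsilon>/M * norm (y - x)"
      using e M by (meson divide_pos_pos)
    define N where "N = norm h + norm k + 1"
    have N: "N > 0" by (simp add: N_def add_nonneg_pos)
    define t0 where "t0 = min d (norm x) / N"
    have "t0 > 0" using d x N by (auto simp: t0_def)
    moreover have "\<bar>(\<phi> (x + t *\<^sub>R h + t *\<^sub>R k) - \<phi> (x + t *\<^sub>R h) - \<phi> (x + t *\<^sub>R k) + \<phi> x) - t\<^sup>2 * (Dg x k \<bullet> h)\<bar> \<le> \<epsilon> * t\<^sup>2"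
      if t: "0 < t" "t < t0" for t
    proof -
      have tN: "t * N < d" "t * N < norm x" using t N by (auto simp: t0_def field_simps)
      have small: "norm (s *\<^sub>R h + r *\<^sub>R k) < t * N" if "0 \<le> s" "s \<le> t" "0 \<le> r" "r \<le> t" for s r
      proof -
        have "norm (s *\<^sub>R h + r *\<^sub>R k) \<le> s * norm h + r * norm k"
          using norm_triangle_ineq[of "s *\<^sub>R h" "r *\<^sub>R k"] that by simp
        also have "\<dots> \<le> t * norm h + t * norm k" using that by (intro add_mono mult_right_mono) auto
        also have "\<dots> < t * N" using t by (simp add: N_def algebra_simps)
        finally show ?thesis .
      qed
      have nz: "x + s *\<^sub>R h + r *\<^sub>R k \<noteq> 0" if "0 \<le> s" "s \<le> t" "0 \<le> r" "r \<le> t" for s r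
      proof
        assume "x + s *\<^sub>R h + r *\<^sub>R k = 0"
        then have "x = - (s *\<^sub>R h + r *\<^sub>R k)" by (metis add.assoc eq_neg_iff_add_eq_0)
        then have "norm x = norm (s *\<^sub>R h + r *\<^sub>R k)" by (metis norm_minus_cancel)
        then show False using small[OF that] tN by simp
      qed
      let ?p = "\<lambda>s. \<phi> (x + s *\<^sub>R h + t *\<^sub>R k) - \<phi> (x + s *\<^sub>R h)"
      have "\<exists>z::real. 0 < z \<and> z < t \<and> ?p t - ?p 0 = (t - 0) * ((g (x + z *\<^sub>R h + t *\<^sub>R k) - g (x + z *\<^sub>R h)) \<bullet> h)"
      proof (rule MVT2)
        show "0 < t" by fact
        fix s :: real assume s: "0 \<le> s" "s \<le> t"
        have "x + s *\<^sub>R h \<noteq> 0" "x + s *\<^sub>R h + t *\<^sub>R k \<noteq> 0"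
          using nz[of s 0] nz[of s t] s t by auto
        note D = phi_deriv[OF this(1)] phi_deriv[OF this(2)]
        have a: "((\<lambda>s. x + s *\<^sub>R h + t *\<^sub>R k) has_derivative (\<lambda>r. r *\<^sub>R h)) (at s)"
          "((\<lambda>s. x + s *\<^sub>R h) has_derivative (\<lambda>r. r *\<^sub>R h)) (at s)"
          by (auto intro!: derivative_eq_intros)
        have "(?p has_derivative (\<lambda>r. g (x + s *\<^sub>R h + t *\<^sub>R k) \<bullet> (r *\<^sub>R h) - g (x + s *\<^sub>R h) \<bullet> (r *\<^sub>R h))) (at s)"
          by (intro has_derivative_diff has_derivative_compose[OF a(1) D(2)] has_derivative_compose[OF a(2) D(1)])
        then show "(?p has_real_derivative (g (x + s *\<^sub>R h + t *\<^sub>R k) - g (x + s *\<^sub>R h)) \<bullet> h) (at s)"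
          unfolding has_field_derivative_def
          by (rule has_derivative_eq_rhs) (auto simp: algebra_simps)
      qed
      then obtain z where z: "0 < z" "z < t" and
        eq: "?p t - ?p 0 = t * ((g (x + z *\<^sub>R h + t *\<^sub>R k) - g (x + z *\<^sub>R h)) \<bullet> h)" by auto
      define r1 where "r1 = g (x + z *\<^sub>R h + t *\<^sub>R k) - g x - Dg x (z *\<^sub>R h + t *\<^sub>R k)"
      define r2 where "r2 = g (x + z *\<^sub>R h) - g x - Dg x (z *\<^sub>R h)"
      have r1: "norm r1 \<le> \<epsilon>/M * norm (z *\<^sub>R h + t *\<^sub>R k)"
        using d(2)[of "x + z *\<^sub>R h + t *\<^sub>R k"] small[of z t] z t tN by (simp add: r1_def add.assoc)
      have r2: "norm r2 \<le> \<epsilon>/M * norm (z *\<^sub>R h)"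
        using d(2)[of "x + z *\<^sub>R h"] small[of z 0] z t tN by (simp add: r2_def)
      have "norm (r1 - r2) \<le> \<epsilon>/M * (norm (z *\<^sub>R h + t *\<^sub>R k) + norm (z *\<^sub>R h))"
        using r1 r2 norm_triangle_ineq4[of r1 r2] by (simp add: algebra_simps)
      also have "\<dots> \<le> \<epsilon>/M * (t * norm h + t * norm k + t * norm h)"
        using z t e M norm_triangle_ineq[of "z *\<^sub>R h" "t *\<^sub>R k"] mult_right_mono[of z t "norm h"]
        by (intro mult_left_mono) auto
      finally have r12: "norm (r1 - r2) \<le> \<epsilon>/M * (t * (2 * norm h + norm k))" by (simp add: algebra_simps)
      have "g (x + z *\<^sub>R h + t *\<^sub>R k) - g (x + z *\<^sub>R h) = t *\<^sub>R Dg x k + (r1 - r2)"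
        by (simp add: r1_def r2_def linear_add[OF lin] linear_cmul[OF lin])
      then have "?p t - ?p 0 - t\<^sup>2 * (Dg x k \<bullet> h) = t * ((r1 - r2) \<bullet> h)"
        unfolding eq by (simp add: inner_add_left power2_eq_square distrib_left)
      then have "\<bar>?p t - ?p 0 - t\<^sup>2 * (Dg x k \<bullet> h)\<bar> \<le> t * (norm (r1 - r2) * norm h)"
        using t Cauchy_Schwarz_ineq2[of "r1 - r2" h] by (simp add: abs_mult)
      also have "\<dots> \<le> t * (\<epsilon>/M * (t * (2 * norm h + norm k)) * norm h)"
        using r12 t by (intro mult_left_mono mult_right_mono) auto
      also have "\<dots> = \<epsilon> * t\<^sup>2 * ((M - 1) / M)" by (simp add: M_def power2_eq_square)
      also have "\<dots> \<le> \<epsilon> * t\<^sup>2 * 1" using e M by (intro mult_left_mono) auto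
      finally show ?thesis by (simp add: algebra_simps)
    qed
    ultimately show ?thesis by blast
  qed
  have "\<bar>Dg x k \<bullet> h - Dg x h \<bullet> k\<bar> \<le> \<epsilon>" if "\<epsilon> > 0" for \<epsilon>
  proof -
    obtain t1 where t1: "t1 > 0" "\<And>t. 0 < t \<Longrightarrow> t < t1 \<Longrightarrow> 
      \<bar>(\<phi> (x + t *\<^sub>R h + t *\<^sub>R k) - \<phi> (x + t *\<^sub>R h) - \<phi> (x + t *\<^sub>R k) + \<phi> x) - t\<^sup>2 * (Dg x k \<bullet> h)\<bar> \<le> \<epsilon>/2 * t\<^sup>2"
      using key[of "\<epsilon>/2" h k] \<open>\<epsilon> > 0\<close> by auto
    obtain t2 where t2: "t2 > 0" "\<And>t. 0 < t \<Longrightarrow> t < t2 \<Longrightarrow> 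
      \<bar>(\<phi> (x + t *\<^sub>R k + t *\<^sub>R h) - \<phi> (x + t *\<^sub>R k) - \<phi> (x + t *\<^sub>R h) + \<phi> x) - t\<^sup>2 * (Dg x h \<bullet> k)\<bar> \<le> \<epsilon>/2 * t\<^sup>2"
      using key[of "\<epsilon>/2" k h] \<open>\<epsilon> > 0\<close> by auto
    define t where "t = min t1 t2 / 2"
    have t: "0 < t" "t < t1" "t < t2" using t1 t2 by (auto simp: t_def)
    have comm: "x + t *\<^sub>R k + t *\<^sub>R h = x + t *\<^sub>R h + t *\<^sub>R k" by (simp add: algebra_simps)
    have "\<bar>t\<^sup>2 * (Dg x k \<bullet> h) - t\<^sup>2 * (Dg x h \<bullet> k)\<bar> \<le> \<epsilon> * t\<^sup>2"
      using t1(2)[OF t(1,2)] t2(2)[OF t(1,3)] unfolding comm by linarith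
    then have "t\<^sup>2 * \<bar>Dg x k \<bullet> h - Dg x h \<bullet> k\<bar> \<le> t\<^sup>2 * \<epsilon>"
      by (simp only: right_diff_distrib[symmetric] abs_mult abs_power2 mult.commute)
    then show ?thesis using t by simp
  qed
  then have "\<bar>Dg x k \<bullet> h - Dg x h \<bullet> k\<bar> \<le> 0" by (rule field_le_epsilon) simp
  then show ?thesis by simp
qed

end

section \<open>Dual norm and anisotropic nearest points\<close>

text \<open>Compactness: coercivity of N bounds the nearest points of a convergent sequence, and
  every limit of them is nearest to the limit point, hence equal to a. N and d are left general so
  that the lemma serves both the Euclidean and the anisotropic distance.\<close>

lemma nearest_point_continuity:
  fixes A :: "'a::euclidean_space set"
  assumes A: "closed A" and N: "continuous_on UNIV N" and m: "m > 0" "\<And>x. m * norm x \<le> N x"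
    and d: "continuous_on UNIV d" and uniq: "\<And>c. c \<in> A \<Longrightarrow> N (x0 - c) = d x0 \<Longrightarrow> c = a"
    and e: "\<epsilon> > 0"
  shows "\<exists>\<delta>>0. \<forall>y c. c \<in> A \<and> N (y - c) = d y \<and> norm (y - x0) < \<delta> \<longrightarrow> norm (c - a) < \<epsilon>"
proof (rule ccontr)
  assume "\<not> ?thesis"
  then have "\<forall>n::nat. \<exists>y c. c \<in> A \<and> N (y - c) = d y \<and> norm (y - x0) < inverse (Suc n) \<and> \<not> norm (c - a) < \<epsilon>"
    by (metis inverse_positive_iff_positive of_nat_0_less_iff zero_less_Suc)
  then obtain y c where yc: "\<And>n. c n \<in> A" "\<And>n. N (y n - c n) = d (y n)"
    "\<And>n::nat. norm (y n - x0) < inverse (Suc n)" "\<And>n. \<not> norm (c n - a) < \<epsilon>" by metis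
  have ylim: "y \<longlonglongrightarrow> x0"
  proof -
    have "(\<lambda>n. norm (y n - x0)) \<longlonglongrightarrow> 0"
      by (rule real_tendsto_sandwich[OF _ _ tendsto_const LIMSEQ_inverse_real_of_nat])
         (use less_imp_le[OF yc(3)] in auto)
    then show ?thesis using LIM_zero_iff tendsto_norm_zero_iff by blast
  qed
  have dlim: "(\<lambda>n. d (y n)) \<longlonglongrightarrow> d x0"
    by (rule isCont_tendsto_compose[OF _ ylim]) (use d in \<open>simp add: continuous_on_eq_continuous_at\<close>)
  obtain B where B: "\<And>n. \<bar>d (y n)\<bar> \<le> B"
    using convergent_imp_Bseq[OF convergentI[OF dlim]] by (auto simp: Bseq_def)
  have "norm (c n) \<le> norm x0 + 1 + B / m" for n
  proof -
    have "m * norm (y n - c n) \<le> B" using m(2)[of "y n - c n"] yc(2)[of n] B[of n] by linarith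
    then have "norm (y n - c n) \<le> B / m" using m(1) by (simp add: field_simps)
    moreover have "inverse (real (Suc n)) \<le> 1" by (simp add: field_simps)
    then have "norm (y n - x0) \<le> 1" using yc(3)[of n] by linarith
    ultimately show ?thesis using norm_triangle_ineq4[of "y n" "y n - c n"] norm_triangle_ineq2[of "y n" x0]
      by simp
  qed
  then have "bounded (range c)" by (auto simp: bounded_iff)
  then obtain l r where r: "strict_mono (r::nat \<Rightarrow> nat)" and l: "(c \<circ> r) \<longlonglongrightarrow> l"
    using bounded_imp_convergent_subsequence by blast
  have lA: "l \<in> A" using A l yc(1) by (metis closed_sequentially comp_apply)
  have "(\<lambda>n. y (r n) - c (r n)) \<longlonglongrightarrow> x0 - l"
    using LIMSEQ_subseq_LIMSEQ[OF ylim r] l by (auto intro!: tendsto_diff simp: o_def)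
  then have "(\<lambda>n. N (y (r n) - c (r n))) \<longlonglongrightarrow> N (x0 - l)"
    by (rule isCont_tendsto_compose[rotated]) (use N in \<open>simp add: continuous_on_eq_continuous_at\<close>)
  moreover have "(\<lambda>n. N (y (r n) - c (r n))) \<longlonglongrightarrow> d x0"
    using LIMSEQ_subseq_LIMSEQ[OF dlim r] yc(2) by (simp add: o_def)
  ultimately have "N (x0 - l) = d x0" using LIMSEQ_unique by blast
  then have "l = a" using uniq lA by blast
  then have "eventually (\<lambda>n. norm (c (r n) - a) < \<epsilon>) sequentially"
    using l e by (auto simp: tendsto_iff dist_norm o_def)
  then show False using yc(4) by (auto simp: eventually_sequentially)
qed

context wulff_norm
begin

lemma ex_phi_1: "\<exists>v. \<phi> v = 1"
proof -
  obtain v :: 'a where "norm v = 1" using vector_choose_size[of 1] by auto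
  then have "v \<noteq> 0" by auto
  then have "\<phi> ((1 / \<phi> v) *\<^sub>R v) = 1" using phi_pos[of v] by (simp add: phi_scale)
  then show ?thesis by blast
qed

lemma norm_le_phi: "norm v \<le> \<phi> v / \<gamma>"
  using phi_ge[of v] gamma_pos by (simp add: field_simps)

lemma dual_upper: assumes "\<phi> v = 1" shows "v \<bullet> x \<le> dual_norm \<phi> x"
  unfolding dual_norm_def
proof (rule cSup_upper)
  show "bdd_above {v \<bullet> x |v. \<phi> v = 1}"
  proof (rule bdd_aboveI)
    fix y assume "y \<in> {v \<bullet> x |v. \<phi> v = 1}"
    then obtain v where "y = v \<bullet> x" "\<phi> v = 1" by auto
    then show "y \<le> 1 / \<gamma> * norm x"
      using norm_cauchy_schwarz[of v x] norm_le_phi[of v] mult_right_mono[of "norm v" "1 / \<gamma>" "norm x"]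
      by simp
  qed
qed (use assms in auto)

lemma inner_le_dual: "v \<bullet> x \<le> \<phi> v * dual_norm \<phi> x"
proof (cases "v = 0")
  case False
  then have p: "\<phi> v > 0" by (rule phi_pos)
  then have "\<phi> ((1 / \<phi> v) *\<^sub>R v) = 1" by (simp add: phi_scale)
  from dual_upper[OF this, of x] p show ?thesis by (simp add: field_simps)
qed simp

lemma dual_leI: assumes "\<And>v. v \<bullet> x \<le> t * \<phi> v" shows "dual_norm \<phi> x \<le> t"
  unfolding dual_norm_def
proof (rule cSup_least)
  show "{v \<bullet> x |v. \<phi> v = 1} \<noteq> {}" using ex_phi_1 by auto
  fix y assume "y \<in> {v \<bullet> x |v. \<phi> v = 1}"
  then obtain v where "\<phi> v = 1" "y = v \<bullet> x" by auto
  then show "y \<le> t" using assms[of v] by simp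
qed

lemma dual_0 [simp]: "dual_norm \<phi> 0 = 0"
proof (rule antisym)
  show "dual_norm \<phi> 0 \<le> 0" by (rule dual_leI) simp
  obtain v where "\<phi> v = 1" using ex_phi_1 by blast
  from dual_upper[OF this, of 0] show "0 \<le> dual_norm \<phi> 0" by simp
qed

lemma dual_add: "dual_norm \<phi> (x + y) \<le> dual_norm \<phi> x + dual_norm \<phi> y"
proof (rule dual_leI)
  fix v show "v \<bullet> (x + y) \<le> (dual_norm \<phi> x + dual_norm \<phi> y) * \<phi> v"
    using inner_le_dual[of v x] inner_le_dual[of v y] by (simp add: algebra_simps)
qed

lemma dual_minus [simp]: "dual_norm \<phi> (- x) = dual_norm \<phi> x"
proof -
  have "dual_norm \<phi> (- x) \<le> dual_norm \<phi> x" for x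
    by (rule dual_leI) (use inner_le_dual[of "- _" x] phi_minus in \<open>simp add: mult.commute\<close>)
  from this[of x] this[of "- x"] show ?thesis by simp
qed

lemma dual_scale: assumes "t \<ge> 0" shows "dual_norm \<phi> (t *\<^sub>R x) = t * dual_norm \<phi> x"
proof (cases "t = 0")
  case False
  have le: "dual_norm \<phi> (t *\<^sub>R x) \<le> t * dual_norm \<phi> x" if "t > 0" for t x
  proof (rule dual_leI)
    fix v show "v \<bullet> (t *\<^sub>R x) \<le> t * dual_norm \<phi> x * \<phi> v"
      using mult_left_mono[OF inner_le_dual[of v x], of t] that by (simp add: algebra_simps)
  qed
  have t: "t > 0" using False assms by simp
  have "dual_norm \<phi> x \<le> (1 / t) * dual_norm \<phi> (t *\<^sub>R x)" using le[of "1 / t" "t *\<^sub>R x"] t by simp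
  then have "t * dual_norm \<phi> x \<le> dual_norm \<phi> (t *\<^sub>R x)" using t by (simp add: field_simps)
  then show ?thesis using le[OF t, of x] by linarith
qed simp

lemma dual_le_norm: "dual_norm \<phi> x \<le> norm x / \<gamma>"
proof (rule dual_leI)
  fix v have "v \<bullet> x \<le> norm v * norm x" by (rule norm_cauchy_schwarz)
  also have "\<dots> \<le> \<phi> v / \<gamma> * norm x" using norm_le_phi by (intro mult_right_mono) auto
  finally show "v \<bullet> x \<le> norm x / \<gamma> * \<phi> v" by (simp add: algebra_simps)
qed

lemma phi_le_norm: "\<exists>B>0. \<forall>x. \<phi> x \<le> B * norm x"
proof -
  obtain B where B: "B > 0" "\<And>v. norm v = 1 \<Longrightarrow> norm (g v) \<le> B" using g_bound by blast
  have "\<phi> x \<le> B * norm x" for x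
  proof (cases "x = 0")
    case False
    have "g ((1 / norm x) *\<^sub>R x) = g x" using g_scale[of x "1 / norm x"] False by simp
    then have "norm (g x) \<le> B" using B(2)[of "(1 / norm x) *\<^sub>R x"] False by simp
    then show ?thesis using euler[OF False] norm_cauchy_schwarz[of "g x" x] mult_right_mono[of "norm (g x)" B "norm x"]
      by simp
  qed simp
  with B(1) show ?thesis by blast
qed

lemma dual_ge_norm: "\<exists>m>0. \<forall>x. m * norm x \<le> dual_norm \<phi> x"
proof -
  obtain B where B: "B > 0" "\<And>x. \<phi> x \<le> B * norm x" using phi_le_norm by blast
  have "1 / B * norm x \<le> dual_norm \<phi> x" for x
  proof (cases "x = 0")
    case False
    have "norm x * norm x \<le> \<phi> x * dual_norm \<phi> x" using inner_le_dual[of x x] by (simp add: dot_square_norm power2_eq_square)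
    moreover have d: "dual_norm \<phi> x > 0"
    proof -
      have "0 < x \<bullet> x" using False by simp
      then have "0 < \<phi> x * dual_norm \<phi> x" using inner_le_dual[of x x] by linarith
      then show ?thesis using phi_pos[OF False] by (simp add: zero_less_mult_iff)
    qed
    moreover have "\<phi> x * dual_norm \<phi> x \<le> B * norm x * dual_norm \<phi> x"
      by (rule mult_right_mono[OF B(2) less_imp_le[OF d]])
    ultimately have "norm x * norm x \<le> B * norm x * dual_norm \<phi> x" by linarith
    then have "norm x * norm x \<le> norm x * (B * dual_norm \<phi> x)" by (simp add: ac_simps)
    then have "norm x \<le> B * dual_norm \<phi> x" using False by simp
    then show ?thesis using B(1) by (simp add: field_simps)
  qed simp
  then show ?thesis using B(1) by (metis zero_less_divide_1_iff)
qed

lemma dual_nonneg [simp]: "0 \<le> dual_norm \<phi> x"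
  using dual_ge_norm by (metis mult_nonneg_nonneg norm_ge_zero order_trans less_imp_le)

lemma dual_pos: "x \<noteq> 0 \<Longrightarrow> 0 < dual_norm \<phi> x"
  using dual_ge_norm by (metis less_le_trans mult_pos_pos zero_less_norm_iff)

lemma dual_diff_le: "dual_norm \<phi> x - dual_norm \<phi> y \<le> norm (x - y) / \<gamma>"
  using dual_add[of "x - y" y] dual_le_norm[of "x - y"] by simp

lemma dual_cont: "continuous_on UNIV (dual_norm \<phi>)"
proof -
  have "(1 / \<gamma>)-lipschitz_on UNIV (dual_norm \<phi>)"
  proof (rule lipschitz_onI)
    fix x y show "dist (dual_norm \<phi> x) (dual_norm \<phi> y) \<le> 1 / \<gamma> * dist x y"
      using dual_diff_le[of x y] dual_diff_le[of y x]
      by (simp add: dist_norm norm_minus_commute[of y x] abs_le_iff)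
  qed (use gamma_pos in simp)
  then show ?thesis by (rule lipschitz_on_continuous_on)
qed

lemma phi_cont_sphere: "continuous_on (sphere 0 1) \<phi>"
  by (rule has_derivative_continuous_on[where f' = "\<lambda>x h. g x \<bullet> h"])
     (metis phi_deriv has_derivative_at_withinI mem_sphere_0 norm_zero zero_neq_one)

text \<open>The supporting direction is sought on the Euclidean sphere because it will serve as a
  Euclidean unit normal.\<close>

lemma dual_attained: "\<exists>v. norm v = 1 \<and> v \<bullet> x = \<phi> v * dual_norm \<phi> x"
proof -
  let ?F = "\<lambda>v. \<phi> v * dual_norm \<phi> x - v \<bullet> x"
  have "sphere (0::'a) 1 \<noteq> {}" by simp
  then have "\<exists>v\<in>sphere 0 1. \<forall>w\<in>sphere 0 1. ?F v \<le> ?F w"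
    by (intro continuous_attains_inf) (auto intro!: continuous_intros phi_cont_sphere)
  then obtain v where v: "norm v = 1" "\<And>w. norm w = 1 \<Longrightarrow> ?F v \<le> ?F w" by auto
  obtain B where B: "B > 0" "\<And>x. \<phi> x \<le> B * norm x" using phi_le_norm by blast
  have "?F v \<le> 0"
  proof (rule ccontr)
    assume "\<not> ?F v \<le> 0"
    then have pos: "?F v > 0" by simp
    \<comment> \<open>A positive minimum could, by \<phi> \<le> B on the unit sphere, be split off
      as a multiple of \<phi>, and the dual norm could be lowered by
      \<open>?F v / B\<close>.\<close>
    have "dual_norm \<phi> x \<le> dual_norm \<phi> x - ?F v / B"
    proof (rule dual_leI)
      fix p :: 'a
      show "p \<bullet> x \<le> (dual_norm \<phi> x - ?F v / B) * \<phi> p"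
      proof (cases "p = 0")
        case False
        obtain n q where q: "norm q = 1" "p = n *\<^sub>R q" and n: "n > 0"
          by (rule that[of "(1 / norm p) *\<^sub>R p" "norm p"]) (use False in auto)
        have "?F v / B * \<phi> q \<le> ?F v / B * B"
          using B(2)[of q] q pos B(1) by (intro mult_left_mono) auto
        then have "q \<bullet> x \<le> (dual_norm \<phi> x - ?F v / B) * \<phi> q"
        proof -
          have "q \<bullet> x \<le> \<phi> q * dual_norm \<phi> x - ?F v" using v(2)[OF q(1)] by linarith
          also have "\<dots> \<le> \<phi> q * dual_norm \<phi> x - ?F v / B * \<phi> q"
            using \<open>?F v / B * \<phi> q \<le> ?F v / B * B\<close> B(1) by simp
          finally show ?thesis by (simp add: left_diff_distrib mult.commute[of "\<phi> q"])
        qed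
        then have "n * (q \<bullet> x) \<le> n * ((dual_norm \<phi> x - ?F v / B) * \<phi> q)" using n by simp
        then show ?thesis unfolding q(2) using n by (simp add: phi_scale mult.left_commute)
      qed simp
    qed
    then show False using pos B(1) by (simp add: field_simps)
  qed
  then show ?thesis using v(1) inner_le_dual[of v x] by (intro exI[of _ v]) auto
qed

text \<open>\<phi> p - p . x is nonnegative and vanishes at p = v, so its derivative vanishes there.
  Differentiability of \<phi> thus acts as strict convexity of the Wulff shape.\<close>

lemma support_point_unique:
  assumes v: "norm v = 1" and x: "v \<bullet> x = \<phi> v" "dual_norm \<phi> x \<le> 1" shows "x = g v"
proof -
  have v0: "v \<noteq> 0" using v by auto
  have ge: "\<phi> p - p \<bullet> x \<ge> 0" for p
    using inner_le_dual[of p x] mult_left_mono[OF x(2) phi_nonneg[of p]] by simp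
  have "((\<lambda>p. \<phi> p - p \<bullet> x) has_derivative (\<lambda>h. g v \<bullet> h - h \<bullet> x)) (at v)"
    using phi_deriv[OF v0] by (auto intro!: derivative_eq_intros)
  then have "(\<lambda>h. g v \<bullet> h - h \<bullet> x) = (\<lambda>h. 0)"
    by (rule has_derivative_local_min) (use ge x in simp)
  then have "g v \<bullet> h = x \<bullet> h" for h by (auto dest!: fun_cong[of _ _ h] simp: inner_commute)
  then show ?thesis by (metis vector_eq_rdot)
qed

lemma dual_g: assumes "v \<noteq> 0" shows "dual_norm \<phi> (g v) = 1"
proof (rule antisym)
  show "dual_norm \<phi> (g v) \<le> 1"
  proof (rule dual_leI)
    fix p show "p \<bullet> g v \<le> 1 * \<phi> p"
      using g_inner_le[OF assms, of p] by (cases "p = 0") (auto simp: inner_commute)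
  qed
  have "\<phi> v * 1 \<le> \<phi> v * dual_norm \<phi> (g v)" using inner_le_dual[of v "g v"] euler[OF assms]
    by (simp add: inner_commute)
  then show "1 \<le> dual_norm \<phi> (g v)" using phi_pos[OF assms] by simp
qed

lemma dual_eq_1E:
  assumes "dual_norm \<phi> x = 1" obtains v where "norm v = 1" "x = g v"
  using dual_attained[of x] support_point_unique assms by (metis mult.right_neutral order_refl)

lemma Wulff_inner_ball:
  assumes v: "norm v = 1" and z: "norm (z - (g v - \<gamma> *\<^sub>R v)) < \<gamma>"
  shows "dual_norm \<phi> z < 1"
proof -
  obtain p where p: "norm p = 1" "p \<bullet> z = \<phi> p * dual_norm \<phi> z" using dual_attained by blast
  have "p \<bullet> z = p \<bullet> (z - (g v - \<gamma> *\<^sub>R v)) + g v \<bullet> p - \<gamma> * (v \<bullet> p)"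
    by (simp add: inner_diff_right inner_commute)
  also have "\<dots> < \<gamma> + g v \<bullet> p - \<gamma> * (v \<bullet> p)"
    using norm_cauchy_schwarz[of p "z - (g v - \<gamma> *\<^sub>R v)"] z p by simp
  also have "\<dots> \<le> \<phi> p" using phi_inner_ball[OF v, of p] p by (simp add: algebra_simps)
  finally have "\<phi> p * dual_norm \<phi> z < \<phi> p * 1" using p by simp
  moreover have "\<phi> p > 0" using p by (intro phi_pos) auto
  ultimately show ?thesis by simp
qed

lemma Wulff_outer_ball:
  "\<exists>R>0. \<forall>v z. norm v = 1 \<and> dual_norm \<phi> z \<le> 1 \<longrightarrow> norm (z - (g v - R *\<^sub>R v)) \<le> R"
proof -
  obtain R where R: "R > 0" "\<And>v p. norm v = 1 \<Longrightarrow> \<phi> p \<le> g v \<bullet> p + R * (norm p - v \<bullet> p)"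
    using phi_outer_ball by blast
  have "norm (z - (g v - R *\<^sub>R v)) \<le> R" if v: "norm v = 1" and z: "dual_norm \<phi> z \<le> 1" for v z
  proof -
    \<comment> \<open>Testing the support inequality with the deviation from the centre of the ball
      turns it into |p|^2 \<le> R |p|.\<close>
    define p where "p = z - (g v - R *\<^sub>R v)"
    have "p \<bullet> z \<le> \<phi> p" using inner_le_dual[of p z] mult_left_mono[OF z phi_nonneg[of p]] by simp
    moreover have "p \<bullet> p = p \<bullet> z - g v \<bullet> p + R * (v \<bullet> p)"
    proof -
      have "p \<bullet> p = p \<bullet> (z - (g v - R *\<^sub>R v))" by (simp only: p_def)
      then show ?thesis by (simp add: inner_diff_right inner_commute)
    qed
    ultimately have "norm p * norm p \<le> R * norm p" using R(2)[OF v, of p]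
      by (simp add: dot_square_norm power2_eq_square algebra_simps)
    then show ?thesis using R(1) by (cases "p = 0") (auto simp: p_def)
  qed
  with R(1) show ?thesis by blast
qed

lemma g_in_frontier_Wulff: assumes "v \<noteq> 0" shows "g v \<in> frontier (Wulff \<phi>)"
proof -
  have "g v \<notin> interior (Wulff \<phi>)"
  proof
    assume "g v \<in> interior (Wulff \<phi>)"
    then obtain e where e: "e > 0" "ball (g v) e \<subseteq> Wulff \<phi>" by (auto simp: mem_interior)
    define t where "t = e / (2 * norm (g v))"
    have g0: "g v \<noteq> 0" using dual_g[OF assms] by auto
    then have t: "t > 0" using e by (simp add: t_def)
    have "norm (t *\<^sub>R g v) < e" using e g0 t by (simp add: t_def)
    then have "(1 + t) *\<^sub>R g v \<in> Wulff \<phi>"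
      using e(2) by (auto simp: dist_norm algebra_simps subset_iff)
    then show False using t dual_scale[of "1 + t" "g v"] dual_g[OF assms] by (simp add: Wulff_def)
  qed
  moreover have "g v \<in> closure (Wulff \<phi>)"
    using closure_subset[of "Wulff \<phi>"] dual_g[OF assms] by (auto simp: Wulff_def)
  ultimately show ?thesis by (simp add: frontier_def)
qed

text \<open>For uniqueness, a competing normal w satisfies \<phi> w \<le> g v . w, so the term
  \<gamma> (1 - v . w) of the inner ball inequality cannot be positive. With this lemma the
  eigenvectors tested in \<open>aNor_n\<close> become vectors orthogonal to u.\<close>

lemma Wnormal_g: assumes v: "norm v = 1" shows "Wnormal \<phi> (g v) = v"
  unfolding Wnormal_def
proof (rule the_equality)
  have v0: "v \<noteq> 0" using v by auto
  show "norm v = 1 \<and> (\<forall>y\<in>Wulff \<phi>. v \<bullet> (y - g v) \<le> 0)"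
  proof (intro conjI ballI v)
    fix y assume "y \<in> Wulff \<phi>"
    then have "v \<bullet> y \<le> \<phi> v" using inner_le_dual[of v y] mult_left_mono[of "dual_norm \<phi> y" 1 "\<phi> v"] phi_nonneg
      by (fastforce simp: Wulff_def)
    then show "v \<bullet> (y - g v) \<le> 0" using euler[OF v0] by (simp add: inner_diff_right inner_commute)
  qed
  fix w assume w: "norm w = 1 \<and> (\<forall>y\<in>Wulff \<phi>. w \<bullet> (y - g v) \<le> 0)"
  then have w0: "w \<noteq> 0" by auto
  have "g w \<in> Wulff \<phi>" using dual_g[OF w0] by (simp add: Wulff_def)
  then have "\<phi> w \<le> g v \<bullet> w" using w euler[OF w0] by (auto simp: inner_diff_right inner_commute)
  then have "\<gamma> * (1 - v \<bullet> w) \<le> 0" using phi_inner_ball[OF v, of w] w by simp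
  then have "v \<bullet> w \<ge> 1" using gamma_pos by (simp add: mult_le_0_iff)
  then have "(norm (v - w))\<^sup>2 \<le> 0" using unit_dist_sq[OF v, of w] w by simp
  then show "w = v" by simp
qed

section \<open>Anisotropic distance to a closed set\<close>

context
  fixes A :: "'a set"
  assumes A: "closed A" "A \<noteq> {}"
begin

lemma adist_le: "c \<in> A \<Longrightarrow> adist \<phi> A x \<le> dual_norm \<phi> (x - c)"
  unfolding adist_def by (intro cINF_lower bdd_belowI[of _ 0]) auto

lemma adist_greatest: "(\<And>c. c \<in> A \<Longrightarrow> t \<le> dual_norm \<phi> (x - c)) \<Longrightarrow> t \<le> adist \<phi> A x"
  unfolding adist_def using A by (intro cINF_greatest) auto

lemma adist_eqI:
  "c \<in> A \<Longrightarrow> dual_norm \<phi> (x - c) = s \<Longrightarrow> (\<And>z. z \<in> A \<Longrightarrow> s \<le> dual_norm \<phi> (x - z)) \<Longrightarrow> adist \<phi> A x = s"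
  using adist_le adist_greatest by (metis antisym)

lemma aproj_nonempty: "aproj \<phi> A x \<noteq> {}"
proof -
  obtain m where m: "m > 0" "\<And>x. m * norm x \<le> dual_norm \<phi> x" using dual_ge_norm by blast
  obtain c0 where c0: "c0 \<in> A" using A by blast
  let ?K = "A \<inter> cball x (dual_norm \<phi> (x - c0) / m)"
  have in_K: "c \<in> ?K" if "c \<in> A" "dual_norm \<phi> (x - c) \<le> dual_norm \<phi> (x - c0)" for c
    using that m(2)[of "x - c"] m(1) by (simp add: dist_norm field_simps)
  have "compact ?K" using A by (simp add: closed_Int_compact)
  moreover have "continuous_on ?K (\<lambda>c. dual_norm \<phi> (x - c))"
    by (rule continuous_on_compose2[OF dual_cont]) (auto intro!: continuous_intros)
  ultimately obtain c where c: "c \<in> ?K" "\<And>c'. c' \<in> ?K \<Longrightarrow> dual_norm \<phi> (x - c) \<le> dual_norm \<phi> (x - c')"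
    using continuous_attains_inf[of ?K] in_K[OF c0] by blast
  have "dual_norm \<phi> (x - c) \<le> dual_norm \<phi> (x - z)" if "z \<in> A" for z
    using c(2)[OF in_K[OF that]] c(2)[OF in_K[OF c0 order_refl]] by linarith
  then have "adist \<phi> A x = dual_norm \<phi> (x - c)" using c(1) by (intro adist_eqI) auto
  then show ?thesis using c(1) by (auto simp: aproj_def)
qed

lemma adist_triangle: "adist \<phi> A x \<le> adist \<phi> A y + dual_norm \<phi> (x - y)"
proof -
  have "adist \<phi> A x - dual_norm \<phi> (x - y) \<le> adist \<phi> A y"
  proof (rule adist_greatest)
    fix c assume "c \<in> A"
    from adist_le[OF this, of x] dual_add[of "x - y" "y - c"]
    show "adist \<phi> A x - dual_norm \<phi> (x - y) \<le> dual_norm \<phi> (y - c)" by simp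
  qed
  then show ?thesis by simp
qed

lemma adist_lipschitz: "\<bar>adist \<phi> A x - adist \<phi> A y\<bar> \<le> norm (x - y) / \<gamma>"
  using adist_triangle[of x y] adist_triangle[of y x] dual_le_norm[of "x - y"] dual_le_norm[of "y - x"]
  by (simp add: norm_minus_commute[of y x] abs_le_iff)

lemma adist_cont: "continuous_on UNIV (adist \<phi> A)"
proof -
  have "(1 / \<gamma>)-lipschitz_on UNIV (adist \<phi> A)"
    by (rule lipschitz_onI) (use adist_lipschitz gamma_pos in \<open>auto simp: dist_norm\<close>)
  then show ?thesis by (rule lipschitz_on_continuous_on)
qed

lemma adist_pos: assumes "x \<notin> A" shows "0 < adist \<phi> A x"
proof -
  obtain c where c: "c \<in> aproj \<phi> A x" using aproj_nonempty by blast
  then have "x - c \<noteq> 0" using assms by (auto simp: aproj_def)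
  from dual_pos[OF this] c show ?thesis by (simp add: aproj_def)
qed

lemma adist_shorten:
  assumes a: "a \<in> A" and eta: "dual_norm \<phi> \<eta> = 1" and s: "adist \<phi> A (a + s *\<^sub>R \<eta>) = s"
    and t: "0 \<le> t" "t \<le> s"
  shows "adist \<phi> A (a + t *\<^sub>R \<eta>) = t"
proof (rule adist_eqI[OF a])
  show "dual_norm \<phi> (a + t *\<^sub>R \<eta> - a) = t" using eta t by (simp add: dual_scale)
  fix z assume z: "z \<in> A"
  have "s \<le> dual_norm \<phi> ((s - t) *\<^sub>R \<eta> + (a + t *\<^sub>R \<eta> - z))"
    using adist_le[OF z, of "a + s *\<^sub>R \<eta>"] s by (simp add: algebra_simps)
  also have "\<dots> \<le> (s - t) + dual_norm \<phi> (a + t *\<^sub>R \<eta> - z)"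
    using dual_add[of "(s - t) *\<^sub>R \<eta>" "a + t *\<^sub>R \<eta> - z"] eta t by (simp add: dual_scale)
  finally show "t \<le> dual_norm \<phi> (a + t *\<^sub>R \<eta> - z)" by simp
qed

text \<open>Equality in the triangle inequality: a direction v attaining the dual norm of a + s
  \<eta> - c must support both \<eta> and (a + t \<eta> - c) / t. Support points are unique, so both
  equal \<open>g v\<close>, and c = a.\<close>

lemma aproj_unique:
  assumes a: "a \<in> A" and eta: "dual_norm \<phi> \<eta> = 1" and s: "adist \<phi> A (a + s *\<^sub>R \<eta>) = s"
    and t: "0 < t" "t < s"
  shows "aproj \<phi> A (a + t *\<^sub>R \<eta>) = {a}"
proof -
  have ad: "adist \<phi> A (a + t *\<^sub>R \<eta>) = t" using adist_shorten[OF a eta s] t by simp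
  have "c = a" if "c \<in> A" and c: "dual_norm \<phi> (a + t *\<^sub>R \<eta> - c) = t" for c
  proof -
    let ?z = "a + t *\<^sub>R \<eta> - c"
    have z: "dual_norm \<phi> ?z = t" using c .
    obtain v where v: "norm v = 1" "v \<bullet> (a + s *\<^sub>R \<eta> - c) = \<phi> v * dual_norm \<phi> (a + s *\<^sub>R \<eta> - c)"
      using dual_attained by blast
    have pv: "\<phi> v > 0" using v by (intro phi_pos) auto
    have "s \<le> dual_norm \<phi> (a + s *\<^sub>R \<eta> - c)" using adist_le[OF \<open>c \<in> A\<close>, of "a + s *\<^sub>R \<eta>"] s by simp
    then have "\<phi> v * s \<le> v \<bullet> (a + s *\<^sub>R \<eta> - c)" using v(2) pv by simp
    also have "v \<bullet> (a + s *\<^sub>R \<eta> - c) = (s - t) * (v \<bullet> \<eta>) + v \<bullet> ?z"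
      by (simp add: algebra_simps)
    finally have sum: "\<phi> v * s \<le> (s - t) * (v \<bullet> \<eta>) + v \<bullet> ?z" .
    have le1: "v \<bullet> \<eta> \<le> \<phi> v" using inner_le_dual[of v \<eta>] eta by simp
    have le2: "v \<bullet> ?z \<le> \<phi> v * t" using inner_le_dual[of v ?z] z by simp
    have "(s - t) * (v \<bullet> \<eta>) \<le> (s - t) * \<phi> v" using le1 t by simp
    then have "v \<bullet> ?z = \<phi> v * t" and "(s - t) * (v \<bullet> \<eta>) = (s - t) * \<phi> v"
      using sum le2 by (auto simp: algebra_simps)
    then have e1: "v \<bullet> \<eta> = \<phi> v" and e2: "v \<bullet> ((1 / t) *\<^sub>R ?z) = \<phi> v" using t
      by (auto simp del: inner_simps simp add: inner_scaleR_right)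
    have "\<eta> = g v" using support_point_unique[OF v(1) e1] eta by simp
    moreover have "(1 / t) *\<^sub>R ?z = g v"
      by (rule support_point_unique[OF v(1) e2]) (use z t dual_scale[of "1 / t" ?z] in simp)
    ultimately have "(1 / t) *\<^sub>R ?z = \<eta>" by simp
    then have "t *\<^sub>R ((1 / t) *\<^sub>R ?z) = t *\<^sub>R \<eta>" by simp
    then show "c = a" using t by simp
  qed
  then show ?thesis using a ad eta t by (auto simp: aproj_def dual_scale)
qed

lemma aproj_tendsto:
  assumes "aproj \<phi> A x0 = {a}" "\<epsilon> > 0"
  shows "\<exists>\<delta>>0. \<forall>y c. c \<in> aproj \<phi> A y \<and> norm (y - x0) < \<delta> \<longrightarrow> norm (c - a) < \<epsilon>"
proof -
  obtain m where m: "m > 0" "\<And>x. m * norm x \<le> dual_norm \<phi> x" using dual_ge_norm by blast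
  have "\<exists>\<delta>>0. \<forall>y c. c \<in> A \<and> dual_norm \<phi> (y - c) = adist \<phi> A y \<and> norm (y - x0) < \<delta> \<longrightarrow> norm (c - a) < \<epsilon>"
    by (rule nearest_point_continuity[OF A(1) dual_cont m adist_cont _ assms(2)])
       (use assms(1) in \<open>auto simp: aproj_def\<close>)
  then show ?thesis by (auto simp: aproj_def)
qed

end

end

section \<open>Sets of positive reach\<close>

lemma infdist_greatest: "A \<noteq> {} \<Longrightarrow> (\<And>z. z \<in> A \<Longrightarrow> t \<le> dist x z) \<Longrightarrow> t \<le> infdist x A"
  by (subst infdist_notempty) (auto intro: cINF_greatest)

text \<open>Expanding the square makes the condition linear in the radius s. In this form touching
  passes to smaller radii and, for a fixed radius, to limits of v and c.\<close>

lemma touching_iff: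
  fixes v :: "'a::euclidean_space"
  assumes v: "norm v = 1" and c: "c \<in> A" and s: "s > 0"
  shows "infdist (c + s *\<^sub>R v) A = s \<longleftrightarrow> (\<forall>z\<in>A. 2 * s * (v \<bullet> (z - c)) \<le> (norm (z - c))\<^sup>2)"
proof -
  have "infdist (c + s *\<^sub>R v) A \<le> s" using infdist_le[OF c, of "c + s *\<^sub>R v"] v s by (simp add: dist_norm)
  then have "infdist (c + s *\<^sub>R v) A = s \<longleftrightarrow> (\<forall>z\<in>A. s \<le> dist (c + s *\<^sub>R v) z)"
    using infdist_greatest[of A s "c + s *\<^sub>R v"] infdist_le[of _ A "c + s *\<^sub>R v"] c by force
  moreover have "s \<le> dist (c + s *\<^sub>R v) z \<longleftrightarrow> 2 * s * (v \<bullet> (z - c)) \<le> (norm (z - c))\<^sup>2" for z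
  proof -
    have "s \<le> dist (c + s *\<^sub>R v) z \<longleftrightarrow> s\<^sup>2 \<le> (norm ((z - c) - s *\<^sub>R v))\<^sup>2"
      using s by (subst dist_norm, subst norm_minus_commute)
        (simp add: algebra_simps power_mono_iff flip: abs_le_square_iff)
    also have "(norm ((z - c) - s *\<^sub>R v))\<^sup>2 = (norm (z - c))\<^sup>2 - 2 * s * (v \<bullet> (z - c)) + s\<^sup>2"
      unfolding power2_norm_eq_inner inner_diff_left[of "z - c"] inner_diff_right[of _ "z - c"]
      using v by (simp add: inner_commute[of "z - c" v] norm_eq_1 power2_eq_square)
    finally show ?thesis by simp
  qed
  ultimately show ?thesis by simp
qed

lemma normal_fibre_iff:
  "v \<in> normal_fibre A c \<longleftrightarrow>
    norm v = 1 \<and> c \<in> A \<and> (\<exists>s>0. \<forall>z\<in>A. 2 * s * (v \<bullet> (z - c)) \<le> (norm (z - c))\<^sup>2)"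
proof -
  have "(\<exists>r>0. infdist (c + r *\<^sub>R v) A = r) \<longleftrightarrow> (\<exists>s>0. \<forall>z\<in>A. 2 * s * (v \<bullet> (z - c)) \<le> (norm (z - c))\<^sup>2)"
    if "norm v = 1" "c \<in> A"
    by (rule ex_cong) (rule touching_iff[OF that])
  then show ?thesis unfolding normal_fibre_def unit_sphere_def by auto
qed

lemma normal_of_nearest:
  fixes x :: "'a::euclidean_space"
  assumes "x \<notin> A" "c \<in> A" "dist x c = infdist x A"
  shows "(1 / dist x c) *\<^sub>R (x - c) \<in> normal_fibre A c"
proof -
  have "x \<noteq> c" using assms by auto
  moreover have "infdist (c + dist x c *\<^sub>R ((1 / dist x c) *\<^sub>R (x - c))) A = dist x c"
    using calculation assms by simp
  moreover have "norm ((1 / dist x c) *\<^sub>R (x - c)) = 1" using calculation by (simp add: dist_norm)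
  ultimately show ?thesis using assms(2) zero_less_dist_iff[of x c]
    unfolding normal_fibre_def unit_sphere_def mem_sphere_0 by blast
qed

locale pos_reach =
  fixes A :: "'a::euclidean_space set" and \<rho> :: real
  assumes closed: "closed A" and nonempty: "A \<noteq> {}" and rho_pos: "\<rho> > 0"
    and uniq: "\<And>x. infdist x A < \<rho> \<Longrightarrow> \<exists>!c. c \<in> A \<and> dist x c = infdist x A"
begin

lemma nearest_ex: "\<exists>c\<in>A. dist x c = infdist x A"
  by (rule infdist_attains_inf[OF closed nonempty, of x]) auto

text \<open>A one-sided replacement for the gradient of the distance. Expanding about the nearest
  point c' of the moved point, not about c, makes the expansion exact, and continuity of nearest
  points keeps the linear term positive.\<close>

lemma infdist_nonincreasing_direction:
  assumes y: "infdist y A < \<rho>" "c \<in> A" "dist y c = infdist y A"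
    and h0: "h0 > 0" "\<And>h. 0 < h \<Longrightarrow> h < h0 \<Longrightarrow> infdist (y + h *\<^sub>R d) A \<le> infdist y A"
  shows "d \<bullet> (y - c) \<le> 0"
proof (rule ccontr)
  assume "\<not> ?thesis"
  then have pos: "d \<bullet> (y - c) > 0" by simp
  then have d0: "d \<noteq> 0" by auto
  define \<epsilon> where "\<epsilon> = d \<bullet> (y - c) / norm d"
  have "\<epsilon> > 0" using pos d0 by (simp add: \<epsilon>_def)
  have "\<exists>\<delta>>0. \<forall>y' c'. c' \<in> A \<and> norm (y' - c') = infdist y' A \<and> norm (y' - y) < \<delta> \<longrightarrow> norm (c' - c) < \<epsilon>"
    by (rule nearest_point_continuity[OF closed, of norm 1])
       (use uniq[OF y(1)] y \<open>\<epsilon> > 0\<close> in \<open>auto intro!: continuous_intros simp: dist_norm\<close>)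
  then obtain \<delta> where \<delta>: "\<delta> > 0" "\<And>y' c'. c' \<in> A \<Longrightarrow> dist y' c' = infdist y' A \<Longrightarrow> norm (y' - y) < \<delta> \<Longrightarrow> norm (c' - c) < \<epsilon>"
    by (auto simp: dist_norm)
  define h where "h = min h0 (\<delta> / norm d) / 2"
  have h: "0 < h" "h < h0" "norm (h *\<^sub>R d) < \<delta>"
    using h0 \<delta>(1) d0 by (auto simp: h_def min_def field_simps split: if_splits)
  obtain c' where c': "c' \<in> A" "dist (y + h *\<^sub>R d) c' = infdist (y + h *\<^sub>R d) A" using nearest_ex by blast
  have "norm (c' - c) < \<epsilon>" using \<delta>(2)[OF c'] h by simp
  then have "norm d * norm (c' - c) < d \<bullet> (y - c)" using d0 by (simp add: \<epsilon>_def field_simps)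
  then have "d \<bullet> (y - c') > 0"
    using norm_cauchy_schwarz[of d "c' - c"] by (simp add: inner_diff_right)
  moreover have "(dist (y + h *\<^sub>R d) c')\<^sup>2 = (norm (y - c'))\<^sup>2 + 2 * h * (d \<bullet> (y - c')) + h\<^sup>2 * (norm d)\<^sup>2"
  proof -
    have "(dist (y + h *\<^sub>R d) c')\<^sup>2 = (norm ((y - c') + h *\<^sub>R d))\<^sup>2"
      by (simp add: dist_norm algebra_simps)
    then show ?thesis
      unfolding power2_norm_eq_inner inner_add_left[of "y - c'"] inner_add_right[of _ "y - c'"]
      by (simp add: inner_commute[of "y - c'" d] power2_eq_square)
  qed
  moreover have "h\<^sup>2 * (norm d)\<^sup>2 \<ge> 0" by simp
  ultimately have "(dist (y + h *\<^sub>R d) c')\<^sup>2 > (norm (y - c'))\<^sup>2"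
    using h by (smt (verit) mult_pos_pos)
  then have "dist (y + h *\<^sub>R d) c' > norm (y - c')" by (meson power_less_imp_less_base zero_le_dist)
  then show False using h0(2)[OF h(1,2)] c' infdist_le[OF c'(1), of y] by (simp add: dist_norm)
qed

lemma touching_shorten:
  assumes v: "norm v = 1" and c: "c \<in> A" and s: "0 < s" "s \<le> r" and r: "infdist (c + r *\<^sub>R v) A = r"
  shows "infdist (c + s *\<^sub>R v) A = s"
proof -
  have "2 * s * (v \<bullet> (z - c)) \<le> (norm (z - c))\<^sup>2" if "z \<in> A" for z
  proof (cases "v \<bullet> (z - c) \<le> 0")
    case True
    then show ?thesis using s by (smt (verit) mult_nonneg_nonpos zero_le_power2)
  next
    case False
    have "2 * r * (v \<bullet> (z - c)) \<le> (norm (z - c))\<^sup>2"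
      using touching_iff[OF v c, of r] r s that by simp
    moreover have "2 * s * (v \<bullet> (z - c)) \<le> 2 * r * (v \<bullet> (z - c))"
      using s False by (intro mult_right_mono) auto
    ultimately show ?thesis by linarith
  qed
  then show ?thesis using touching_iff[OF v c s(1)] by simp
qed

text \<open>If the touching radius stopped at some s* below \<open>\<rho>\<close>, then maximise the distance from \<open>A\<close>
  over a small ball around the centre \<open>x\<close>: first order optimality forces the maximiser onto the
  ray through \<open>x\<close>, whose nearest point is still \<open>c\<close>.\<close>

lemma touching_extend:
  assumes v: "norm v = 1" and c: "c \<in> A" and r: "r > 0" "infdist (c + r *\<^sub>R v) A = r"
    and s1: "0 < s1" "s1 < \<rho>"
  shows "infdist (c + s1 *\<^sub>R v) A = s1"
proof -
  define T where "T = {0..s1} \<inter> {s. infdist (c + s *\<^sub>R v) A - s = 0}"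
  have "closed {s. infdist (c + s *\<^sub>R v) A - s = 0}"
    by (intro closed_Collect_eq continuous_intros)
  then have "compact T" unfolding T_def by (simp add: compact_Int_closed)
  moreover have m: "min r s1 \<in> T" using touching_shorten[OF v c _ _ r(2), of "min r s1"] r s1 by (auto simp: T_def)
  ultimately obtain s where s: "s \<in> T" "\<And>t. t \<in> T \<Longrightarrow> t \<le> s"
    using compact_attains_sup[of T] by blast
  have spos: "s > 0" using s(2)[OF m] r s1 by auto
  have sle: "s \<le> s1" and sd: "infdist (c + s *\<^sub>R v) A = s" using s(1) by (auto simp: T_def)
  have "\<not> s < s1"
  proof
    assume "s < s1"
    \<comment> \<open>t \<le> s1 - s keeps the distance at the maximiser at most s1 < \<rho>, where
      nearest points are unique; t < s makes D - t positive below.\<close>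
    define t where "t = min (s / 2) (s1 - s)"
    have t: "0 < t" "t \<le> s / 2" "s + t \<le> s1" using \<open>s < s1\<close> spos unfolding t_def by linarith+
    define x where "x = c + s *\<^sub>R v"
    have "\<exists>y\<in>cball x t. \<forall>z\<in>cball x t. infdist z A \<le> infdist y A"
      using t by (intro continuous_attains_sup) (auto intro!: continuous_intros)
    then obtain y where y: "norm (y - x) \<le> t" and ymax: "\<And>z. norm (z - x) \<le> t \<Longrightarrow> infdist z A \<le> infdist y A"
      by (metis dist_commute dist_norm mem_cball)
    have ylt: "infdist y A \<le> s + t"
      using infdist_triangle[of y A x] y sd by (simp add: x_def dist_norm)
    have ygt: "infdist y A \<ge> s" using ymax[of x] t sd by (simp add: x_def)
    have yrho: "infdist y A < \<rho>" using ylt t s1 by simp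
    obtain c' where c': "c' \<in> A" "dist y c' = infdist y A" using nearest_ex by blast
    define D where "D = infdist y A"
    define \<nu> where "\<nu> = (1 / D) *\<^sub>R (y - c')"
    have D: "D > 0" "norm (y - c') = D" using ygt spos c' by (auto simp: D_def dist_norm)
    have \<nu>: "norm \<nu> = 1" "y - c' = D *\<^sub>R \<nu>" using D by (auto simp: \<nu>_def)
    \<comment> \<open>First order optimality at the maximiser y: a direction that stays in the ball
      cannot make an acute angle with the direction \<nu> leading away from the nearest
      point.\<close>
    have KKT: "d \<bullet> \<nu> \<le> 0" if h0: "h0 > 0" "\<And>h. 0 < h \<Longrightarrow> h < h0 \<Longrightarrow> norm (y + h *\<^sub>R d - x) \<le> t" for d h0
    proof -
      have "d \<bullet> (y - c') \<le> 0"
        by (rule infdist_nonincreasing_direction[OF yrho c' h0(1)]) (use h0 ymax in auto)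
      then show ?thesis using D unfolding \<nu>(2) by (simp add: mult_le_0_iff)
    qed
    have bd: "norm (y - x) = t"
    proof (rule ccontr)
      assume "norm (y - x) \<noteq> t"
      then have lt: "norm (y - x) < t" using y by simp
      have "\<nu> \<bullet> \<nu> \<le> 0"
      proof (rule KKT[of "t - norm (y - x)"])
        fix h :: real assume "0 < h" "h < t - norm (y - x)"
        then show "norm (y + h *\<^sub>R \<nu> - x) \<le> t"
          using norm_triangle_ineq[of "y - x" "h *\<^sub>R \<nu>"] \<nu> by (simp add: algebra_simps)
      qed (use lt in simp)
      then show False using \<nu>(1) by (simp add: norm_eq_1)
    qed
    define e where "e = (1 / t) *\<^sub>R (y - x)"
    have e: "norm e = 1" "y - x = t *\<^sub>R e" using bd t by (auto simp: e_def)
    have "\<nu> = e"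
    proof (rule ccontr)
      assume ne: "\<nu> \<noteq> e"
      have "(norm (\<nu> - e))\<^sup>2 > 0" using ne by simp
      then have lt1: "\<nu> \<bullet> e < 1" using unit_dist_sq[OF \<nu>(1) e(1)] by simp
      define d where "d = \<nu> - e"
      have de: "d \<bullet> e < 0" using lt1 e by (simp add: d_def inner_diff_left norm_eq_1)
      have dd: "(norm d)\<^sup>2 > 0" using ne by (simp add: d_def)
      have "d \<bullet> \<nu> \<le> 0"
      \<comment> \<open>The bound on h is where |t e + h d| returns to t; it is positive because d =
        \<nu> - e points strictly into the ball.\<close>
      proof (rule KKT[of "2 * t * (- (d \<bullet> e)) / (norm d)\<^sup>2"])
        show "0 < 2 * t * (- (d \<bullet> e)) / (norm d)\<^sup>2"
          using de dd t by (intro divide_pos_pos mult_pos_pos) auto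
        fix h assume h: "0 < h" "h < 2 * t * (- (d \<bullet> e)) / (norm d)\<^sup>2"
        have "h * (norm d)\<^sup>2 < 2 * t * (- (d \<bullet> e))" using h(2) unfolding pos_less_divide_eq[OF dd] .
        then have "h * (h * (norm d)\<^sup>2) < h * (2 * t * (- (d \<bullet> e)))" using h(1) by (intro mult_strict_left_mono)
        moreover have "(norm (t *\<^sub>R e + h *\<^sub>R d))\<^sup>2 = t\<^sup>2 + 2 * t * h * (d \<bullet> e) + h * (h * (norm d)\<^sup>2)"
          unfolding power2_norm_eq_inner inner_add_left inner_add_right
          using e(1) by (simp add: inner_commute[of e d] norm_eq_1 power2_eq_square)
        ultimately have "(norm (t *\<^sub>R e + h *\<^sub>R d))\<^sup>2 \<le> t\<^sup>2" by (simp add: algebra_simps)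
        then have "norm (t *\<^sub>R e + h *\<^sub>R d) \<le> t" using t by (simp add: power2_le_iff_abs_le)
        moreover have "y + h *\<^sub>R d - x = t *\<^sub>R e + h *\<^sub>R d" using e(2) by (simp add: algebra_simps)
        ultimately show "norm (y + h *\<^sub>R d - x) \<le> t" by metis
      qed
      moreover have "d \<bullet> \<nu> = 1 - \<nu> \<bullet> e" using \<nu>(1) by (simp add: d_def inner_diff_left norm_eq_1 inner_commute[of e])
      ultimately show False using lt1 by simp
    qed
    then have yx: "y = x + t *\<^sub>R \<nu>" using e(2) by (simp add: algebra_simps)
    have xc: "x - c' = (D - t) *\<^sub>R \<nu>" using \<nu>(2) yx by (simp add: algebra_simps)
    have Dt: "D > t" using ygt t spos by (simp add: D_def)
    then have "dist x c' = D - t" using xc \<nu>(1) by (simp add: dist_norm)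
    then have "s \<le> D - t" using infdist_le[OF c'(1), of x] sd by (simp add: x_def)
    then have Ds: "D = s + t" using ylt by (simp add: D_def)
    \<comment> \<open>Both c and c' realise the distance of x, which is below \<rho>; so they agree,
      and the ray from c through x continues to y.\<close>
    then have "dist x c' = infdist x A" using \<open>dist x c' = D - t\<close> sd by (simp add: x_def)
    moreover have "dist x c = infdist x A" using sd v spos by (simp add: x_def dist_norm)
    moreover have "infdist x A < \<rho>" using sd sle s1 by (simp add: x_def)
    ultimately have "c' = c" using uniq[of x] c c'(1) by blast
    then have "s *\<^sub>R v = s *\<^sub>R \<nu>" using xc Ds by (simp add: x_def)
    then have "v = \<nu>" using spos by simp
    then have "y = c + (s + t) *\<^sub>R v" using yx by (simp add: x_def algebra_simps)
    then have "s + t \<in> T" using Ds t spos by (auto simp: T_def D_def)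
    from s(2)[OF this] t show False by simp
  qed
  then show ?thesis using sle sd by simp
qed

lemma normal_ineq:
  assumes "v \<in> normal_fibre A c" "z \<in> A"
  shows "\<rho> * (v \<bullet> (z - c)) \<le> (norm (z - c))\<^sup>2"
proof -
  from assms obtain r where v: "norm v = 1" "c \<in> A" "r > 0" "infdist (c + r *\<^sub>R v) A = r"
    by (auto simp: normal_fibre_def unit_sphere_def)
  \<comment> \<open>\<open>touching_extend\<close> reaches every radius below \<rho>; the choice
    \<rho> / 2 turns the factor 2 s of \<open>touching_iff\<close> into \<rho>.\<close>
  have "infdist (c + (\<rho> / 2) *\<^sub>R v) A = \<rho> / 2"
    by (rule touching_extend[OF v]) (use rho_pos in auto)
  then show ?thesis using touching_iff[OF v(1,2), of "\<rho> / 2"] rho_pos assms(2) by auto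
qed

text \<open>The radius is the same for all normals, so the touching inequality is a closed condition
  and survives the limit along a convergent subsequence of unit vectors.\<close>

lemma normal_limit:
  assumes c: "c \<longlonglongrightarrow> l" and v: "\<And>n. v n \<in> normal_fibre A (c n)"
  shows "\<exists>w r. strict_mono (r::nat \<Rightarrow> nat) \<and> (v \<circ> r) \<longlonglongrightarrow> w \<and> w \<in> normal_fibre A l"
proof -
  have nv: "norm (v n) = 1" "c n \<in> A" for n using v[of n] by (auto simp: normal_fibre_iff)
  have "compact (sphere (0::'a) 1)" by simp
  then obtain w r where r: "strict_mono (r::nat \<Rightarrow> nat)" and w: "(v \<circ> r) \<longlonglongrightarrow> w" "norm w = 1"
    using nv(1) unfolding compact_def by (metis mem_sphere_0)
  have cr: "(c \<circ> r) \<longlonglongrightarrow> l" using LIMSEQ_subseq_LIMSEQ[OF c r] .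
  have "l \<in> A" using closed_sequentially[OF closed _ c] nv by blast
  moreover have "2 * (\<rho> / 2) * (w \<bullet> (z - l)) \<le> (norm (z - l))\<^sup>2" if z: "z \<in> A" for z
  proof (rule LIMSEQ_le)
    show "(\<lambda>n. 2 * (\<rho> / 2) * ((v \<circ> r) n \<bullet> (z - (c \<circ> r) n))) \<longlonglongrightarrow> 2 * (\<rho> / 2) * (w \<bullet> (z - l))"
      by (intro tendsto_intros w cr)
    show "(\<lambda>n. (norm (z - (c \<circ> r) n))\<^sup>2) \<longlonglongrightarrow> (norm (z - l))\<^sup>2"
      by (intro tendsto_intros cr)
    show "\<exists>N. \<forall>n\<ge>N. 2 * (\<rho> / 2) * ((v \<circ> r) n \<bullet> (z - (c \<circ> r) n)) \<le> (norm (z - (c \<circ> r) n))\<^sup>2"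
      using normal_ineq[OF v z] by auto
  qed
  ultimately have "w \<in> normal_fibre A l"
    using w(2) rho_pos unfolding normal_fibre_iff by (metis half_gt_zero)
  with r w show ?thesis by blast
qed

text \<open>Points outside A converging to l have nearest points converging to l as well, each with
  a normal; a limit of these is a normal at l.\<close>

lemma frontier_normal_ex:
  assumes l: "l \<in> frontier A" shows "\<exists>v. v \<in> normal_fibre A l"
proof -
  have "l \<in> closure (- A)" using l by (simp add: frontier_closures)
  then obtain x where x: "\<And>n::nat. x n \<notin> A" "x \<longlonglongrightarrow> l" by (auto simp: closure_sequential)
  have "\<forall>n. \<exists>c. c \<in> A \<and> dist (x n) c = infdist (x n) A" using nearest_ex by blast
  then obtain c where c: "\<And>n. c n \<in> A" "\<And>n. dist (x n) (c n) = infdist (x n) A" by metis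
  have lA: "l \<in> A" using l closed frontier_subset_closed by blast
  have "(\<lambda>n. dist (c n) l) \<longlonglongrightarrow> 0"
  proof (rule real_tendsto_sandwich[OF _ _ tendsto_const])
    show "(\<lambda>n. 2 * dist (x n) l) \<longlonglongrightarrow> 0"
      using tendsto_mult_right_zero[OF iffD1[OF tendsto_dist_iff x(2)]] .
    have "dist (c n) l \<le> 2 * dist (x n) l" for n
      using dist_triangle[of "c n" l "x n"] c(2)[of n] infdist_le[OF lA, of "x n"] by (simp add: dist_commute)
    then show "\<forall>\<^sub>F n in sequentially. dist (c n) l \<le> 2 * dist (x n) l" by simp
  qed simp
  then have "c \<longlonglongrightarrow> l" by (rule iffD2[OF tendsto_dist_iff])
  from normal_limit[OF this, of "\<lambda>n. (1 / dist (x n) (c n)) *\<^sub>R (x n - c n)"]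
  show ?thesis using normal_of_nearest[OF x(1) c] by blast
qed

lemma normal_near:
  assumes a: "normal_fibre A a = {u}" and e: "\<epsilon> > 0"
  shows "\<exists>\<eta>>0. \<forall>c v. norm (c - a) < \<eta> \<and> v \<in> normal_fibre A c \<longrightarrow> norm (v - u) < \<epsilon>"
proof (rule ccontr)
  assume "\<not> ?thesis"
  then have "\<forall>n::nat. \<exists>c v. norm (c - a) < inverse (Suc n) \<and> v \<in> normal_fibre A c \<and> \<not> norm (v - u) < \<epsilon>"
    by (metis inverse_positive_iff_positive of_nat_0_less_iff zero_less_Suc)
  then obtain c v where cv: "\<And>n::nat. norm (c n - a) < inverse (Suc n)" "\<And>n. v n \<in> normal_fibre A (c n)"
    "\<And>n. \<not> norm (v n - u) < \<epsilon>" by metis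
  have "(\<lambda>n. norm (c n - a)) \<longlonglongrightarrow> 0"
    by (rule real_tendsto_sandwich[OF _ _ tendsto_const LIMSEQ_inverse_real_of_nat])
       (use less_imp_le[OF cv(1)] in auto)
  then have "c \<longlonglongrightarrow> a" using LIM_zero_iff tendsto_norm_zero_iff by blast
  from normal_limit[OF this cv(2)] a obtain r where "(v \<circ> r) \<longlonglongrightarrow> u" by auto
  then have "eventually (\<lambda>n. norm (v (r n) - u) < \<epsilon>) sequentially"
    using e by (auto simp: tendsto_iff dist_norm o_def)
  then show False using cv(3) by (auto simp: eventually_sequentially)
qed

text \<open>If y were outside, the distance from A along the segment from y to x would be maximal at
  some p before x. There the normal at the nearest point cannot make an acute angle with x - y,
  while \<open>normal_near\<close> puts it within k of u and x - y lies in the cone about u.\<close>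

lemma interior_cone:
  assumes a: "normal_fibre A a = {u}" and k: "0 < k"
  shows "\<exists>\<eta>>0. \<forall>x y. x \<in> A \<and> norm (x - a) < \<eta> \<and> norm (y - a) < \<eta> \<and>
            k * norm (x - y) \<le> (x - y) \<bullet> u \<longrightarrow> y \<in> A"
proof -
  obtain \<eta>0 where \<eta>0: "\<eta>0 > 0" "\<And>c v. norm (c - a) < \<eta>0 \<Longrightarrow> v \<in> normal_fibre A c \<Longrightarrow> norm (v - u) < k"
    using normal_near[OF a k] by blast
  have aA: "a \<in> A" using a by (auto simp: normal_fibre_def)
  \<comment> \<open>The nearest point of p is at most 2 |p - a| away from a, whence the factor 1/2;
    \<rho> is the range of unique nearest points.\<close>
  define \<eta> where "\<eta> = min (\<eta>0 / 2) \<rho>"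
  have "y \<in> A" if x: "x \<in> A" "norm (x - a) < \<eta>" and y: "norm (y - a) < \<eta>"
    and cone: "k * norm (x - y) \<le> (x - y) \<bullet> u" for x y
  proof (rule ccontr)
    assume yA: "y \<notin> A"
    define d where "d = x - y"
    have d0: "d \<noteq> 0" using x yA by (auto simp: d_def)
    have "\<exists>t\<in>{0..1::real}. \<forall>s\<in>{0..1}. infdist (y + s *\<^sub>R d) A \<le> infdist (y + t *\<^sub>R d) A"
      by (intro continuous_attains_sup) (auto intro!: continuous_intros)
    then obtain t where t: "0 \<le> t" "t \<le> 1"
      and tmax: "\<And>s. 0 \<le> s \<Longrightarrow> s \<le> 1 \<Longrightarrow> infdist (y + s *\<^sub>R d) A \<le> infdist (y + t *\<^sub>R d) A" by auto
    define p where "p = y + t *\<^sub>R d"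
    have "infdist y A > 0" by (rule infdist_pos_not_in_closed[OF closed nonempty yA])
    then have ppos: "infdist p A > 0" using tmax[of 0] by (simp add: p_def)
    then have pA: "p \<notin> A" by auto
    have "t \<noteq> 1" using pA x by (auto simp: p_def d_def)
    then have t1: "t < 1" using t by simp
    have pball: "norm (p - a) < \<eta>"
    proof -
      have "p \<in> closed_segment y x" using t
        by (auto simp: p_def d_def closed_segment_def algebra_simps intro!: exI[of _ t])
      moreover have "closed_segment y x \<subseteq> ball a \<eta>"
        by (rule closed_segment_subset) (use x y in \<open>auto simp: dist_norm norm_minus_commute\<close>)
      ultimately show ?thesis by (auto simp: dist_norm norm_minus_commute)
    qed
    have pinf: "infdist p A \<le> norm (p - a)" using infdist_le[OF aA, of p] by (simp add: dist_norm)
    obtain c where c: "c \<in> A" "dist p c = infdist p A" using nearest_ex by blast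
    have "norm (c - a) < \<eta>0"
      using pball pinf c(2) dist_triangle[of c a p] by (auto simp: \<eta>_def dist_norm norm_minus_commute)
    from \<eta>0(2)[OF this normal_of_nearest[OF pA c]]
    have near: "norm ((1 / dist p c) *\<^sub>R (p - c) - u) < k" .
    have "d \<bullet> (p - c) \<le> 0"
    proof (rule infdist_nonincreasing_direction[OF _ c, of "1 - t"])
      show "infdist p A < \<rho>" using pball pinf by (simp add: \<eta>_def)
      fix h assume "0 < h" "h < 1 - t"
      then show "infdist (p + h *\<^sub>R d) A \<le> infdist p A"
        using tmax[of "t + h"] t by (simp add: p_def algebra_simps)
    qed (use t1 in simp)
    then have "d \<bullet> ((1 / dist p c) *\<^sub>R (p - c)) \<le> 0" by (simp add: divide_nonpos_nonneg)
    moreover have "d \<bullet> (u - (1 / dist p c) *\<^sub>R (p - c)) \<le> norm d * norm (u - (1 / dist p c) *\<^sub>R (p - c))"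
      by (rule norm_cauchy_schwarz)
    moreover have "norm d * norm (u - (1 / dist p c) *\<^sub>R (p - c)) < norm d * k"
      using near d0 by (intro mult_strict_left_mono) (auto simp: norm_minus_commute)
    ultimately have "d \<bullet> u < norm d * k" by (simp add: inner_diff_right)
    then show False using cone by (simp add: d_def mult.commute)
  qed
  moreover have "\<eta> > 0" using \<eta>0 rho_pos by (simp add: \<eta>_def)
  ultimately show ?thesis by blast
qed

end

lemma pos_reachI:
  fixes A :: "'a::euclidean_space set"
  assumes "closed A" "A \<noteq> {}" "reach A > 0"
  obtains \<rho> where "pos_reach A \<rho>"
proof -
  from assms(3) obtain r where r: "r \<in> {ereal \<rho> | \<rho>. \<rho> \<ge> 0 \<and>
      (\<forall>x. infdist x A < \<rho> \<longrightarrow> (\<exists>!c. c \<in> A \<and> dist x c = infdist x A))}" "r > 0"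
    unfolding reach_def less_Sup_iff by blast
  then obtain \<rho> where "r = ereal \<rho>" "\<forall>x. infdist x A < \<rho> \<longrightarrow> (\<exists>!c. c \<in> A \<and> dist x c = infdist x A)"
    by blast
  with r assms have "pos_reach A \<rho>" by unfold_locales auto
  then show ?thesis by (rule that)
qed

section \<open>The local epigraph representation\<close>

text \<open>The profile of the Huber function: quadratic up to e, affine with slope 2 e
  beyond.\<close>

lemma huber_lipschitz:
  fixes r s e :: real
  assumes "0 \<le> r" "r \<le> s" "0 < e"
  shows "\<bar>(s\<^sup>2 - (max 0 (s - e))\<^sup>2) - (r\<^sup>2 - (max 0 (r - e))\<^sup>2)\<bar> \<le> 2 * e * (s - r)"
proof -
  consider "s \<le> e" | "r \<le> e" "e < s" | "e < r" by linarith
  then show ?thesis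
  proof cases
    case 1
    then have m: "max 0 (s - e) = 0" "max 0 (r - e) = 0" using assms by auto
    have "s\<^sup>2 - r\<^sup>2 = (s + r) * (s - r)" by (simp add: power2_eq_square algebra_simps)
    moreover have "0 \<le> (s + r) * (s - r)" using assms by simp
    moreover have "(s + r) * (s - r) \<le> 2 * e * (s - r)" using assms 1 by (intro mult_right_mono) auto
    ultimately show ?thesis unfolding m by simp
  next
    case 2
    then have m: "max 0 (s - e) = s - e" "max 0 (r - e) = 0" by auto
    have "0 \<le> (e - r)\<^sup>2" by simp
    then have "2 * e * s - e\<^sup>2 - r\<^sup>2 \<le> 2 * e * (s - r)" by (simp add: power2_eq_square algebra_simps)
    moreover have "r\<^sup>2 \<le> e\<^sup>2" using 2 assms by (simp add: power_mono)
    moreover have "e\<^sup>2 \<le> e * s" using 2 assms by (simp add: power2_eq_square)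
    ultimately show ?thesis unfolding m by (simp add: power2_eq_square algebra_simps abs_le_iff)
  next
    case 3
    then have m: "max 0 (s - e) = s - e" "max 0 (r - e) = r - e" using assms by auto
    have "(s\<^sup>2 - (s - e)\<^sup>2) - (r\<^sup>2 - (r - e)\<^sup>2) = 2 * e * (s - r)"
      by (simp add: power2_eq_square algebra_simps)
    then show ?thesis unfolding m using assms by simp
  qed
qed

lemma convex_on_excess_square:
  fixes a :: "'a::real_normed_vector"
  assumes "convex S" shows "convex_on S (\<lambda>x. (max 0 (norm (x - a) - e))\<^sup>2)"
proof (rule convex_onI)
  fix t x y assume t: "0 < t" "t < (1::real)"
  let ?m = "\<lambda>x. max 0 (norm (x - a) - e)"
  have "(1 - t) *\<^sub>R x + t *\<^sub>R y - a = (1 - t) *\<^sub>R (x - a) + t *\<^sub>R (y - a)" by (simp add: algebra_simps)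
  then have "norm ((1 - t) *\<^sub>R x + t *\<^sub>R y - a) \<le> (1 - t) * norm (x - a) + t * norm (y - a)"
    using norm_triangle_ineq[of "(1 - t) *\<^sub>R (x - a)" "t *\<^sub>R (y - a)"] t by simp
  then have "norm ((1 - t) *\<^sub>R x + t *\<^sub>R y - a) - e \<le> (1 - t) * (norm (x - a) - e) + t * (norm (y - a) - e)"
    by (simp add: algebra_simps)
  also have "\<dots> \<le> (1 - t) * ?m x + t * ?m y"
    using t by (intro add_mono mult_left_mono) auto
  finally have "?m ((1 - t) *\<^sub>R x + t *\<^sub>R y) \<le> (1 - t) * ?m x + t * ?m y"
    using t by simp
  then have "(?m ((1 - t) *\<^sub>R x + t *\<^sub>R y))\<^sup>2 \<le> ((1 - t) * ?m x + t * ?m y)\<^sup>2"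
    by (intro power_mono) auto
  also have "\<dots> \<le> (1 - t) * (?m x)\<^sup>2 + t * (?m y)\<^sup>2"
  proof -
    have "0 \<le> (1 - t) * t * (?m x - ?m y)\<^sup>2" using t by (intro mult_nonneg_nonneg) auto
    also have "\<dots> = (1 - t) * (?m x)\<^sup>2 + t * (?m y)\<^sup>2 - ((1 - t) * ?m x + t * ?m y)\<^sup>2"
      by (simp add: power2_eq_square algebra_simps)
    finally show ?thesis by simp
  qed
  finally show "(?m ((1 - t) *\<^sub>R x + t *\<^sub>R y))\<^sup>2 \<le> (1 - t) * (?m x)\<^sup>2 + t * (?m y)\<^sup>2" .
qed (rule assms)

lemma convex_hplane: "convex (hplane a u)"
proof -
  have "hplane a u = {x. u \<bullet> x = u \<bullet> a}" by (auto simp: hplane_def inner_diff_left inner_commute[of u])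
  then show ?thesis by (simp add: convex_hyperplane)
qed

text \<open>The supremum of the supporting affine functions of \<open>f0 + C |x - a|\<^sup>2\<close> is a global convex
  extension; subtracting a Huber function instead of \<open>C |x - a|\<^sup>2\<close> keeps it Lipschitz.\<close>

lemma semiconvex_lipschitz_extension:
  fixes f0 :: "'a::euclidean_space \<Rightarrow> real"
  assumes e: "e > 0" and C: "C \<ge> 0" and M: "M \<ge> 0" and P: "convex P" "a \<in> P"
    and B: "B = P \<inter> ball a e"
    and q: "\<And>b. b \<in> B \<Longrightarrow> norm (q b) \<le> M"
    and sub: "\<And>b x. b \<in> B \<Longrightarrow> x \<in> B \<Longrightarrow> f0 x \<ge> f0 b + q b \<bullet> (x - b) - C * (norm (x - b))\<^sup>2"
  obtains f where "semiconvex_on P a f" "\<exists>K. K-lipschitz_on P f" "\<And>b. b \<in> B \<Longrightarrow> f b = f0 b"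
proof -
  define h where "h x = f0 x + C * (norm (x - a))\<^sup>2" for x
  \<comment> \<open>Adding C |x - a|^2 shifts the slope at b by 2 C (b - a) and cancels the
    quadratic error, so that b yields a genuine affine minorant of h on B.\<close>
  define p where "p b = q b + (2 * C) *\<^sub>R (b - a)" for b
  define K where "K = M + 2 * C * e"
  have K: "K \<ge> 0" using M C e by (simp add: K_def)
  have aB: "a \<in> B" using P e by (simp add: B)
  have p: "norm (p b) \<le> K" if "b \<in> B" for b
  proof -
    have "norm (b - a) \<le> e" using that by (simp add: B dist_norm norm_minus_commute)
    then have "2 * C * norm (b - a) \<le> 2 * C * e" using C by (intro mult_left_mono) auto
    then show ?thesis using q[OF that] norm_triangle_ineq[of "q b" "(2 * C) *\<^sub>R (b - a)"] C
      by (simp add: p_def K_def)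
  qed
  have h: "h x \<ge> h b + p b \<bullet> (x - b)" if "b \<in> B" "x \<in> B" for b x
  proof -
    have "x - a = (x - b) + (b - a)" by simp
    then have "(norm (x - a))\<^sup>2 = (norm ((x - b) + (b - a)))\<^sup>2" by simp
    also have "\<dots> = (norm (x - b))\<^sup>2 + 2 * ((b - a) \<bullet> (x - b)) + (norm (b - a))\<^sup>2"
      unfolding power2_norm_eq_inner inner_add_left[of "x - b"] inner_add_right[of _ "x - b"]
      by (simp add: inner_commute[of "x - b" "b - a"])
    finally have "(norm (x - a))\<^sup>2 = (norm (x - b))\<^sup>2 + 2 * ((b - a) \<bullet> (x - b)) + (norm (b - a))\<^sup>2" .
    then have "C * (norm (x - a))\<^sup>2 = C * (norm (x - b))\<^sup>2 + 2 * C * ((b - a) \<bullet> (x - b)) + C * (norm (b - a))\<^sup>2"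
      by (simp add: distrib_left)
    then show ?thesis using sub[OF that] by (simp add: h_def p_def inner_add_left)
  qed
  define H where "H x = (SUP b\<in>B. h b + p b \<bullet> (x - b))" for x
  have le1: "p b \<bullet> y \<le> K * norm y" if "b \<in> B" for b y
    using norm_cauchy_schwarz[of "p b" y] mult_right_mono[OF p[OF that] norm_ge_zero[of y]] by linarith
  have bdd: "bdd_above ((\<lambda>b. h b + p b \<bullet> (x - b)) ` B)" for x
  proof (rule bdd_aboveI2)
    fix b assume b: "b \<in> B"
    have "h b + p b \<bullet> (x - b) \<le> h a + p b \<bullet> (x - a)"
      using h[OF b aB] by (simp add: inner_diff_right)
    then show "h b + p b \<bullet> (x - b) \<le> h a + K * norm (x - a)" using le1[OF b, of "x - a"] by linarith
  qed
  have H_upper: "h b + p b \<bullet> (x - b) \<le> H x" if "b \<in> B" for b x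
    unfolding H_def by (rule cSUP_upper[OF that bdd])
  have H_least: "H x \<le> t" if "\<And>b. b \<in> B \<Longrightarrow> h b + p b \<bullet> (x - b) \<le> t" for x t
    unfolding H_def using aB by (intro cSUP_least that) auto
  have H_eq: "H x = h x" if "x \<in> B" for x
    using H_upper[OF that, of x] H_least[of x "h x"] h[OF _ that] by force
  have H_lip: "H x - H y \<le> K * norm (x - y)" for x y
  proof -
    have "H x \<le> H y + K * norm (x - y)"
    proof (rule H_least)
      fix b assume b: "b \<in> B"
      show "h b + p b \<bullet> (x - b) \<le> H y + K * norm (x - y)"
        using H_upper[OF b, of y] le1[OF b, of "x - y"] by (simp add: inner_diff_right)
    qed
    then show ?thesis by simp
  qed
  have H_cvx: "convex_on P H"
  proof (rule convex_onI[OF _ P(1)])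
    fix t :: real and x y assume t: "0 < t" "t < 1"
    show "H ((1 - t) *\<^sub>R x + t *\<^sub>R y) \<le> (1 - t) * H x + t * H y"
    proof (rule H_least)
      fix b assume b: "b \<in> B"
      have eq: "(1 - t) *\<^sub>R x + t *\<^sub>R y - b = (1 - t) *\<^sub>R (x - b) + t *\<^sub>R (y - b)" by (simp add: algebra_simps)
      have "h b + p b \<bullet> ((1 - t) *\<^sub>R x + t *\<^sub>R y - b) = (1 - t) * (h b + p b \<bullet> (x - b)) + t * (h b + p b \<bullet> (y - b))"
        unfolding eq inner_add_right inner_scaleR_right by (simp add: algebra_simps)
      also have "\<dots> \<le> (1 - t) * H x + t * H y"
        using t H_upper[OF b] by (intro add_mono mult_left_mono) auto
      finally show "h b + p b \<bullet> ((1 - t) *\<^sub>R x + t *\<^sub>R y - b) \<le> (1 - t) * H x + t * H y" .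
    qed
  qed
  \<comment> \<open>Within distance e of a this is |x - a|^2, so f = f0 on B. Moreover C |x - a|^2 +
    f is H plus C times the convex excess square, while f itself stays Lipschitz.\<close>
  define hub where "hub x = (norm (x - a))\<^sup>2 - (max 0 (norm (x - a) - e))\<^sup>2" for x
  define f where "f x = H x - C * hub x" for x
  have "semiconvex_on P a f"
    unfolding semiconvex_on_def
  proof (intro exI conjI)
    have "convex_on P (\<lambda>x. H x + C * (max 0 (norm (x - a) - e))\<^sup>2)"
      by (intro convex_on_add convex_on_cmul H_cvx C convex_on_excess_square P)
    moreover have "H x + C * (max 0 (norm (x - a) - e))\<^sup>2 = C * (norm (x - a))\<^sup>2 + f x" for x
      by (simp add: f_def hub_def algebra_simps)
    ultimately show "convex_on P (\<lambda>x. C * (norm (x - a))\<^sup>2 + f x)" by simp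
  qed (rule C)
  moreover have "(K + C * (2 * e))-lipschitz_on P f"
  proof (rule lipschitz_onI)
    fix x y
    have "\<bar>hub x - hub y\<bar> \<le> 2 * e * \<bar>norm (x - a) - norm (y - a)\<bar>"
      using huber_lipschitz[of "norm (x - a)" "norm (y - a)" e] huber_lipschitz[of "norm (y - a)" "norm (x - a)" e] e
      unfolding hub_def by (cases "norm (x - a) \<le> norm (y - a)") auto
    also have "\<dots> \<le> 2 * e * norm (x - y)"
      using norm_triangle_ineq3[of "x - a" "y - a"] e by (intro mult_left_mono) auto
    finally have "C * \<bar>hub x - hub y\<bar> \<le> C * (2 * e * norm (x - y))" using C by (rule mult_left_mono)
    moreover have "\<bar>C * hub x - C * hub y\<bar> = C * \<bar>hub x - hub y\<bar>"
      using C by (simp add: abs_mult flip: right_diff_distrib)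
    moreover have "\<bar>H x - H y\<bar> \<le> K * norm (x - y)"
      using H_lip[of x y] H_lip[of y x] by (simp add: norm_minus_commute[of y x] abs_le_iff)
    ultimately have "\<bar>f x - f y\<bar> \<le> K * norm (x - y) + C * (2 * e * norm (x - y))"
      unfolding f_def by linarith
    then show "dist (f x) (f y) \<le> (K + C * (2 * e)) * dist x y"
      by (simp add: dist_norm algebra_simps)
  qed (use K C e in simp)
  moreover have "f b = f0 b" if "b \<in> B" for b
  proof -
    have "norm (b - a) < e" using that by (simp add: B dist_norm norm_minus_commute)
    then show ?thesis using H_eq[OF that] by (simp add: f_def hub_def h_def)
  qed
  ultimately show ?thesis using that by blast
qed

section \<open>The graph near a point with a single normal\<close>

context pos_reach
begin

text \<open>Heights s are measured along -u, so A lies on the side of large s. All clauses are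
  local; the last one supplies the data for \<open>semiconvex_lipschitz_extension\<close>.\<close>

lemma local_graph:
  assumes a: "normal_fibre A a = {u}"
  obtains \<epsilon> \<delta> f0 C where "\<epsilon> > 0" "\<delta> > 0" "\<epsilon> \<le> \<delta>" "C \<ge> 0" "f0 a = 0"
    "\<And>b s. b \<in> hplane a u \<Longrightarrow> norm (b - a) < \<epsilon> \<Longrightarrow> \<bar>s\<bar> < \<delta> \<Longrightarrow> b - s *\<^sub>R u \<in> A \<longleftrightarrow> f0 b \<le> s"
    "\<And>b s. b \<in> hplane a u \<Longrightarrow> norm (b - a) < \<epsilon> \<Longrightarrow> \<bar>s\<bar> < \<delta> \<Longrightarrow> b - s *\<^sub>R u \<in> frontier A \<longleftrightarrow> s = f0 b"
    "\<And>b. b \<in> hplane a u \<Longrightarrow> norm (b - a) < \<epsilon> \<Longrightarrow> \<bar>f0 b\<bar> \<le> norm (b - a)"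
    "\<And>k. k > 0 \<Longrightarrow> \<exists>r>0. \<forall>b\<in>hplane a u. norm (b - a) < r \<longrightarrow> \<bar>f0 b\<bar> \<le> k * norm (b - a)"
    "\<And>b. b \<in> hplane a u \<Longrightarrow> norm (b - a) < \<epsilon> \<Longrightarrow> \<exists>q. norm q \<le> 2 \<and>
        (\<forall>x\<in>hplane a u. norm (x - a) < \<epsilon> \<longrightarrow> f0 x \<ge> f0 b + q \<bullet> (x - b) - C * (norm (x - b))\<^sup>2)"
proof -
  have aA: "a \<in> A" and u: "norm u = 1" using a by (auto simp: normal_fibre_def unit_sphere_def)
  obtain \<eta>1 where \<eta>1: "\<eta>1 > 0" "\<And>x y. x \<in> A \<Longrightarrow> norm (x - a) < \<eta>1 \<Longrightarrow> norm (y - a) < \<eta>1 \<Longrightarrow>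
            1/2 * norm (x - y) \<le> (x - y) \<bullet> u \<Longrightarrow> y \<in> A"
    using interior_cone[OF a, of "1/2"] by fastforce
  obtain \<eta>2 where \<eta>2: "\<eta>2 > 0" "\<And>c v. norm (c - a) < \<eta>2 \<Longrightarrow> v \<in> normal_fibre A c \<Longrightarrow> norm (v - u) < 1/2"
    using normal_near[OF a, of "1/2"] by fastforce
  define \<eta> where "\<eta> = min (min \<eta>1 \<eta>2) \<rho> / 2"
  have \<eta>: "\<eta> > 0" "2 * \<eta> \<le> \<eta>1" "2 * \<eta> \<le> \<eta>2" "2 * \<eta> \<le> \<rho>"
    using \<eta>1 \<eta>2 rho_pos by (auto simp: \<eta>_def)
  \<comment> \<open>The heights |f0 b| + |b - b'| < 3 \<epsilon> must stay below \<delta>, and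
    \<epsilon> + \<delta> < \<eta> keeps the cylinder inside the balls where the cone property and
    the control of normals hold.\<close>
  define \<delta> where "\<delta> = \<eta> / 2"
  define \<epsilon> where "\<epsilon> = \<eta> / 8"
  define B where "B = {b \<in> hplane a u. norm (b - a) < \<epsilon>}"
  have ed: "0 < \<epsilon>" "\<epsilon> < \<delta>" "4 * \<epsilon> \<le> \<delta>" "\<delta> < \<rho>" "\<epsilon> + \<delta> < \<eta>" using \<eta> by (auto simp: \<epsilon>_def \<delta>_def)
  have near: "norm (b - s *\<^sub>R u - a) < \<eta>" if "b \<in> B" "\<bar>s\<bar> < \<delta>" for b s
  proof -
    have "norm ((b - a) - s *\<^sub>R u) \<le> norm (b - a) + \<bar>s\<bar>" using norm_triangle_ineq4[of "b - a" "s *\<^sub>R u"] u by simp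
    moreover have "b - s *\<^sub>R u - a = (b - a) - s *\<^sub>R u" by simp
    ultimately show ?thesis using that ed unfolding B_def by (simp add: algebra_simps)
  qed
  \<comment> \<open>A step down by s' - s \<ge> |b - b'| has length at most 2 (s' - s), so it lies
    in the cone with constant 1/2.\<close>
  have cone: "b' - s' *\<^sub>R u \<in> A"
    if "b - s *\<^sub>R u \<in> A" "b \<in> B" "b' \<in> B" "\<bar>s\<bar> < \<delta>" "\<bar>s'\<bar> < \<delta>" "s' - s \<ge> norm (b - b')" for b b' s s'
  proof (rule \<eta>1(2)[OF that(1)])
    show "norm (b - s *\<^sub>R u - a) < \<eta>1" "norm (b' - s' *\<^sub>R u - a) < \<eta>1"
      using near[OF that(2,4)] near[OF that(3,5)] \<eta> by auto
    have eq: "b - s *\<^sub>R u - (b' - s' *\<^sub>R u) = (b - b') + (s' - s) *\<^sub>R u" by (simp add: algebra_simps)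
    have "(b - b') \<bullet> u = 0" using that(2,3) by (simp add: B_def hplane_def inner_diff_left)
    moreover have "norm ((b - b') + (s' - s) *\<^sub>R u) \<le> norm (b - b') + (s' - s)"
      using norm_triangle_ineq[of "b - b'" "(s' - s) *\<^sub>R u"] u that(6) norm_ge_zero[of "b - b'"] by simp
    ultimately show "1 / 2 * norm (b - s *\<^sub>R u - (b' - s' *\<^sub>R u)) \<le> (b - s *\<^sub>R u - (b' - s' *\<^sub>R u)) \<bullet> u"
      unfolding eq using that(6) u by (simp add: inner_add_left norm_eq_1)
  qed
  have aB: "a \<in> B" using ed by (simp add: B_def hplane_def)
  have uN: "u \<in> normal_fibre A a" using a by simp
  have sq: "(norm (b - s *\<^sub>R u - a))\<^sup>2 = (norm (b - a))\<^sup>2 + s\<^sup>2" "u \<bullet> (b - s *\<^sub>R u - a) = - s" if "b \<in> hplane a u" for b s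
  proof -
    have o: "(b - a) \<bullet> u = 0" "u \<bullet> (b - a) = 0" using that by (auto simp: hplane_def inner_commute)
    have e: "b - s *\<^sub>R u - a = (b - a) - s *\<^sub>R u" by simp
    show "(norm (b - s *\<^sub>R u - a))\<^sup>2 = (norm (b - a))\<^sup>2 + s\<^sup>2"
      unfolding e power2_norm_eq_inner inner_diff_left[of "b - a"] inner_diff_right[of _ "b - a"]
      using o u by (simp add: norm_eq_1 power2_eq_square)
    show "u \<bullet> (b - s *\<^sub>R u - a) = - s"
      unfolding e inner_diff_right[of _ "b - a"] using o u by (simp add: norm_eq_1)
  qed
  have low: "- s * \<rho> \<le> (norm (b - a))\<^sup>2 + s\<^sup>2" if "b \<in> hplane a u" "b - s *\<^sub>R u \<in> A" for b s
    using normal_ineq[OF uN that(2)] unfolding sq[OF that(1)] by (simp add: mult.commute)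
  \<comment> \<open>The touching ball at a forbids points of A higher than |b - a| above the plane:
    they would need 2 |s| \<ge> \<rho>, but |s| < \<delta> < \<rho> / 2.\<close>
  have low2: "s \<ge> - norm (b - a)" if b: "b \<in> B" "b - s *\<^sub>R u \<in> A" and s: "\<bar>s\<bar> < \<delta>" for b s
  proof (rule ccontr)
    assume "\<not> ?thesis"
    then have n: "norm (b - a) < - s" by simp
    then have "(norm (b - a))\<^sup>2 \<le> s\<^sup>2" using power_mono[of "norm (b - a)" "- s" 2] by simp
    then have "- s * \<rho> \<le> 2 * s\<^sup>2" using low[of b s] b by (simp add: B_def)
    then have "(- s) * \<rho> \<le> (- s) * (2 * (- s))" by (simp add: power2_eq_square)
    moreover have "- s > 0" using n norm_ge_zero[of "b - a"] by linarith
    ultimately have "\<rho> \<le> 2 * (- s)" by (metis mult_le_cancel_left_pos)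
    then show False using s \<eta> by (simp add: \<delta>_def)
  qed
  \<comment> \<open>The window makes the set of heights compact, so the infimum is attained. It
    contains |b - a| by \<open>cone\<close> applied to a, and \<open>low2\<close> shows that no
    smaller height is lost.\<close>
  define f0 where "f0 b = Inf {s \<in> {-\<epsilon>..\<epsilon>}. b - s *\<^sub>R u \<in> A}" for b
  have f0: "b - f0 b *\<^sub>R u \<in> A" "\<bar>f0 b\<bar> \<le> norm (b - a)"
    "\<And>s. b - s *\<^sub>R u \<in> A \<Longrightarrow> \<bar>s\<bar> < \<delta> \<Longrightarrow> f0 b \<le> s" if b: "b \<in> B" for b
  proof -
    let ?T = "{s \<in> {-\<epsilon>..\<epsilon>}. b - s *\<^sub>R u \<in> A}"
    have nb: "norm (b - a) < \<epsilon>" using b by (simp add: B_def)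
    have mem: "norm (b - a) \<in> ?T"
      using cone[of a 0 b "norm (b - a)"] aA aB b nb ed norm_ge_zero[of "b - a"]
      by (simp add: norm_minus_commute del: norm_ge_zero)
    have "closed ((\<lambda>s. b - s *\<^sub>R u) -` A)" by (rule continuous_closed_vimage[OF closed]) (intro continuous_intros)
    moreover have "?T = {-\<epsilon>..\<epsilon>} \<inter> (\<lambda>s. b - s *\<^sub>R u) -` A" by auto
    ultimately have "closed ?T" by (simp add: closed_Int)
    moreover have bb: "bdd_below ?T" by (rule bdd_belowI[of _ "- \<epsilon>"]) auto
    ultimately have "f0 b \<in> ?T" unfolding f0_def using mem by (intro closed_contains_Inf) auto
    then show A: "b - f0 b *\<^sub>R u \<in> A" by simp
    have "f0 b \<le> norm (b - a)" unfolding f0_def by (rule cInf_lower[OF mem bb])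
    moreover have "f0 b \<ge> - norm (b - a)" by (rule low2[OF b A]) (use \<open>f0 b \<in> ?T\<close> ed in auto)
    ultimately show fb: "\<bar>f0 b\<bar> \<le> norm (b - a)" by simp
    fix s assume s: "b - s *\<^sub>R u \<in> A" "\<bar>s\<bar> < \<delta>"
    show "f0 b \<le> s"
    proof (cases "s \<in> {-\<epsilon>..\<epsilon>}")
      case True
      then have "s \<in> ?T" using s by simp
      then show ?thesis unfolding f0_def by (rule cInf_lower[OF _ bb])
    next
      case False
      have "s \<ge> - norm (b - a)" by (rule low2[OF b s])
      then have "s > \<epsilon>" using False nb by auto
      then show ?thesis using fb nb by linarith
    qed
  qed
  have f0_small: "\<bar>f0 b\<bar> < \<epsilon>" if "b \<in> B" for b using f0(2)[OF that] that by (simp add: B_def)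
  have char: "b - s *\<^sub>R u \<in> A \<longleftrightarrow> f0 b \<le> s" if b: "b \<in> B" and s: "\<bar>s\<bar> < \<delta>" for b s
    using f0(3)[OF b _ s] cone[OF f0(1)[OF b] b b _ s] f0_small[OF b] ed by auto
  have lip: "f0 b' \<le> f0 b + norm (b - b')" if b: "b \<in> B" "b' \<in> B" for b b'
  proof -
    have "norm (b - b') \<le> norm (b - a) + norm (b' - a)" using norm_triangle_ineq4[of "b - a" "b' - a"] by simp
    then have "norm (b - b') < 2 * \<epsilon>" using b by (simp add: B_def)
    then have s: "\<bar>f0 b + norm (b - b')\<bar> < \<delta>" using f0_small[OF b(1)] ed norm_ge_zero[of "b - b'"] by linarith
    show ?thesis using cone[OF f0(1)[OF b(1)] b _ s] f0_small[OF b(1)] ed char[OF b(2) s] by simp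
  qed
  have fr: "b - s *\<^sub>R u \<in> frontier A \<longleftrightarrow> s = f0 b" if b: "b \<in> B" and s: "\<bar>s\<bar> < \<delta>" for b s
  proof
    assume L: "b - s *\<^sub>R u \<in> frontier A"
    then have inA: "b - s *\<^sub>R u \<in> A" using closed frontier_subset_closed by blast
    show "s = f0 b"
    proof (rule ccontr)
      assume "s \<noteq> f0 b"
      then have gt: "s > f0 b" using char[OF b s] inA by simp
      define p where "p = b - s *\<^sub>R u"
      define x where "x = b - f0 b *\<^sub>R u"
      have xp: "x - p = (s - f0 b) *\<^sub>R u" by (simp add: x_def p_def algebra_simps)
      \<comment> \<open>A ball of radius a quarter of the height gap D stays in the cone below the
        graph point x, since 1/2 (D + q) \<le> D - q for q < D / 4.\<close>
      define r where "r = min ((s - f0 b) / 4) (\<eta>1 - norm (p - a))"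
      have "r > 0" using gt near[OF b s] \<eta> by (auto simp: r_def p_def)
      moreover have "ball p r \<subseteq> A"
      proof
        fix y assume "y \<in> ball p r"
        then have y: "norm (p - y) < r" by (simp add: dist_norm)
        show "y \<in> A"
        proof (rule \<eta>1(2))
          show "x \<in> A" using f0(1)[OF b] by (simp add: x_def)
          show "norm (x - a) < \<eta>1" using near[OF b, of "f0 b"] f0_small[OF b] ed \<eta> by (simp add: x_def)
          show "norm (y - a) < \<eta>1" using y norm_triangle_ineq4[of "p - a" "p - y"] by (simp add: r_def)
          have arith: "1/2 * N \<le> T" if "\<bar>i\<bar> \<le> q" "N \<le> D + q" "q < D / 4" "T = D + i" for N T D q i :: real
            using that by linarith
          have eq: "x - y = (s - f0 b) *\<^sub>R u + (p - y)" using xp by (simp add: algebra_simps)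
          have "\<bar>(p - y) \<bullet> u\<bar> \<le> norm (p - y)" using Cauchy_Schwarz_ineq2[of "p - y" u] u by simp
          moreover have "norm ((s - f0 b) *\<^sub>R u + (p - y)) \<le> (s - f0 b) + norm (p - y)"
            using norm_triangle_ineq[of "(s - f0 b) *\<^sub>R u" "p - y"] u gt by simp
          moreover have "norm (p - y) < (s - f0 b) / 4" using y by (simp add: r_def)
          moreover have "((s - f0 b) *\<^sub>R u + (p - y)) \<bullet> u = (s - f0 b) + (p - y) \<bullet> u"
            using u by (simp only: inner_add_left inner_scaleR_left) (simp add: norm_eq_1)
          ultimately show "1/2 * norm (x - y) \<le> (x - y) \<bullet> u" unfolding eq
            using arith by blast
        qed
      qed
      ultimately have "p \<in> interior A" by (auto simp: mem_interior)
      then show False using L by (simp add: frontier_def p_def)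
    qed
  next
    assume R: "s = f0 b"
    then have inA: "b - s *\<^sub>R u \<in> A" using f0(1)[OF b] by simp
    have "b - s *\<^sub>R u \<notin> interior A"
    proof
      assume "b - s *\<^sub>R u \<in> interior A"
      then obtain r where r: "r > 0" "ball (b - s *\<^sub>R u) r \<subseteq> A" by (auto simp: mem_interior)
      define t where "t = min (r / 2) ((\<delta> - \<bar>s\<bar>) / 2)"
      have t0: "0 < t" "t \<le> r / 2" "t \<le> (\<delta> - \<bar>s\<bar>) / 2"
        unfolding t_def by (use r s in simp, rule min.cobounded1, rule min.cobounded2)
      have "\<bar>s - t\<bar> \<le> \<bar>s\<bar> + t" using t0 by linarith
      then have t: "0 < t" "t < r" "\<bar>s - t\<bar> < \<delta>" using t0 r s by auto
      have "b - (s - t) *\<^sub>R u \<in> ball (b - s *\<^sub>R u) r" using t u by (simp add: dist_norm algebra_simps)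
      then have "b - (s - t) *\<^sub>R u \<in> A" using r by blast
      then show False using char[OF b t(3)] R t by simp
    qed
    then show "b - s *\<^sub>R u \<in> frontier A" using inA closure_subset by (auto simp: frontier_def)
  qed
  have flat: "\<exists>r>0. \<forall>b\<in>hplane a u. norm (b - a) < r \<longrightarrow> \<bar>f0 b\<bar> \<le> k * norm (b - a)" if k: "k > 0" for k
  proof -
    \<comment> \<open>With 4 k' \<le> 1 the point at depth 4 k' |b - a| is at most 2 |b - a| from a,
      so it lies in the cone with constant k'.\<close>
    define k' where "k' = min k 1 / 4"
    have k': "0 < k'" "4 * k' \<le> k" "4 * k' \<le> 1" using k by (auto simp: k'_def)
    obtain \<eta>3 where \<eta>3: "\<eta>3 > 0" "\<And>x y. x \<in> A \<Longrightarrow> norm (x - a) < \<eta>3 \<Longrightarrow> norm (y - a) < \<eta>3 \<Longrightarrow>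
            k' * norm (x - y) \<le> (x - y) \<bullet> u \<Longrightarrow> y \<in> A"
      using interior_cone[OF a k'(1)] by blast
    define r where "r = min (min \<epsilon> (\<eta>3 / 2)) (k * \<rho> / 2)"
    have "r > 0" using ed \<eta>3 k rho_pos by (simp add: r_def)
    moreover have "\<bar>f0 b\<bar> \<le> k * norm (b - a)" if b: "b \<in> hplane a u" "norm (b - a) < r" for b
    proof -
      have bB: "b \<in> B" using b by (simp add: B_def r_def)
      define s where "s = 4 * k' * norm (b - a)"
      have s: "0 \<le> s" "s \<le> norm (b - a)" using k' mult_right_mono[OF k'(3), of "norm (b - a)"] by (auto simp: s_def)
      have "b - s *\<^sub>R u \<in> A"
      proof (rule \<eta>3(2)[OF aA])
        show "norm (a - a) < \<eta>3" using \<eta>3 by simp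
        have "norm (b - s *\<^sub>R u - a) \<le> norm (b - a) + s"
          using norm_triangle_ineq4[of "b - a" "s *\<^sub>R u"] u s by (simp add: algebra_simps)
        then show n: "norm (b - s *\<^sub>R u - a) < \<eta>3" using s b by (simp add: r_def)
        have "norm (b - s *\<^sub>R u - a) \<le> 2 * norm (b - a)"
          using \<open>norm (b - s *\<^sub>R u - a) \<le> norm (b - a) + s\<close> s by linarith
        then have "k' * norm (b - s *\<^sub>R u - a) \<le> k' * (2 * norm (b - a))" using k' by (intro mult_left_mono) auto
        also have "\<dots> \<le> s" using k' by (simp add: s_def)
        also have "s = (a - (b - s *\<^sub>R u)) \<bullet> u"
          using sq(2)[OF b(1), of s] by (metis inner_commute inner_minus_right minus_diff_eq minus_minus)
        finally show "k' * norm (a - (b - s *\<^sub>R u)) \<le> (a - (b - s *\<^sub>R u)) \<bullet> u"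
          by (simp add: norm_minus_commute)
      qed
      then have "f0 b \<le> s" using char[OF bB, of s] s b ed by (simp add: r_def)
      also have "s \<le> k * norm (b - a)" using k' by (simp add: s_def mult_right_mono)
      finally have up: "f0 b \<le> k * norm (b - a)" .
      \<comment> \<open>The lower bound comes from the touching ball at a; its quadratic error 2 |b
        - a|^2 / \<rho> is at most k |b - a| once |b - a| < k \<rho> / 2.\<close>
      have "- f0 b * \<rho> \<le> (norm (b - a))\<^sup>2 + (f0 b)\<^sup>2" by (rule low[OF b(1) f0(1)[OF bB]])
      also have "(f0 b)\<^sup>2 \<le> (norm (b - a))\<^sup>2" using f0(2)[OF bB] by (simp add: power2_le_iff_abs_le)
      also have "(norm (b - a))\<^sup>2 + (norm (b - a))\<^sup>2 = 2 * norm (b - a) * norm (b - a)" by (simp add: power2_eq_square)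
      also have "\<dots> \<le> k * \<rho> * norm (b - a)" using b by (intro mult_right_mono) (auto simp: r_def)
      finally have "(- f0 b) * \<rho> \<le> (k * norm (b - a)) * \<rho>" by (simp add: algebra_simps)
      then have "- f0 b \<le> k * norm (b - a)" using rho_pos by (rule mult_right_le_imp_le)
      then show ?thesis using up by simp
    qed
    ultimately show ?thesis by blast
  qed
  have sub: "\<exists>q. norm q \<le> 2 \<and> (\<forall>x\<in>B. f0 x \<ge> f0 b + q \<bullet> (x - b) - (4 / \<rho>) * (norm (x - b))\<^sup>2)" if b: "b \<in> B" for b
  proof -
    define p where "p = b - f0 b *\<^sub>R u"
    have fb: "\<bar>f0 b\<bar> < \<delta>" using f0_small[OF b] ed by simp
    have "p \<in> frontier A" using fr[OF b fb] by (simp add: p_def)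
    then obtain v where v: "v \<in> normal_fibre A p" using frontier_normal_ex by blast
    have v1: "norm v = 1" using v by (simp add: normal_fibre_def unit_sphere_def)
    have "norm (v - u) < 1/2" using \<eta>2(2)[OF _ v] near[OF b fb] \<eta> by (simp add: p_def)
    moreover have "u \<bullet> (u - v) \<le> norm (u - v)" using norm_cauchy_schwarz[of u "u - v"] u by simp
    moreover have "u \<bullet> (u - v) = 1 - v \<bullet> u" using u by (simp add: inner_diff_right norm_eq_1 inner_commute)
    ultimately have vu: "v \<bullet> u > 1/2" by (simp add: norm_minus_commute)
    \<comment> \<open>Scaled to \<open>q \<bullet> u = 1\<close>, a normal acts on horizontal
      vectors as a slope. The bound v . u > 1/2 gives |q| \<le> 2 and doubles the error 2 |w|^2 /
      \<rho>.\<close>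
    define q where "q = (1 / (v \<bullet> u)) *\<^sub>R v"
    have "norm q \<le> 2" using vu v1 by (simp add: q_def field_simps)
    moreover have "f0 x \<ge> f0 b + q \<bullet> (x - b) - (4 / \<rho>) * (norm (x - b))\<^sup>2" if x: "x \<in> B" for x
    proof -
      define w where "w = x - b"
      define \<Delta> where "\<Delta> = f0 x - f0 b"
      have wu: "w \<bullet> u = 0" using x b by (simp add: w_def B_def hplane_def inner_diff_left)
      have zp: "x - f0 x *\<^sub>R u - p = w - \<Delta> *\<^sub>R u" by (simp add: p_def w_def \<Delta>_def algebra_simps)
      have "\<rho> * (v \<bullet> (w - \<Delta> *\<^sub>R u)) \<le> (norm (w - \<Delta> *\<^sub>R u))\<^sup>2"
        using normal_ineq[OF v f0(1)[OF x]] unfolding zp .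
      also have "(norm (w - \<Delta> *\<^sub>R u))\<^sup>2 = (norm w)\<^sup>2 + \<Delta>\<^sup>2"
        unfolding power2_norm_eq_inner inner_diff_left inner_diff_right
        using wu u by (simp add: inner_commute[of u w] norm_eq_1 power2_eq_square)
      also have "\<Delta>\<^sup>2 \<le> (norm w)\<^sup>2"
      proof -
        have "\<bar>\<Delta>\<bar> \<le> norm w" using lip[OF x b] lip[OF b x] by (simp add: \<Delta>_def w_def norm_minus_commute abs_le_iff)
        then show ?thesis by (simp add: power2_le_iff_abs_le)
      qed
      finally have "\<rho> * (v \<bullet> w - \<Delta> * (v \<bullet> u)) \<le> 2 * (norm w)\<^sup>2" by (simp add: inner_diff_right)
      then have "v \<bullet> w - \<Delta> * (v \<bullet> u) \<le> 2 * (norm w)\<^sup>2 / \<rho>" using rho_pos by (simp add: field_simps)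
      moreover have "v \<bullet> w = (v \<bullet> u) * (q \<bullet> w)" using vu by (simp add: q_def)
      ultimately have "(v \<bullet> u) * (q \<bullet> w - \<Delta>) \<le> 2 * (norm w)\<^sup>2 / \<rho>" by (simp add: algebra_simps)
      also have "\<dots> = 1/2 * (4 * (norm w)\<^sup>2 / \<rho>)" by simp
      also have "\<dots> \<le> (v \<bullet> u) * (4 * (norm w)\<^sup>2 / \<rho>)" using vu rho_pos by (intro mult_right_mono) auto
      finally have "q \<bullet> w - \<Delta> \<le> 4 * (norm w)\<^sup>2 / \<rho>"
        by (rule mult_left_le_imp_le) (use vu in simp)
      then show ?thesis by (simp add: w_def \<Delta>_def)
    qed
    ultimately show ?thesis by blast
  qed
  show ?thesis
  proof (rule that[of \<epsilon> \<delta> "4 / \<rho>" f0])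
    show "f0 a = 0" using f0(2)[OF aB] by simp
    show "\<exists>q. norm q \<le> 2 \<and> (\<forall>x\<in>hplane a u. norm (x - a) < \<epsilon> \<longrightarrow> f0 x \<ge> f0 b + q \<bullet> (x - b) - 4 / \<rho> * (norm (x - b))\<^sup>2)"
      if "b \<in> hplane a u" "norm (b - a) < \<epsilon>" for b
      using sub[of b] that by (auto simp: B_def)
  qed (use ed rho_pos char fr f0(2) flat in \<open>auto simp: B_def\<close>)
qed

lemma local_epigraph:
  assumes a: "normal_fibre A a = {u}"
  shows "\<exists>\<epsilon>>0. \<exists>\<delta>>0. \<exists>f.
        semiconvex_on (hplane a u) a f \<and> (\<exists>K. K-lipschitz_on (hplane a u) f) \<and>
        f a = 0 \<and> (f has_derivative (\<lambda>h. 0)) (at a within hplane a u) \<and>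
        fgraph a u f \<inter> cyl \<epsilon> \<delta> a u = frontier A \<inter> cyl \<epsilon> \<delta> a u \<and>
        fepi a u f \<inter> cyl \<epsilon> \<delta> a u = A \<inter> cyl \<epsilon> \<delta> a u"
proof -
  have u: "norm u = 1" using a by (auto simp: normal_fibre_def unit_sphere_def)
  obtain \<epsilon> \<delta> f0 C where ed: "\<epsilon> > 0" "\<delta> > 0" "\<epsilon> \<le> \<delta>" "C \<ge> 0" "f0 a = 0"
    and mem: "\<And>b s. b \<in> hplane a u \<Longrightarrow> norm (b - a) < \<epsilon> \<Longrightarrow> \<bar>s\<bar> < \<delta> \<Longrightarrow> b - s *\<^sub>R u \<in> A \<longleftrightarrow> f0 b \<le> s"
    and fr: "\<And>b s. b \<in> hplane a u \<Longrightarrow> norm (b - a) < \<epsilon> \<Longrightarrow> \<bar>s\<bar> < \<delta> \<Longrightarrow> b - s *\<^sub>R u \<in> frontier A \<longleftrightarrow> s = f0 b"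
    and f0: "\<And>b. b \<in> hplane a u \<Longrightarrow> norm (b - a) < \<epsilon> \<Longrightarrow> \<bar>f0 b\<bar> \<le> norm (b - a)"
    and flat: "\<And>k. k > 0 \<Longrightarrow> \<exists>r>0. \<forall>b\<in>hplane a u. norm (b - a) < r \<longrightarrow> \<bar>f0 b\<bar> \<le> k * norm (b - a)"
    and sub: "\<And>b. b \<in> hplane a u \<Longrightarrow> norm (b - a) < \<epsilon> \<Longrightarrow> \<exists>q. norm q \<le> 2 \<and>
        (\<forall>x\<in>hplane a u. norm (x - a) < \<epsilon> \<longrightarrow> f0 x \<ge> f0 b + q \<bullet> (x - b) - C * (norm (x - b))\<^sup>2)"
    by (rule local_graph[OF a]) (rule that, assumption+)
  define B where "B = hplane a u \<inter> ball a \<epsilon>"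
  have B: "b \<in> B \<longleftrightarrow> b \<in> hplane a u \<and> norm (b - a) < \<epsilon>" for b
    by (auto simp: B_def dist_norm norm_minus_commute)
  have "\<forall>b\<in>B. \<exists>q. norm q \<le> 2 \<and> (\<forall>x\<in>B. f0 x \<ge> f0 b + q \<bullet> (x - b) - C * (norm (x - b))\<^sup>2)"
  proof
    fix b assume "b \<in> B"
    with sub obtain q where "norm q \<le> 2"
      "\<And>x. x \<in> hplane a u \<Longrightarrow> norm (x - a) < \<epsilon> \<Longrightarrow> f0 x \<ge> f0 b + q \<bullet> (x - b) - C * (norm (x - b))\<^sup>2"
      using B by metis
    then show "\<exists>q. norm q \<le> 2 \<and> (\<forall>x\<in>B. f0 x \<ge> f0 b + q \<bullet> (x - b) - C * (norm (x - b))\<^sup>2)"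
      using B by blast
  qed
  then obtain q where q: "\<And>b. b \<in> B \<Longrightarrow> norm (q b) \<le> 2"
    "\<And>b x. b \<in> B \<Longrightarrow> x \<in> B \<Longrightarrow> f0 x \<ge> f0 b + q b \<bullet> (x - b) - C * (norm (x - b))\<^sup>2" by metis
  obtain f where f: "semiconvex_on (hplane a u) a f" "\<exists>K. K-lipschitz_on (hplane a u) f" "\<And>b. b \<in> B \<Longrightarrow> f b = f0 b"
  proof (rule semiconvex_lipschitz_extension[OF ed(1,4) _ convex_hplane _ B_def q])
    show "a \<in> hplane a u" by (simp add: hplane_def)
  qed auto
  have aB: "a \<in> B" using ed by (simp add: B hplane_def)
  have fa: "f a = 0" using f(3)[OF aB] ed by simp
  have der: "(f has_derivative (\<lambda>h. 0)) (at a within hplane a u)"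
    unfolding has_derivative_within_alt
  proof (intro conjI allI impI)
    fix e :: real assume "e > 0"
    then obtain r where r: "r > 0" "\<And>b. b \<in> hplane a u \<Longrightarrow> norm (b - a) < r \<Longrightarrow> \<bar>f0 b\<bar> \<le> e * norm (b - a)"
      using flat by blast
    show "\<exists>d>0. \<forall>y\<in>hplane a u. norm (y - a) < d \<longrightarrow> norm (f y - f a - 0) \<le> e * norm (y - a)"
      by (rule exI[of _ "min r \<epsilon>"]) (use r ed f(3) fa in \<open>auto simp: B\<close>)
  qed simp
  have cyl: "p \<in> cyl \<epsilon> \<delta> a u \<longleftrightarrow> (\<exists>b s. p = b - s *\<^sub>R u \<and> b \<in> hplane a u \<and> norm (b - a) < \<epsilon> \<and> \<bar>s\<bar> < \<delta>)" for p
  proof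
    assume "p \<in> cyl \<epsilon> \<delta> a u"
    then obtain x t where "p = x + t *\<^sub>R u" "x \<in> hplane a u" "norm (x - a) < \<epsilon>" "\<bar>t\<bar> < \<delta>" by (auto simp: cyl_def)
    then show "\<exists>b s. p = b - s *\<^sub>R u \<and> b \<in> hplane a u \<and> norm (b - a) < \<epsilon> \<and> \<bar>s\<bar> < \<delta>"
      by (intro exI[of _ x] exI[of _ "- t"]) auto
  next
    assume "\<exists>b s. p = b - s *\<^sub>R u \<and> b \<in> hplane a u \<and> norm (b - a) < \<epsilon> \<and> \<bar>s\<bar> < \<delta>"
    then obtain x t where "p = x - t *\<^sub>R u" "x \<in> hplane a u" "norm (x - a) < \<epsilon>" "\<bar>t\<bar> < \<delta>" by auto
    then show "p \<in> cyl \<epsilon> \<delta> a u" unfolding cyl_def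
      by (intro CollectI exI[of _ x] exI[of _ "- t"]) auto
  qed
  have inj: "b = b' \<and> s = s'" if "b - s *\<^sub>R u = b' - s' *\<^sub>R u" "b \<in> hplane a u" "b' \<in> hplane a u" for b b' s s'
  proof -
    have eq: "b - a = (b' - a) + (s - s') *\<^sub>R u" using that(1) by (simp add: algebra_simps)
    have "(b - a) \<bullet> u = 0" "(b' - a) \<bullet> u = 0" using that by (auto simp: hplane_def)
    then have "s = s'" unfolding eq inner_add_left using u by (cases "u = 0") (auto simp: norm_eq_1)
    then show ?thesis using that(1) by simp
  qed
  have "p \<in> fgraph a u f \<longleftrightarrow> p \<in> frontier A" "p \<in> fepi a u f \<longleftrightarrow> p \<in> A" if "p \<in> cyl \<epsilon> \<delta> a u" for p
  proof -
    obtain b s where p: "p = b - s *\<^sub>R u" "b \<in> hplane a u" "norm (b - a) < \<epsilon>" "\<bar>s\<bar> < \<delta>" using \<open>p \<in> cyl \<epsilon> \<delta> a u\<close> cyl by blast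
    have fb: "f b = f0 b" using f(3) p by (simp add: B)
    have "p \<in> fgraph a u f \<longleftrightarrow> s = f b"
      unfolding fgraph_def p(1) using inj[OF _ p(2)] p(2) by blast
    then show "p \<in> fgraph a u f \<longleftrightarrow> p \<in> frontier A" using fr[OF p(2-4)] fb p(1) by simp
    have "p \<in> fepi a u f \<longleftrightarrow> s \<ge> f b"
      unfolding fepi_def p(1) using inj[OF _ p(2)] p(2) by blast
    then show "p \<in> fepi a u f \<longleftrightarrow> p \<in> A" using mem[OF p(2-4)] fb p(1) by simp
  qed
  then show ?thesis using ed f fa der by blast
qed

end

section \<open>Proximal subgradients and second order expansions\<close>

lemma le_limit_small:
  fixes A B C :: real
  assumes t0: "t0 > 0" and le: "\<And>t. 0 < t \<Longrightarrow> t < t0 \<Longrightarrow> A \<le> B + C * t"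
  shows "A \<le> B"
proof (rule field_le_epsilon)
  fix e :: real assume e: "e > 0"
  define t where "t = min (t0 / 2) (e / (\<bar>C\<bar> + 1))"
  have t: "0 < t" "t < t0" using t0 e min.cobounded1[of "t0 / 2" "e / (\<bar>C\<bar> + 1)"] by (auto simp: t_def simp del: min.cobounded1)
  have "t \<le> e / (\<bar>C\<bar> + 1)" by (simp add: t_def)
  then have "(\<bar>C\<bar> + 1) * t \<le> e" by (simp add: field_simps)
  moreover have "C * t \<le> (\<bar>C\<bar> + 1) * t" using t by (intro mult_right_mono) auto
  ultimately show "A \<le> B + e" using le[OF t] by linarith
qed

text \<open>On a partition into N intervals the quadratic errors add up to only C / N. This
  integrates an inequality between increments where no derivative is at hand.\<close>

lemma abs_diff_le_of_quadratic_chain: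
  fixes \<phi> :: "real \<Rightarrow> real"
  assumes C: "C \<ge> 0"
    and le: "\<And>s t. 0 \<le> s \<Longrightarrow> s \<le> 1 \<Longrightarrow> 0 \<le> t \<Longrightarrow> t \<le> 1 \<Longrightarrow> \<phi> s - \<phi> t \<ge> - E * \<bar>s - t\<bar> - C * (s - t)\<^sup>2"
  shows "\<bar>\<phi> 1 - \<phi> 0\<bar> \<le> E"
proof (rule le_limit_small[of 1])
  fix e :: real assume e: "0 < e" "e < 1"
  obtain n :: nat where n: "inverse (real (Suc n)) < e" using reals_Archimedean e by blast
  define N where "N = real (Suc n)"
  have N: "N > 0" "1 / N < e" using n by (auto simp: N_def inverse_eq_divide)
  have step: "\<bar>\<phi> (real (Suc k) / N) - \<phi> (real k / N)\<bar> \<le> E / N + C / N\<^sup>2" if "Suc k \<le> Suc n" for k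
  proof -
    have r: "real (Suc k) / N \<le> 1" "real k / N \<le> 1" "0 \<le> real (Suc k) / N" "0 \<le> real k / N"
      using that N by (auto simp: N_def)
    have d: "real (Suc k) / N - real k / N = 1 / N" by (simp add: diff_divide_distrib[symmetric])
    then have d': "real k / N - real (Suc k) / N = - (1 / N)" by simp
    show ?thesis using le[OF r(3,1,4,2)] le[OF r(4,2,3,1)] N(1) unfolding d d'
      by (simp add: abs_le_iff power_divide)
  qed
  have "\<bar>\<phi> (real k / N) - \<phi> 0\<bar> \<le> real k * (E / N + C / N\<^sup>2)" if "k \<le> Suc n" for k
    using that
  proof (induction k)
    case (Suc k)
    then have "\<bar>\<phi> (real k / N) - \<phi> 0\<bar> \<le> real k * (E / N + C / N\<^sup>2)" by simp
    then have "\<bar>\<phi> (real (Suc k) / N) - \<phi> 0\<bar> \<le> real k * (E / N + C / N\<^sup>2) + (E / N + C / N\<^sup>2)"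
      using step[OF Suc.prems] by linarith
    then show ?case by (simp add: distrib_right)
  qed simp
  from this[of "Suc n"] have "\<bar>\<phi> (N / N) - \<phi> 0\<bar> \<le> N * (E / N + C / N\<^sup>2)" by (simp only: N_def le_refl)
  also have "N * (E / N + C / N\<^sup>2) = E + C * (1 / N)" using N(1) by (simp add: field_simps power2_eq_square)
  also have "\<dots> \<le> E + C * e" using N(2) C by (intro add_left_mono mult_left_mono) auto
  finally show "\<bar>\<phi> 1 - \<phi> 0\<bar> \<le> E + C * e" using N(1) by simp
qed simp

text \<open>The constant \<kappa> is the same at all points and the inequality holds on all of V, so
  two subgradients can be tested against each other: (p - q) . (x - y) \<ge> -2 \<kappa> |x - y|^2.
  Requiring q in V removes the normal component, which the inequality cannot see.\<close>

definition proximal_subgradient ::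
  "'a::real_inner set \<Rightarrow> ('a \<Rightarrow> real) \<Rightarrow> real \<Rightarrow> 'a \<Rightarrow> 'a \<Rightarrow> bool" where
  "proximal_subgradient V F \<kappa> z q \<longleftrightarrow> q \<in> V \<and> (\<forall>x\<in>V. F x \<ge> F z + q \<bullet> (x - z) - \<kappa> * (norm (x - z))\<^sup>2)"

lemma linear_normE:
  fixes D :: "'a::euclidean_space \<Rightarrow> 'b::real_normed_vector"
  assumes "linear D" obtains K where "K > 0" "\<And>x. norm (D x) \<le> K * norm x"
  using bounded_linear.pos_bounded[of D] linear_conv_bounded_linear assms
  by (metis mult.commute)

text \<open>A second order expansion of \<open>F\<close> differentiates all its proximal subgradients: test the
  subgradient inequality at \<open>z + t |z| e\<close> with \<open>e\<close> the direction of \<open>q - D z\<close>.\<close>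

lemma subgradient_expansion:
  fixes D :: "'a::euclidean_space \<Rightarrow> 'a"
  assumes V: "subspace V" and D: "linear D" "\<And>z. z \<in> V \<Longrightarrow> D z \<in> V"
    and sym: "\<And>x z. x \<in> V \<Longrightarrow> z \<in> V \<Longrightarrow> D x \<bullet> z = D z \<bullet> x" and kap: "\<kappa> \<ge> 0"
    and F: "\<And>\<epsilon>. \<epsilon> > 0 \<Longrightarrow> \<exists>\<delta>>0. \<forall>z\<in>V. norm z < \<delta> \<longrightarrow> \<bar>F z - D z \<bullet> z / 2\<bar> \<le> \<epsilon> * (norm z)\<^sup>2"
    and e: "\<epsilon> > 0"
  shows "\<exists>\<delta>>0. \<forall>z\<in>V. \<forall>q. norm z < \<delta> \<and> proximal_subgradient V F \<kappa> z q \<longrightarrow> norm (q - D z) \<le> \<epsilon> * norm z"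
proof -
  obtain K where K: "K > 0" "\<And>x. norm (D x) \<le> K * norm x" using linear_normE[OF D(1)] by blast
  have DK: "\<bar>D x \<bullet> x\<bar> \<le> K * (norm x)\<^sup>2" for x
    using Cauchy_Schwarz_ineq2[of "D x" x] mult_right_mono[OF K(2)[of x] norm_ge_zero[of x]]
    by (simp add: power2_eq_square)
  \<comment> \<open>The step length s = t |z| is so small that the quadratic term costs at most
    \<epsilon>/2 |z|; \<epsilon>1 below is chosen so that 5 \<epsilon>1 |z|^2, divided by s, costs
    the other half.\<close>
  define t where "t = min 1 (\<epsilon> / (2 * (\<kappa> + K)))"
  have t: "0 < t" "t \<le> 1" "(\<kappa> + K) * t \<le> \<epsilon> / 2"
  proof -
    have "t \<le> \<epsilon> / (2 * (\<kappa> + K))" by (simp add: t_def)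
    then show "(\<kappa> + K) * t \<le> \<epsilon> / 2" using K kap by (simp add: field_simps)
  qed (use e K kap in \<open>auto simp: t_def\<close>)
  define \<epsilon>1 where "\<epsilon>1 = t * \<epsilon> / 10"
  have e1: "\<epsilon>1 > 0" using t e by (simp add: \<epsilon>1_def)
  obtain \<delta> where \<delta>: "\<delta> > 0" "\<And>z. z \<in> V \<Longrightarrow> norm z < \<delta> \<Longrightarrow> \<bar>F z - D z \<bullet> z / 2\<bar> \<le> \<epsilon>1 * (norm z)\<^sup>2"
    using F[OF e1] by blast
  have key: "s * norm (q - D z) \<le> (\<kappa> + K) * s\<^sup>2 + \<epsilon>1 * ((norm z + s)\<^sup>2 + (norm z)\<^sup>2)"
    if z: "z \<in> V" "norm z < \<delta>" and q: "proximal_subgradient V F \<kappa> z q" and s: "s > 0" "norm z + s < \<delta>" for z q s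
  proof (cases "q = D z")
    case True
    then show ?thesis using e1 K kap by simp
  next
    case False
    define m where "m = norm (q - D z)"
    define e where "e = (1 / m) *\<^sub>R (q - D z)"
    have m: "m > 0" using False by (simp add: m_def)
    have ne: "norm e = 1" using m by (simp add: e_def m_def)
    have qe: "q = D z + m *\<^sub>R e" using m by (simp add: e_def)
    have eV: "e \<in> V" using q z D(2) V unfolding e_def proximal_subgradient_def
      by (intro subspace_scale subspace_diff) auto
    define x where "x = z + s *\<^sub>R e"
    have xV: "x \<in> V" using V z(1) eV by (simp add: x_def subspace_add subspace_scale)
    have nx: "norm x \<le> norm z + s" using norm_triangle_ineq[of z "s *\<^sub>R e"] ne s by (simp add: x_def)
    have "F x \<ge> F z + q \<bullet> (x - z) - \<kappa> * (norm (x - z))\<^sup>2" using q xV by (auto simp: proximal_subgradient_def)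
    then have "F x \<ge> F z + s * (D z \<bullet> e + m) - \<kappa> * s\<^sup>2"
      using ne s by (simp add: x_def qe inner_add_left norm_eq_1)
    moreover have "F x \<le> D x \<bullet> x / 2 + \<epsilon>1 * (norm z + s)\<^sup>2"
    proof -
      have "F x \<le> D x \<bullet> x / 2 + \<epsilon>1 * (norm x)\<^sup>2" using \<delta>(2)[OF xV] nx s(2) by simp
      also have "\<epsilon>1 * (norm x)\<^sup>2 \<le> \<epsilon>1 * (norm z + s)\<^sup>2" using e1 nx by (intro mult_left_mono power_mono) auto
      finally show ?thesis by simp
    qed
    moreover have "F z \<ge> D z \<bullet> z / 2 - \<epsilon>1 * (norm z)\<^sup>2" using \<delta>(2)[OF z] by simp
    moreover have "D x \<bullet> x = D z \<bullet> z + 2 * s * (D z \<bullet> e) + s\<^sup>2 * (D e \<bullet> e)"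
      using sym[OF eV z(1)] by (simp add: x_def linear_add[OF D(1)] linear_cmul[OF D(1)] inner_add_left inner_add_right
          power2_eq_square algebra_simps)
    moreover have "s\<^sup>2 * (D e \<bullet> e) \<le> s\<^sup>2 * K" using DK[of e] ne by (intro mult_left_mono) auto
    ultimately have "s * m \<le> \<kappa> * s\<^sup>2 + s\<^sup>2 * K / 2 + \<epsilon>1 * (norm z + s)\<^sup>2 + \<epsilon>1 * (norm z)\<^sup>2"
      unfolding distrib_left by linarith
    moreover have "0 \<le> s\<^sup>2 * K" using K(1) by simp
    ultimately show ?thesis unfolding m_def by (simp add: algebra_simps)
  qed
  have "norm (q - D z) \<le> \<epsilon> * norm z"
    if z: "z \<in> V" "norm z < \<delta> / 2" and q: "proximal_subgradient V F \<kappa> z q" for z q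
  proof (cases "z = 0")
    case True
    \<comment> \<open>At z = 0 there is no scale |z| for the step; here s tends to 0 freely and
      forces q = 0.\<close>
    have "norm (q - D z) \<le> 0"
    proof (rule le_limit_small[of \<delta>])
      fix s assume s: "0 < s" "s < \<delta>"
      have "s * norm (q - D z) \<le> s * (0 + (\<kappa> + K + \<epsilon>1) * s)"
        using key[OF z(1) _ q s(1)] s True by (simp add: power2_eq_square algebra_simps)
      then show "norm (q - D z) \<le> 0 + (\<kappa> + K + \<epsilon>1) * s" using s(1) by (rule mult_left_le_imp_le)
    qed (use \<delta> in simp)
    then show ?thesis using True by simp
  next
    case False
    then have nz: "norm z > 0" by simp
    define s where "s = t * norm z"
    have s: "0 < s" "s \<le> norm z" using t nz by (auto simp: s_def)
    have "s * norm (q - D z) \<le> (\<kappa> + K) * s\<^sup>2 + \<epsilon>1 * ((norm z + s)\<^sup>2 + (norm z)\<^sup>2)"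
      using key[OF z(1) _ q s(1)] z(2) s by simp
    also have "(norm z + s)\<^sup>2 \<le> (2 * norm z)\<^sup>2" using s by (intro power_mono) auto
    finally have "s * norm (q - D z) \<le> (\<kappa> + K) * s\<^sup>2 + \<epsilon>1 * ((2 * norm z)\<^sup>2 + (norm z)\<^sup>2)" using e1 by simp
    also have "\<dots> = s * ((\<kappa> + K) * t * norm z + \<epsilon> / 2 * norm z)"
      using t(1) by (simp add: s_def \<epsilon>1_def power2_eq_square field_simps)
    finally have "norm (q - D z) \<le> (\<kappa> + K) * t * norm z + \<epsilon> / 2 * norm z"
      using s(1) by (rule mult_left_le_imp_le)
    also have "(\<kappa> + K) * t * norm z \<le> \<epsilon> / 2 * norm z" using t(3) by (intro mult_right_mono) auto
    finally show ?thesis by simp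
  qed
  then show ?thesis using \<delta>(1) by (intro exI[of _ "\<delta> / 2"]) auto
qed

text \<open>Hypomonotonicity spreads a first order expansion known only at subgradients over an
  asymptotically dense set of base points to all subgradients.\<close>

lemma subgradient_expansion_of_approx:
  fixes D :: "'a::euclidean_space \<Rightarrow> 'a"
  assumes V: "subspace V" and D: "linear D" "\<And>z. z \<in> V \<Longrightarrow> D z \<in> V" and kap: "\<kappa> \<ge> 0"
    and approx: "\<And>\<epsilon>. \<epsilon> > 0 \<Longrightarrow> \<exists>\<delta>>0. \<forall>x\<in>V. norm x < \<delta> \<longrightarrow>
      (\<exists>b\<in>V. \<exists>q. proximal_subgradient V F \<kappa> b q \<and> norm (b - x) \<le> \<epsilon> * norm x \<and> norm (q - D x) \<le> \<epsilon> * norm x)"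
    and e: "\<epsilon> > 0"
  shows "\<exists>\<delta>>0. \<forall>z\<in>V. \<forall>p. z \<noteq> 0 \<and> norm z < \<delta> \<and> proximal_subgradient V F \<kappa> z p \<longrightarrow> norm (p - D z) \<le> \<epsilon> * norm z"
proof -
  obtain K where K: "K > 0" "\<And>x. norm (D x) \<le> K * norm x" using linear_normE[OF D(1)] by blast
  \<comment> \<open>After division by t n / 2, the variation of D along the step together with the
    approximation error contributes 4 (K + 1) t n, and hypomonotonicity 16 \<kappa> t n.\<close>
  define M where "M = 4 * (K + 1) + 16 * \<kappa>"
  have M: "M > 0" using K kap by (simp add: M_def)
  define t where "t = min 1 (\<epsilon> / M)"
  have t: "0 < t" "t \<le> 1" using e M by (auto simp: t_def)
  have "t \<le> \<epsilon> / M" by (simp add: t_def)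
  then have tM: "M * t \<le> \<epsilon>" using M by (simp add: field_simps)
  obtain \<delta> where \<delta>: "\<delta> > 0" and ap: "\<And>x. x \<in> V \<Longrightarrow> norm x < \<delta> \<Longrightarrow>
      \<exists>b\<in>V. \<exists>q. proximal_subgradient V F \<kappa> b q \<and> norm (b - x) \<le> t / 4 * norm x \<and> norm (q - D x) \<le> t / 4 * norm x"
    using approx[of "t / 4"] t by fastforce
  have "norm (p - D z) \<le> \<epsilon> * norm z"
    if z: "z \<in> V" "norm z < \<delta> / 2" "z \<noteq> 0" and p: "proximal_subgradient V F \<kappa> z p" for z p
  proof (cases "p = D z")
    case False
    define n where "n = norm z"
    have n: "n > 0" using z by (simp add: n_def)
    define m where "m = norm (p - D z)"
    define e where "e = (1 / m) *\<^sub>R (p - D z)"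
    have m: "m > 0" using False by (simp add: m_def)
    have ne: "norm e = 1" using m by (simp add: e_def m_def)
    have pe: "p = D z + m *\<^sub>R e" using m by (simp add: e_def)
    have eV: "e \<in> V" using p z D(2) V unfolding e_def proximal_subgradient_def
      by (intro subspace_scale subspace_diff) auto
    \<comment> \<open>A step from z of length t |z| along the error p - D z. The good base point b
      near x is off by at most half that length, so b - z still advances by t n / 2 along e, and
      testing p against the subgradient at b bounds m.\<close>
    define x where "x = z + (t * n) *\<^sub>R e"
    have xV: "x \<in> V" using V z(1) eV by (simp add: x_def subspace_add subspace_scale)
    have "norm x \<le> n + t * n" using norm_triangle_ineq[of z "(t * n) *\<^sub>R e"] ne t n by (simp add: x_def n_def)
    also have "t * n \<le> 1 * n" using t n by (intro mult_right_mono) auto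
    finally have nx: "norm x \<le> 2 * n" by simp
    obtain b q where b: "b \<in> V" "proximal_subgradient V F \<kappa> b q"
      "norm (b - x) \<le> t / 4 * norm x" "norm (q - D x) \<le> t / 4 * norm x"
      using ap[OF xV] nx z(2) by (auto simp: n_def)
    have t4: "t / 4 * norm x \<le> t / 2 * n" using nx t mult_left_mono[OF nx, of "t / 4"] by simp
    define r2 where "r2 = b - x"
    define r1 where "r1 = q - D x"
    have r: "norm r2 \<le> t / 2 * n" "norm r1 \<le> t / 2 * n" using b(3,4) t4 by (auto simp: r1_def r2_def)
    have bz: "b - z = (t * n) *\<^sub>R e + r2" by (simp add: r2_def x_def)
    have qq: "q = D z + (t * n) *\<^sub>R D e + r1" by (simp add: r1_def x_def linear_add[OF D(1)] linear_cmul[OF D(1)])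
    have tn: "t * n > 0" using t n by simp
    have nbz: "norm (b - z) \<le> 2 * t * n"
      using norm_triangle_ineq[of "(t * n) *\<^sub>R e" r2] r ne tn unfolding bz by simp
    have h1: "F b \<ge> F z + p \<bullet> (b - z) - \<kappa> * (norm (b - z))\<^sup>2" using p b(1) by (simp add: proximal_subgradient_def)
    have h2: "F z \<ge> F b + q \<bullet> (z - b) - \<kappa> * (norm (z - b))\<^sup>2" using b(2) z(1) by (simp add: proximal_subgradient_def)
    have "(p - q) \<bullet> (b - z) \<le> 2 * \<kappa> * (norm (b - z))\<^sup>2"
      using h1 h2 by (simp add: norm_minus_commute[of z b] inner_diff_left inner_diff_right algebra_simps)
    also have "\<dots> \<le> 2 * \<kappa> * (2 * t * n)\<^sup>2" using kap nbz by (intro mult_left_mono power_mono) auto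
    finally have up: "(p - q) \<bullet> (b - z) \<le> 8 * \<kappa> * (t * n)\<^sup>2" by (simp add: power_mult_distrib)
    define w where "w = (t * n) *\<^sub>R D e + r1"
    have "norm w \<le> (t * n) * K + t / 2 * n"
    proof -
      have "norm w \<le> norm ((t * n) *\<^sub>R D e) + norm r1" unfolding w_def by (rule norm_triangle_ineq)
      also have "norm ((t * n) *\<^sub>R D e) \<le> (t * n) * K" using K(2)[of e] ne t n by simp
      finally show ?thesis using r by linarith
    qed
    also have "\<dots> \<le> (K + 1) * (t * n)" using t n by (simp add: algebra_simps)
    finally have w: "norm w \<le> (K + 1) * (t * n)" .
    have "p - q = m *\<^sub>R e - w" by (simp add: pe qq w_def)
    then have "(p - q) \<bullet> (b - z) = m * (e \<bullet> (b - z)) - w \<bullet> (b - z)" by (simp add: inner_diff_left)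
    moreover have "e \<bullet> (b - z) \<ge> t * n / 2"
    proof -
      have "\<bar>e \<bullet> r2\<bar> \<le> norm r2" using Cauchy_Schwarz_ineq2[of e r2] ne by simp
      moreover have "e \<bullet> (b - z) = t * n + e \<bullet> r2" using ne unfolding bz by (simp add: inner_add_right norm_eq_1)
      ultimately show ?thesis using r(1) by linarith
    qed
    then have "m * (e \<bullet> (b - z)) \<ge> m * (t * n / 2)" using m by simp
    moreover have "w \<bullet> (b - z) \<le> ((K + 1) * (t * n)) * (2 * t * n)"
    proof -
      have "w \<bullet> (b - z) \<le> norm w * norm (b - z)" by (rule norm_cauchy_schwarz)
      also have "\<dots> \<le> ((K + 1) * (t * n)) * (2 * t * n)" using w nbz K t n by (intro mult_mono) auto
      finally show ?thesis .
    qed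
    ultimately have "m * (t * n / 2) \<le> ((K + 1) * (t * n)) * (2 * t * n) + 8 * \<kappa> * (t * n)\<^sup>2"
      using up by linarith
    then have "(t * n / 2) * m \<le> (t * n / 2) * (M * t * n)" by (simp add: M_def power2_eq_square algebra_simps)
    then have "m \<le> M * t * n" by (rule mult_left_le_imp_le) (use t n in simp)
    also have "\<dots> \<le> \<epsilon> * n" using tM n by simp
    finally show ?thesis by (simp add: m_def n_def)
  qed (use e in simp)
  then show ?thesis using \<delta> by (intro exI[of _ "\<delta> / 2"]) auto
qed

text \<open>Along a ray, subgradients bound the increments of F (t z) - t^2 / 2 D z . z from below,
  whichever way the ray is traversed; \<open>abs_diff_le_of_quadratic_chain\<close> integrates these
  bounds.\<close>

lemma second_order_of_subgradients:
  fixes D :: "'a::euclidean_space \<Rightarrow> 'a"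
  assumes V: "subspace V" and D: "linear D" and kap: "\<kappa> \<ge> 0" and F0: "F 0 = 0"
    and R: "R > 0" and p: "\<And>z. z \<in> V \<Longrightarrow> norm z < R \<Longrightarrow> proximal_subgradient V F \<kappa> z (p z)"
    and pD: "\<And>\<epsilon>. \<epsilon> > 0 \<Longrightarrow> \<exists>\<delta>>0. \<forall>z\<in>V. norm z < \<delta> \<longrightarrow> norm (p z - D z) \<le> \<epsilon> * norm z"
    and e: "\<epsilon> > 0"
  shows "\<exists>\<delta>>0. \<forall>z\<in>V. norm z < \<delta> \<longrightarrow> \<bar>F z - D z \<bullet> z / 2\<bar> \<le> \<epsilon> * (norm z)\<^sup>2"
proof -
  obtain K where K: "K > 0" "\<And>x. norm (D x) \<le> K * norm x" using linear_normE[OF D(1)] by blast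
  obtain \<delta> where \<delta>: "\<delta> > 0" "\<And>z. z \<in> V \<Longrightarrow> norm z < \<delta> \<Longrightarrow> norm (p z - D z) \<le> \<epsilon> * norm z"
    using pD[OF e] by blast
  have "\<bar>F z - D z \<bullet> z / 2\<bar> \<le> \<epsilon> * (norm z)\<^sup>2" if z: "z \<in> V" "norm z < min \<delta> R" for z
  proof -
    define B where "B = D z \<bullet> z"
    have B: "\<bar>B\<bar> \<le> K * (norm z)\<^sup>2"
      using Cauchy_Schwarz_ineq2[of "D z" z] mult_right_mono[OF K(2)[of z] norm_ge_zero[of z]]
      by (simp add: power2_eq_square B_def)
    define \<phi> where "\<phi> t = F (t *\<^sub>R z) - t\<^sup>2 / 2 * B" for t
    have "\<bar>\<phi> 1 - \<phi> 0\<bar> \<le> \<epsilon> * (norm z)\<^sup>2"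
    proof (rule abs_diff_le_of_quadratic_chain[where C = "(\<kappa> + K) * (norm z)\<^sup>2"])
      show "0 \<le> (\<kappa> + K) * (norm z)\<^sup>2" using kap K by simp
      fix s t :: real assume s: "0 \<le> s" "s \<le> 1" and t: "0 \<le> t" "t \<le> 1"
      have "t * norm z \<le> 1 * norm z" using t by (intro mult_right_mono) auto
      then have nt: "norm (t *\<^sub>R z) \<le> norm z" using t by simp
      have tV: "t *\<^sub>R z \<in> V" "s *\<^sub>R z \<in> V" using V z by (auto intro: subspace_scale)
      have "F (s *\<^sub>R z) \<ge> F (t *\<^sub>R z) + p (t *\<^sub>R z) \<bullet> (s *\<^sub>R z - t *\<^sub>R z) - \<kappa> * (norm (s *\<^sub>R z - t *\<^sub>R z))\<^sup>2"
        using p[OF tV(1)] nt z(2) tV(2) by (simp add: proximal_subgradient_def)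
      moreover have "s *\<^sub>R z - t *\<^sub>R z = (s - t) *\<^sub>R z" by (simp add: algebra_simps)
      ultimately have h: "F (s *\<^sub>R z) \<ge> F (t *\<^sub>R z) + (s - t) * (p (t *\<^sub>R z) \<bullet> z) - \<kappa> * (s - t)\<^sup>2 * (norm z)\<^sup>2"
        by (simp add: power_mult_distrib)
      define \<theta> where "\<theta> = (p (t *\<^sub>R z) - D (t *\<^sub>R z)) \<bullet> z"
      have "norm (p (t *\<^sub>R z) - D (t *\<^sub>R z)) \<le> \<epsilon> * norm (t *\<^sub>R z)" using \<delta>(2)[OF tV(1)] nt z(2) by simp
      also have "\<dots> \<le> \<epsilon> * norm z" using nt e by (intro mult_left_mono) auto
      finally have "\<bar>\<theta>\<bar> \<le> \<epsilon> * norm z * norm z"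
        using Cauchy_Schwarz_ineq2[of "p (t *\<^sub>R z) - D (t *\<^sub>R z)" z]
          mult_right_mono[of "norm (p (t *\<^sub>R z) - D (t *\<^sub>R z))" "\<epsilon> * norm z" "norm z"]
        unfolding \<theta>_def by (smt (verit) norm_ge_zero)
      then have "\<bar>s - t\<bar> * \<bar>\<theta>\<bar> \<le> \<bar>s - t\<bar> * (\<epsilon> * (norm z)\<^sup>2)"
        by (intro mult_left_mono) (auto simp: power2_eq_square)
      then have th: "(s - t) * \<theta> \<ge> - (\<epsilon> * (norm z)\<^sup>2) * \<bar>s - t\<bar>"
        using abs_le_D2[of "(s - t) * \<theta>" "\<bar>s - t\<bar> * (\<epsilon> * (norm z)\<^sup>2)"] by (simp add: abs_mult mult.commute)
      have "p (t *\<^sub>R z) \<bullet> z = t * B + \<theta>"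
        by (simp add: \<theta>_def B_def inner_diff_left linear_cmul[OF D])
      then have "\<phi> s - \<phi> t \<ge> (s - t) * (t * B + \<theta>) - \<kappa> * (s - t)\<^sup>2 * (norm z)\<^sup>2 - (s\<^sup>2 - t\<^sup>2) / 2 * B"
        using h by (simp add: \<phi>_def algebra_simps diff_divide_distrib)
      moreover have "(s - t) * (t * B + \<theta>) - (s\<^sup>2 - t\<^sup>2) / 2 * B = (s - t) * \<theta> - (s - t)\<^sup>2 / 2 * B"
        by (simp add: power2_eq_square field_simps)
      moreover have "(s - t)\<^sup>2 / 2 * B \<le> (s - t)\<^sup>2 * (K * (norm z)\<^sup>2)"
      proof -
        have "(s - t)\<^sup>2 / 2 * B \<le> (s - t)\<^sup>2 / 2 * (K * (norm z)\<^sup>2)" using B by (intro mult_left_mono) auto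
        also have "\<dots> \<le> (s - t)\<^sup>2 * (K * (norm z)\<^sup>2)" using K(1) by (intro mult_right_mono) auto
        finally show ?thesis .
      qed
      ultimately show "\<phi> s - \<phi> t \<ge> - (\<epsilon> * (norm z)\<^sup>2) * \<bar>s - t\<bar> - (\<kappa> + K) * (norm z)\<^sup>2 * (s - t)\<^sup>2"
        using th by (simp add: algebra_simps)
    qed
    then show ?thesis by (simp add: \<phi>_def B_def F0)
  qed
  then show ?thesis using \<delta>(1) R by (intro exI[of _ "min \<delta> R"]) auto
qed

text \<open>v = (u + q) / s with s = 1 / (v . u) and s^2 = 1 + |q|^2. So v - u and the slope q
  differ by a vector of length s - 1, which is quadratic in either of them.\<close>

lemma normal_slope_bounds:
  fixes u v :: "'a::real_inner"
  assumes u: "norm u = 1" and v: "norm v = 1" and vu: "v \<bullet> u > 0"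
  defines "q \<equiv> (1 / (v \<bullet> u)) *\<^sub>R v - u"
  shows "q \<bullet> u = 0" and "norm (v - u - q) \<le> (norm q)\<^sup>2"
    and "norm (v - u) \<le> 1 \<Longrightarrow> norm (q - (v - u)) \<le> 2 * (norm (v - u))\<^sup>2"
proof -
  define s where "s = 1 / (v \<bullet> u)"
  have s: "s > 0" "s * (v \<bullet> u) = 1" using vu by (auto simp: s_def)
  show qu: "q \<bullet> u = 0" using vu u by (simp add: q_def inner_diff_left norm_eq_1)
  have vuq: "v \<bullet> u = 1 / s" using vu by (simp add: s_def)
  have qu': "q + u = s *\<^sub>R v" by (simp add: q_def s_def)
  have "(norm (q + u))\<^sup>2 = (norm q)\<^sup>2 + 1"
    unfolding power2_norm_eq_inner inner_add_left inner_add_right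
    using qu u by (simp add: inner_commute[of u q] norm_eq_1)
  then have s2: "s\<^sup>2 = (norm q)\<^sup>2 + 1" using s v unfolding qu' by simp
  then have s1: "s \<ge> 1" using s(1) power_le_one[of s 2]
    by (smt (verit, best) zero_le_power2 power2_le_imp_le one_power2)
  have "v - u - q = (1 - s) *\<^sub>R v" by (simp add: q_def s_def algebra_simps)
  then have eq: "norm (v - u - q) = s - 1" using s1 v by simp
  have "s - 1 \<le> (s - 1) * (s + 1)" using s1 by (simp add: mult_le_cancel_left1)
  also have "\<dots> = (norm q)\<^sup>2" using s2 by (simp add: power2_eq_square algebra_simps)
  finally show "norm (v - u - q) \<le> (norm q)\<^sup>2" using eq by simp
  assume small: "norm (v - u) \<le> 1"
  have d2: "(norm (v - u))\<^sup>2 = 2 * (1 - 1 / s)" using unit_dist_sq[OF v u] vuq by simp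
  have "(norm (v - u))\<^sup>2 \<le> 1" using small by (simp add: power_le_one)
  then have "1 / s \<ge> 1/2" using d2 by simp
  then have "s \<le> 2" using s by (simp add: field_simps)
  have "s - 1 = s * (1 - 1 / s)" using s by (simp add: field_simps)
  also have "\<dots> \<le> 2 * (1 - 1 / s)" using \<open>s \<le> 2\<close> s1 by (intro mult_right_mono) auto
  also have "\<dots> = (norm (v - u))\<^sup>2" using d2 by simp
  finally have "norm (q - (v - u)) \<le> (norm (v - u))\<^sup>2" using eq by (simp add: norm_minus_commute)
  then show "norm (q - (v - u)) \<le> 2 * (norm (v - u))\<^sup>2" using zero_le_power2[of "norm (v - u)"] by linarith
qed

text \<open>A touching ball of any radius at a graph point gives a subgradient with the global
  semiconvexity constant, since the local paraboloid bound self-improves along convex rays.\<close>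

lemma proximal_subgradient_of_normal:
  fixes u v a b :: "'a::euclidean_space"
  assumes u: "norm u = 1" and v: "norm v = 1"
    and cvx: "convex_on (hplane a u) (\<lambda>x. \<kappa> * (norm (x - a))\<^sup>2 + f x)" and kap: "\<kappa> \<ge> 0"
    and lip: "K-lipschitz_on (hplane a u) f" and b: "b \<in> hplane a u" and r0: "r0 > 0"
    and E: "\<And>x s. x \<in> hplane a u \<Longrightarrow> norm (x - b) < r0 \<Longrightarrow> f x \<le> s \<Longrightarrow> s < f x + r0 \<Longrightarrow> x - s *\<^sub>R u \<in> E"
    and \<sigma>: "\<sigma> > 0" and touch: "\<And>y. y \<in> E \<Longrightarrow> 2 * \<sigma> * (v \<bullet> (y - (b - f b *\<^sub>R u))) \<le> (norm (y - (b - f b *\<^sub>R u)))\<^sup>2"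
  shows "v \<bullet> u > 0"
    and "proximal_subgradient {z. z \<bullet> u = 0} (\<lambda>z. f (a + z)) \<kappa> (b - a) ((1 / (v \<bullet> u)) *\<^sub>R v - u)"
proof -
  have K: "K \<ge> 0" using lip by (rule lipschitz_on_nonneg)
  have in_plane: "b + w \<in> hplane a u" if "w \<bullet> u = 0" for w
    using b that by (simp add: hplane_def inner_diff_left inner_add_left)
  have ineq: "2 * \<sigma> * (v \<bullet> w - (f (b + w) - f b) * (v \<bullet> u)) \<le> (1 + K\<^sup>2) * (norm w)\<^sup>2"
    if w: "w \<bullet> u = 0" "norm w < r0" for w
  proof -
    define \<Delta> where "\<Delta> = f (b + w) - f b"
    have "(b + w) - f (b + w) *\<^sub>R u \<in> E" by (rule E[OF in_plane[OF w(1)]]) (use w r0 in auto)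
    from touch[OF this] have "2 * \<sigma> * (v \<bullet> (w - \<Delta> *\<^sub>R u)) \<le> (norm (w - \<Delta> *\<^sub>R u))\<^sup>2"
      by (simp add: \<Delta>_def algebra_simps)
    also have "(norm (w - \<Delta> *\<^sub>R u))\<^sup>2 = (norm w)\<^sup>2 + \<Delta>\<^sup>2"
      unfolding power2_norm_eq_inner inner_diff_left inner_diff_right
      using w(1) u by (simp add: inner_commute[of u w] norm_eq_1 power2_eq_square)
    also have "\<Delta>\<^sup>2 \<le> K\<^sup>2 * (norm w)\<^sup>2"
    proof -
      have "\<bar>\<Delta>\<bar> \<le> K * norm w" using lipschitz_onD[OF lip in_plane[OF w(1)] b] by (simp add: \<Delta>_def dist_norm)
      then have "\<bar>\<Delta>\<bar>\<^sup>2 \<le> (K * norm w)\<^sup>2" by (rule power_mono) simp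
      then show ?thesis by (simp add: power_mult_distrib)
    qed
    finally show ?thesis by (simp add: \<Delta>_def inner_diff_right algebra_simps)
  qed
  \<comment> \<open>Points straight below the graph lie in E, so v cannot point downwards.\<close>
  have ge0: "v \<bullet> u \<ge> 0"
  proof -
    have "- (v \<bullet> u) \<le> 0"
    proof (rule le_limit_small[OF r0])
      fix s assume s: "0 < s" "s < r0"
      have "b - (f b + s) *\<^sub>R u \<in> E" by (rule E[OF b]) (use s r0 in auto)
      moreover have "b - (f b + s) *\<^sub>R u - (b - f b *\<^sub>R u) = - (s *\<^sub>R u)" by (simp add: algebra_simps)
      ultimately have "2 * \<sigma> * (v \<bullet> - (s *\<^sub>R u)) \<le> (norm (- (s *\<^sub>R u)))\<^sup>2" using touch by metis
      then have "s * (2 * \<sigma> * (- (v \<bullet> u))) \<le> s * s" using u by (simp add: power2_eq_square ac_simps)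
      then have "2 * \<sigma> * (- (v \<bullet> u)) \<le> s" using s(1) by (rule mult_left_le_imp_le)
      then show "- (v \<bullet> u) \<le> 0 + 1 / (2 * \<sigma>) * s" using \<sigma> by (simp add: field_simps)
    qed
    then show ?thesis by simp
  qed
  \<comment> \<open>A horizontal v could be followed along the graph itself, where the touching
    inequality would set a linear term in t below a quadratic one.\<close>
  have "v \<bullet> u \<noteq> 0"
  proof
    assume 0: "v \<bullet> u = 0"
    have "2 * \<sigma> \<le> 0"
    proof (rule le_limit_small[OF r0])
      fix t assume t: "0 < t" "t < r0"
      have "2 * \<sigma> * (v \<bullet> (t *\<^sub>R v)) \<le> (1 + K\<^sup>2) * (norm (t *\<^sub>R v))\<^sup>2"
        using ineq[of "t *\<^sub>R v"] 0 v t by simp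
      then have "t * (2 * \<sigma>) \<le> t * ((1 + K\<^sup>2) * t)" using v by (simp add: norm_eq_1 power2_eq_square ac_simps)
      then show "2 * \<sigma> \<le> 0 + (1 + K\<^sup>2) * t" using t by simp
    qed
    then show False using \<sigma> by simp
  qed
  then show vu: "v \<bullet> u > 0" using ge0 by simp
  define q where "q = (1 / (v \<bullet> u)) *\<^sub>R v - u"
  have qu: "q \<bullet> u = 0" unfolding q_def by (rule normal_slope_bounds(1)[OF u v vu])
  have sub: "f (b + w) \<ge> f b + q \<bullet> w - \<kappa> * (norm w)\<^sup>2" if w: "w \<bullet> u = 0" for w
  proof -
    define G where "G x = \<kappa> * (norm (x - a))\<^sup>2 + f x" for x
    have G: "G (b + t *\<^sub>R w) - G b = f (b + t *\<^sub>R w) - f b + \<kappa> * (2 * t * ((b - a) \<bullet> w) + t\<^sup>2 * (norm w)\<^sup>2)" for t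
    proof -
      have "b + t *\<^sub>R w - a = (b - a) + t *\<^sub>R w" by simp
      then have "(norm (b + t *\<^sub>R w - a))\<^sup>2 = (norm (b - a))\<^sup>2 + (2 * t * ((b - a) \<bullet> w) + t\<^sup>2 * (norm w)\<^sup>2)"
        by (simp only: power2_norm_eq_inner inner_add_left[of "b - a"] inner_add_right[of _ "b - a"])
           (simp add: inner_commute[of w "b - a"] power2_eq_square)
      then show ?thesis by (simp add: G_def distrib_left)
    qed
    define t0 where "t0 = min 1 (r0 / (norm w + 1))"
    have t0: "t0 > 0" using r0 by (simp add: t0_def add_nonneg_pos)
    \<comment> \<open>C depends on \<sigma> and K but enters with an extra factor t. Convexity of G
      bounds the increment at b + t w by t times the one at b + w, so t \<rightarrow> 0 removes C
      and leaves \<kappa> alone.\<close>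
    define C where "C = (1 + K\<^sup>2) * (norm w)\<^sup>2 / (2 * \<sigma> * (v \<bullet> u))"
    have "q \<bullet> w + 2 * \<kappa> * ((b - a) \<bullet> w) \<le> G (b + w) - G b"
    proof (rule le_limit_small[OF t0])
      fix t assume t: "0 < t" "t < t0"
      have t1: "t \<le> 1" "t * (norm w + 1) < r0" using t by (auto simp: t0_def pos_less_divide_eq add_nonneg_pos)
      have tw: "norm (t *\<^sub>R w) < r0" "(t *\<^sub>R w) \<bullet> u = 0" using t t1 w by (auto simp: algebra_simps)
      have vw: "v \<bullet> w = (v \<bullet> u) * (q \<bullet> w)" using w vu by (simp add: q_def inner_diff_left inner_commute[of u w])
      have "2 * \<sigma> * (v \<bullet> (t *\<^sub>R w) - (f (b + t *\<^sub>R w) - f b) * (v \<bullet> u)) \<le> (1 + K\<^sup>2) * (norm (t *\<^sub>R w))\<^sup>2"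
        by (rule ineq[OF tw(2,1)])
      then have "(2 * \<sigma> * (v \<bullet> u)) * (t * (q \<bullet> w) - (f (b + t *\<^sub>R w) - f b)) \<le> (1 + K\<^sup>2) * (norm w)\<^sup>2 * t\<^sup>2"
        using vw by (simp add: power_mult_distrib algebra_simps)
      also have "\<dots> = (2 * \<sigma> * (v \<bullet> u)) * (C * t\<^sup>2)" using \<sigma> vu by (simp add: C_def)
      finally have 1: "t * (q \<bullet> w) - (f (b + t *\<^sub>R w) - f b) \<le> C * t\<^sup>2"
        by (rule mult_left_le_imp_le) (use \<sigma> vu in simp)
      have "b + t *\<^sub>R w = (1 - t) *\<^sub>R b + t *\<^sub>R (b + w)" by (simp add: algebra_simps)
      then have "G (b + t *\<^sub>R w) \<le> (1 - t) * G b + t * G (b + w)"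
        using convex_onD[OF cvx, of t b "b + w"] t t1 b in_plane[OF w] unfolding G_def by simp
      then have 2: "G (b + t *\<^sub>R w) - G b \<le> t * (G (b + w) - G b)" by (simp add: algebra_simps)
      have "0 \<le> \<kappa> * (t\<^sup>2 * (norm w)\<^sup>2)" using kap by simp
      with 1 2 G[of t] have "t * (q \<bullet> w + 2 * \<kappa> * ((b - a) \<bullet> w)) \<le> t * (G (b + w) - G b + C * t)"
        by (simp add: power2_eq_square algebra_simps)
      then show "q \<bullet> w + 2 * \<kappa> * ((b - a) \<bullet> w) \<le> G (b + w) - G b + C * t"
        using t(1) by (rule mult_left_le_imp_le)
    qed
    then show ?thesis using G[of 1] by (simp add: algebra_simps)
  qed
  show "proximal_subgradient {z. z \<bullet> u = 0} (\<lambda>z. f (a + z)) \<kappa> (b - a) ((1 / (v \<bullet> u)) *\<^sub>R v - u)"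
    unfolding proximal_subgradient_def q_def[symmetric]
  proof (intro conjI ballI)
    fix x assume "x \<in> {z. z \<bullet> u = 0}"
    moreover have "(b - a) \<bullet> u = 0" using b by (simp add: hplane_def)
    ultimately have "(x - (b - a)) \<bullet> u = 0" by (simp add: inner_diff_left)
    from sub[OF this] show "f (a + (b - a)) + q \<bullet> (x - (b - a)) - \<kappa> * (norm (x - (b - a)))\<^sup>2 \<le> f (a + x)"
      by (simp add: algebra_simps)
  qed (use qu in simp)
qed

text \<open>The plane sees L and Q only on vectors orthogonal to u. There L vanishes because f has
  zero derivative, and D is the Riesz representation of Q composed with the orthogonal projection,
  hence tangential.\<close>

lemma second_order_atD:
  fixes u a :: "'a::euclidean_space"
  assumes u: "norm u = 1" and so: "second_order_at (hplane a u) f a L Q" and f0: "f a = 0"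
    and der: "(f has_derivative (\<lambda>h. 0)) (at a within hplane a u)"
  obtains D where "linear D" "\<And>z. D z \<bullet> u = 0"
    "\<And>x z. x \<bullet> u = 0 \<Longrightarrow> z \<bullet> u = 0 \<Longrightarrow> D x \<bullet> z = Q x z"
    "\<And>\<epsilon>. \<epsilon> > 0 \<Longrightarrow> \<exists>\<delta>>0. \<forall>z\<in>{z. z \<bullet> u = 0}. norm z < \<delta> \<longrightarrow> \<bar>f (a + z) - D z \<bullet> z / 2\<bar> \<le> \<epsilon> * (norm z)\<^sup>2"
proof -
  have L: "linear L" and Q: "bilinear Q" and
    lim: "((\<lambda>x. (f x - f a - L (x - a) - Q (x - a) (x - a) / 2) / (norm (x - a))\<^sup>2) \<longlongrightarrow> 0) (at a within hplane a u)"
    using so by (auto simp: second_order_at_def)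
  have Ql: "linear (\<lambda>x. Q x y)" "linear (Q x)" for x y using Q by (auto simp: bilinear_def)
  have ex: "\<exists>\<delta>>0. \<forall>z. z \<bullet> u = 0 \<and> norm z < \<delta> \<longrightarrow> \<bar>f (a + z) - L z - Q z z / 2\<bar> \<le> \<epsilon> * (norm z)\<^sup>2"
    if "\<epsilon> > 0" for \<epsilon>
  proof -
    from lim that obtain d where d: "d > 0" "\<And>x. x \<in> hplane a u \<Longrightarrow> 0 < dist x a \<Longrightarrow> dist x a < d \<Longrightarrow>
      \<bar>(f x - f a - L (x - a) - Q (x - a) (x - a) / 2) / (norm (x - a))\<^sup>2\<bar> < \<epsilon>"
      unfolding Lim_within by (metis diff_zero dist_real_def)
    have "\<bar>f (a + z) - L z - Q z z / 2\<bar> \<le> \<epsilon> * (norm z)\<^sup>2" if z: "z \<bullet> u = 0" "norm z < d" for z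
    proof (cases "z = 0")
      case True
      then show ?thesis using f0 linear_0[OF L] linear_0[OF Ql(2)] by simp
    next
      case False
      then show ?thesis using d(2)[of "a + z"] z f0
        by (simp add: hplane_def dist_norm abs_divide divide_less_eq)
    qed
    then show ?thesis using d(1) by blast
  qed
  have L0: "L h = 0" if h: "h \<bullet> u = 0" for h
  proof -
    have "\<bar>L h\<bar> \<le> \<epsilon> * norm h" if e: "\<epsilon> > 0" for \<epsilon>
    proof -
      obtain d1 where d1: "d1 > 0" "\<And>z. z \<bullet> u = 0 \<Longrightarrow> norm z < d1 \<Longrightarrow> \<bar>f (a + z) - L z - Q z z / 2\<bar> \<le> 1 * (norm z)\<^sup>2"
        using ex[of 1] by auto
      obtain d2 where d2: "d2 > 0" "\<And>y. y \<in> hplane a u \<Longrightarrow> norm (y - a) < d2 \<Longrightarrow> \<bar>f y\<bar> \<le> \<epsilon> * norm (y - a)"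
        using der e f0 unfolding has_derivative_within_alt by auto
      have np: "norm h + 1 > 0" by (simp add: add_nonneg_pos)
      show ?thesis
      proof (rule le_limit_small[of "min d1 d2 / (norm h + 1)"])
        show "0 < min d1 d2 / (norm h + 1)" using d1 d2 np by simp
        fix t assume t: "0 < t" "t < min d1 d2 / (norm h + 1)"
        have "t * (norm h + 1) < min d1 d2" using t(2) unfolding pos_less_divide_eq[OF np] .
        moreover have "norm (t *\<^sub>R h) \<le> t * (norm h + 1)" using t by simp
        ultimately have n: "norm (t *\<^sub>R h) < d1" "norm (t *\<^sub>R h) < d2" by linarith+
        have z: "(t *\<^sub>R h) \<bullet> u = 0" "a + t *\<^sub>R h \<in> hplane a u" using h by (auto simp: hplane_def)
        have "\<bar>f (a + t *\<^sub>R h) - t * L h - t * (t * Q h h) / 2\<bar> \<le> t\<^sup>2 * (norm h)\<^sup>2"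
          using d1(2)[OF z(1) n(1)] t by (simp add: linear_cmul[OF L] linear_cmul[OF Ql(1)] linear_cmul[OF Ql(2)] power_mult_distrib)
        moreover have "\<bar>f (a + t *\<^sub>R h)\<bar> \<le> \<epsilon> * (t * norm h)" using d2(2)[OF z(2)] n(2) t by simp
        moreover have "\<bar>t * L h\<bar> = t * \<bar>L h\<bar>" "\<bar>t * (t * Q h h) / 2\<bar> \<le> t * (t * \<bar>Q h h\<bar>)"
          using t by (auto simp: abs_mult)
        ultimately have "t * \<bar>L h\<bar> \<le> t\<^sup>2 * (norm h)\<^sup>2 + \<epsilon> * (t * norm h) + t * (t * \<bar>Q h h\<bar>)" by linarith
        also have "\<dots> = t * (\<epsilon> * norm h + ((norm h)\<^sup>2 + \<bar>Q h h\<bar>) * t)"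
          by (simp add: power2_eq_square algebra_simps)
        finally show "\<bar>L h\<bar> \<le> \<epsilon> * norm h + ((norm h)\<^sup>2 + \<bar>Q h h\<bar>) * t"
          using t(1) by (rule mult_left_le_imp_le)
      qed
    qed
    then have small: "\<bar>L h\<bar> \<le> 0 + norm h * t" if "0 < t" for t using that by (simp add: mult.commute)
    have "\<bar>L h\<bar> \<le> 0" by (rule le_limit_small[of 1, OF _ small]) auto
    then show ?thesis by simp
  qed
  define P where "P z = z - (z \<bullet> u) *\<^sub>R u" for z
  have Plin: "linear P" by (rule linearI) (auto simp: P_def algebra_simps)
  have Pu: "P u = 0" using u by (simp add: P_def norm_eq_1)
  have PV: "P z = z" if "z \<bullet> u = 0" for z using that by (simp add: P_def)
  define D where "D z = (\<Sum>b\<in>Basis. Q (P z) (P b) *\<^sub>R b)" for z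
  have D: "D z \<bullet> x = Q (P z) (P x)" for z x
  proof -
    have "Q (P z) (P x) = Q (P z) (P (\<Sum>b\<in>Basis. (x \<bullet> b) *\<^sub>R b))" by (simp add: euclidean_representation)
    also have "\<dots> = (\<Sum>b\<in>Basis. (x \<bullet> b) * Q (P z) (P b))"
      by (simp add: linear_sum[OF Plin] linear_sum[OF Ql(2)] linear_cmul[OF Plin] linear_cmul[OF Ql(2)])
    finally show ?thesis by (simp add: D_def inner_sum_left inner_commute[of x] mult.commute)
  qed
  have "linear D"
    by (rule linearI) (simp_all add: D_def linear_add[OF Plin] linear_add[OF Ql(1)] linear_cmul[OF Plin]
        linear_cmul[OF Ql(1)] scaleR_add_left sum.distrib scaleR_sum_right)
  moreover have "D z \<bullet> u = 0" for z by (simp add: D Pu linear_0[OF Ql(2)])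
  moreover have DQ: "D x \<bullet> z = Q x z" if "x \<bullet> u = 0" "z \<bullet> u = 0" for x z using that by (simp add: D PV)
  moreover have "\<exists>\<delta>>0. \<forall>z\<in>{z. z \<bullet> u = 0}. norm z < \<delta> \<longrightarrow> \<bar>f (a + z) - D z \<bullet> z / 2\<bar> \<le> \<epsilon> * (norm z)\<^sup>2"
    if "\<epsilon> > 0" for \<epsilon> using ex[OF that] by (auto simp: L0 DQ)
  ultimately show ?thesis by (rule that)
qed

text \<open>The form is symmetrised because D comes without symmetry; on the diagonal this changes
  nothing.\<close>

lemma second_order_atI:
  fixes u a :: "'a::euclidean_space"
  assumes u: "norm u = 1" and D: "linear D" and f0: "f a = 0"
    and ex: "\<And>\<epsilon>. \<epsilon> > 0 \<Longrightarrow> \<exists>\<delta>>0. \<forall>z\<in>{z. z \<bullet> u = 0}. norm z < \<delta> \<longrightarrow> \<bar>f (a + z) - D z \<bullet> z / 2\<bar> \<le> \<epsilon> * (norm z)\<^sup>2"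
  shows "second_order_at (hplane a u) f a (\<lambda>h. 0) (\<lambda>x y. (D x \<bullet> y + D y \<bullet> x) / 2)"
  unfolding second_order_at_def
proof (intro conjI allI)
  show "linear (\<lambda>h::'a. 0::real)" by (rule linearI) auto
  show "bilinear (\<lambda>x y. (D x \<bullet> y + D y \<bullet> x) / 2)"
    unfolding bilinear_def
    by (intro conjI allI linearI)
       (auto simp: linear_add[OF D] linear_cmul[OF D] inner_add_left inner_add_right field_simps)
  show "((\<lambda>x. (f x - f a - 0 - (D (x - a) \<bullet> (x - a) + D (x - a) \<bullet> (x - a)) / 2 / 2) / (norm (x - a))\<^sup>2) \<longlongrightarrow> 0)
      (at a within hplane a u)"
    unfolding Lim_within
  proof (intro allI impI)
    fix e :: real assume e: "e > 0"
    obtain d where d: "d > 0" "\<And>z. z \<bullet> u = 0 \<Longrightarrow> norm z < d \<Longrightarrow> \<bar>f (a + z) - D z \<bullet> z / 2\<bar> \<le> e / 2 * (norm z)\<^sup>2"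
      using ex[of "e / 2"] e by auto
    show "\<exists>d>0. \<forall>x\<in>hplane a u. 0 < dist x a \<and> dist x a < d \<longrightarrow>
      dist ((f x - f a - 0 - (D (x - a) \<bullet> (x - a) + D (x - a) \<bullet> (x - a)) / 2 / 2) / (norm (x - a))\<^sup>2) 0 < e"
    proof (intro exI[of _ d] conjI ballI impI d(1))
      fix x assume x: "x \<in> hplane a u" "0 < dist x a \<and> dist x a < d"
      have "\<bar>f x - D (x - a) \<bullet> (x - a) / 2\<bar> \<le> e / 2 * (norm (x - a))\<^sup>2"
        using d(2)[of "x - a"] x by (simp add: hplane_def dist_norm)
      also have "\<dots> < e * (norm (x - a))\<^sup>2" using x e by (simp add: dist_norm)
      finally show "dist ((f x - f a - 0 - (D (x - a) \<bullet> (x - a) + D (x - a) \<bullet> (x - a)) / 2 / 2) / (norm (x - a))\<^sup>2) 0 < e"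
        using x f0 by (simp add: dist_norm abs_divide pos_divide_less_eq)
    qed
  qed
qed (auto simp: inner_commute add.commute)

section \<open>Anisotropic normals over sets of positive reach\<close>

definition little_o :: "'i filter \<Rightarrow> ('i \<Rightarrow> 'b::real_normed_vector) \<Rightarrow> ('i \<Rightarrow> real) \<Rightarrow> bool" where
  "little_o F f r \<longleftrightarrow> (\<forall>\<epsilon>>0. \<forall>\<^sub>F i in F. norm (f i) \<le> \<epsilon> * r i)"

lemma little_oD: "little_o F f r \<Longrightarrow> \<epsilon> > 0 \<Longrightarrow> \<forall>\<^sub>F i in F. norm (f i) \<le> \<epsilon> * r i"
  by (simp add: little_o_def)

lemma little_o_add:
  assumes "little_o F f r" "little_o F h r" shows "little_o F (\<lambda>i. f i + h i) r"
  unfolding little_o_def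
proof (intro allI impI)
  fix e :: real assume e: "e > 0"
  then have "e / 2 > 0" by simp
  show "\<forall>\<^sub>F i in F. norm (f i + h i) \<le> e * r i"
    using little_oD[OF assms(1) \<open>e / 2 > 0\<close>] little_oD[OF assms(2) \<open>e / 2 > 0\<close>]
  proof eventually_elim
    case (elim i)
    then show ?case using norm_triangle_ineq[of "f i" "h i"] by simp
  qed
qed

lemma little_o_norm_le:
  assumes f: "little_o F f r" and C: "C > 0" and le: "\<forall>\<^sub>F i in F. norm (h i) \<le> C * norm (f i)"
  shows "little_o F h r"
  unfolding little_o_def
proof (intro allI impI)
  fix e :: real assume e: "e > 0"
  then have "e / C > 0" using C by simp
  from little_oD[OF f this] le show "\<forall>\<^sub>F i in F. norm (h i) \<le> e * r i"
  proof eventually_elim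
    case (elim i)
    have "C * norm (f i) \<le> C * (e / C * r i)" using elim(1) C by (intro mult_left_mono) auto
    then show ?case using elim(2) C by simp
  qed
qed

lemma little_o_minus: "little_o F f r \<Longrightarrow> little_o F (\<lambda>i. - f i) r"
  by (simp add: little_o_def)

lemma little_o_diff: "little_o F f r \<Longrightarrow> little_o F h r \<Longrightarrow> little_o F (\<lambda>i. f i - h i) r"
  using little_o_add[of F f r "\<lambda>i. - h i"] little_o_minus[of F h r] by simp

lemma little_o_linear:
  fixes T :: "'a::euclidean_space \<Rightarrow> 'b::real_normed_vector"
  assumes "linear T" "little_o F f r" shows "little_o F (\<lambda>i. T (f i)) r"
proof -
  obtain K where "K > 0" "\<And>x. norm (T x) \<le> K * norm x" using linear_normE[OF assms(1)] by blast
  then show ?thesis by (intro little_o_norm_le[OF assms(2), of K]) auto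
qed

lemma little_o_gauge:
  assumes f: "little_o F f r" and C: "C > 0" and le: "\<forall>\<^sub>F i in F. r i \<le> C * r' i"
  shows "little_o F f r'"
  unfolding little_o_def
proof (intro allI impI)
  fix e :: real assume e: "e > 0"
  then have "e / C > 0" using C by simp
  from little_oD[OF f this] le show "\<forall>\<^sub>F i in F. norm (f i) \<le> e * r' i"
  proof eventually_elim
    case (elim i)
    have "e / C * r i \<le> e / C * (C * r' i)" using elim(2) C e by (intro mult_left_mono) auto
    then show ?case using elim(1) C by simp
  qed
qed

lemma little_o_tendsto:
  fixes k :: "'i \<Rightarrow> real"
  assumes k: "(k \<longlongrightarrow> 0) F" and le: "\<forall>\<^sub>F i in F. norm (h i) \<le> k i * r i" and r: "\<forall>\<^sub>F i in F. 0 \<le> r i"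
  shows "little_o F h r"
  unfolding little_o_def
proof (intro allI impI)
  fix e :: real assume e: "e > 0"
  have "\<forall>\<^sub>F i in F. k i < e" using k e by (rule order_tendstoD)
  then show "\<forall>\<^sub>F i in F. norm (h i) \<le> e * r i" using le r
  proof eventually_elim
    case (elim i)
    then have "k i * r i \<le> e * r i" by (intro mult_right_mono) auto
    then show ?case using elim by simp
  qed
qed

lemma little_o_derivative:
  assumes G: "(G has_derivative D) (at x)" and f: "(f \<longlongrightarrow> x) F"
  shows "little_o F (\<lambda>i. G (f i) - G x - D (f i - x)) (\<lambda>i. norm (f i - x))"
  unfolding little_o_def
proof (intro allI impI)
  fix e :: real assume "e > 0"
  then obtain d where d: "d > 0" "\<And>y. norm (y - x) < d \<Longrightarrow> norm (G y - G x - D (y - x)) \<le> e * norm (y - x)"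
    using G unfolding has_derivative_at_alt by blast
  have "\<forall>\<^sub>F i in F. dist (f i) x < d" using f d(1) by (rule tendstoD)
  then show "\<forall>\<^sub>F i in F. norm (G (f i) - G x - D (f i - x)) \<le> e * norm (f i - x)"
    by eventually_elim (use d in \<open>simp add: dist_norm\<close>)
qed

text \<open>Half of |z| is absorbed on the left, so an error relative to |z| + r still gives a bound
  by r alone.\<close>

lemma little_o_absorb:
  assumes le: "\<forall>\<^sub>F i in F. norm (z i) \<le> C * r i + norm (e i)"
    and e: "little_o F e (\<lambda>i. norm (z i) + r i)"
  shows "\<forall>\<^sub>F i in F. norm (z i) \<le> (2 * C + 1) * r i"
proof -
  have "(1/2::real) > 0" by simp
  from little_oD[OF e this] le show ?thesis
    by eventually_elim (simp add: algebra_simps)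
qed

lemma little_o_of_eps_delta:
  fixes z :: "'i \<Rightarrow> 'a::real_normed_vector" and q :: "'i \<Rightarrow> 'b::real_normed_vector"
  assumes ed: "\<And>\<epsilon>. \<epsilon> > 0 \<Longrightarrow> \<exists>\<delta>>0. \<forall>z\<in>V. \<forall>q. norm z < \<delta> \<and> S z q \<longrightarrow> norm (q - D z) \<le> \<epsilon> * norm z"
    and z: "(z \<longlongrightarrow> 0) F" and S: "\<forall>\<^sub>F i in F. z i \<in> V \<and> S (z i) (q i)"
  shows "little_o F (\<lambda>i. q i - D (z i)) (\<lambda>i. norm (z i))"
  unfolding little_o_def
proof (intro allI impI)
  fix e :: real assume "e > 0"
  from ed[OF this] obtain d where d: "d > 0"
    "\<And>z q. z \<in> V \<Longrightarrow> norm z < d \<Longrightarrow> S z q \<Longrightarrow> norm (q - D z) \<le> e * norm z" by blast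
  have "\<forall>\<^sub>F i in F. dist (z i) 0 < d" using z d(1) by (rule tendstoD)
  then show "\<forall>\<^sub>F i in F. norm (q i - D (z i)) \<le> e * norm (z i)"
    using S by eventually_elim (use d in auto)
qed

section \<open>Density one in terms of outer measure\<close>

lemma outer_lmeasure_empty: "outer_lmeasure {} = 0"
proof -
  have "outer_lmeasure {} \<le> emeasure lebesgue {}" unfolding outer_lmeasure_def by (rule Inf_lower) auto
  then show ?thesis by simp
qed

lemma outer_lmeasure_measurable:
  assumes "S \<in> sets lebesgue" shows "outer_lmeasure S = emeasure lebesgue S"
  unfolding outer_lmeasure_def
proof (rule antisym[OF Inf_lower Inf_greatest])
  fix y assume "y \<in> {emeasure lebesgue T |T. T \<in> sets lebesgue \<and> S \<subseteq> T}"
  then show "emeasure lebesgue S \<le> y" by (blast intro: emeasure_mono)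
qed (use assms in blast)

lemma density_one_ball_subset:
  assumes e: "e > 0" and sub: "ball p e \<subseteq> S" shows "density_one S p"
  unfolding density_one_def
proof (rule tendsto_eventually, rule eventually_at_rightI[of 0 e])
  fix t assume t: "t \<in> {0<..<e}"
  then have "S \<inter> ball p t = ball p t" using sub by auto
  moreover have "measure lebesgue (ball p t) > 0" using t by (simp add: content_ball_pos)
  ultimately show "enn2real (outer_lmeasure (S \<inter> ball p t)) / measure lebesgue (ball p t) = 1"
    by (simp add: outer_lmeasure_measurable measure_def)
qed (use e in simp)

text \<open>This is how density one is exploited: it supplies points of S arbitrarily near
  p.\<close>

lemma density_one_meets_ball:
  assumes d: "density_one S p" and e: "e > 0" shows "S \<inter> ball p e \<noteq> {}"
proof
  assume emp: "S \<inter> ball p e = {}"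
  let ?h = "\<lambda>t. enn2real (outer_lmeasure (S \<inter> ball p t)) / measure lebesgue (ball p t)"
  have "(?h \<longlongrightarrow> 0) (at_right 0)"
  proof (rule tendsto_eventually, rule eventually_at_rightI[of 0 e])
    fix t assume "t \<in> {0<..<e}"
    then have "S \<inter> ball p t = {}" using emp by force
    then show "?h t = 0" by (simp add: outer_lmeasure_empty)
  qed (use e in simp)
  moreover have "(?h \<longlongrightarrow> 1) (at_right 0)" using d by (simp add: density_one_def)
  ultimately show False using tendsto_unique[of "at_right (0::real)" ?h 0 1] by simp
qed

lemma touching_frontier:
  assumes v: "norm v = 1" and c: "c \<in> A" and s: "\<sigma> > 0"
    and touch: "\<And>z. z \<in> A \<Longrightarrow> 2 * \<sigma> * (v \<bullet> (z - c)) \<le> (norm (z - c))\<^sup>2"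
  shows "c \<in> frontier A"
proof -
  have "c \<notin> interior A"
  proof
    assume "c \<in> interior A"
    then obtain r where r: "r > 0" "ball c r \<subseteq> A" by (auto simp: mem_interior)
    define t where "t = min (r / 2) \<sigma>"
    have t: "0 < t" "t < r" "t \<le> \<sigma>" using r s by (auto simp: t_def min_def)
    have "c + t *\<^sub>R v \<in> A" using r(2) t v by (auto simp: dist_norm subset_iff)
    from touch[OF this] have "t * (2 * \<sigma>) \<le> t * t" using v t by (simp add: norm_eq_1 power2_eq_square ac_simps)
    then have "2 * \<sigma> \<le> t" using t by simp
    then show False using t s by simp
  qed
  then show ?thesis using c closure_subset by (auto simp: frontier_def)
qed

context wulff_norm
begin

text \<open>The open anisotropic ball about y of radius d = \<open>adist \<phi> A y\<close> misses A
  and, by \<open>Wulff_inner_ball\<close>, contains a Euclidean ball of radius d \<gamma> touching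
  at c. Its normal there is the v with (y - c) / d = g v.\<close>

lemma aproj_normal:
  assumes A: "closed A" "A \<noteq> {}" and y: "y \<notin> A" and c: "c \<in> aproj \<phi> A y"
  obtains v where "norm v = 1" "y = c + adist \<phi> A y *\<^sub>R g v"
    "\<And>z. z \<in> A \<Longrightarrow> 2 * (adist \<phi> A y * \<gamma>) * (v \<bullet> (z - c)) \<le> (norm (z - c))\<^sup>2"
proof -
  define d where "d = adist \<phi> A y"
  have d: "d > 0" using adist_pos[OF A y] by (simp add: d_def)
  have "dual_norm \<phi> ((1 / d) *\<^sub>R (y - c)) = 1" using c d by (simp add: dual_scale aproj_def d_def)
  then obtain v where v: "norm v = 1" "(1 / d) *\<^sub>R (y - c) = g v" by (rule dual_eq_1E)
  have "d *\<^sub>R ((1 / d) *\<^sub>R (y - c)) = d *\<^sub>R g v" using v by simp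
  then have yc: "y = c + d *\<^sub>R g v" using d by (simp add: algebra_simps)
  have "2 * (d * \<gamma>) * (v \<bullet> (z - c)) \<le> (norm (z - c))\<^sup>2" if z: "z \<in> A" for z
  proof -
    define x where "x = (1 / d) *\<^sub>R (y - z)"
    have "dual_norm \<phi> x \<ge> 1" using adist_le[OF A z, of y] d by (simp add: x_def dual_scale d_def)
    then have "norm (x - (g v - \<gamma> *\<^sub>R v)) \<ge> \<gamma>" using Wulff_inner_ball[OF v(1), of x] by force
    then have "d * \<gamma> \<le> d * norm (x - (g v - \<gamma> *\<^sub>R v))" using d by simp
    also have "\<dots> = norm (d *\<^sub>R (x - (g v - \<gamma> *\<^sub>R v)))" using d by simp
    also have "d *\<^sub>R (x - (g v - \<gamma> *\<^sub>R v)) = - ((z - c) - (d * \<gamma>) *\<^sub>R v)"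
      using d by (simp add: x_def yc algebra_simps)
    finally have "d * \<gamma> \<le> norm ((z - c) - (d * \<gamma>) *\<^sub>R v)" unfolding norm_minus_cancel .
    then have "(d * \<gamma>)\<^sup>2 \<le> (norm ((z - c) - (d * \<gamma>) *\<^sub>R v))\<^sup>2"
      using d gamma_pos by (intro power_mono) auto
    also have "\<dots> = (norm (z - c))\<^sup>2 - 2 * (d * \<gamma>) * (v \<bullet> (z - c)) + (d * \<gamma>)\<^sup>2"
      unfolding power2_norm_eq_inner inner_diff_left[of "z - c"] inner_diff_right[of _ "z - c"]
      using v(1) by (simp add: inner_commute[of "z - c" v] norm_eq_1 power2_eq_square)
    finally show ?thesis by simp
  qed
  then show ?thesis using that[OF v(1) yc[unfolded d_def]] unfolding d_def by blast
qed

text \<open>Density supplies points x near a + r' \<eta> whose rays from their own nearest points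
  can be stretched by \<sigma>. Stretching by \<theta> < \<sigma> and letting x tend to a + r'
  \<eta> carries the distance equality over to a + s \<eta> with some s > r.\<close>

lemma less_areach_of_less_areach_low:
  assumes A: "closed A" "A \<noteq> {}" and a: "a \<in> A" and eta: "dual_norm \<phi> \<eta> = 1"
    and r: "0 < r" "ereal r < areach_low \<phi> A a \<eta>"
  shows "ereal r < areach \<phi> A a \<eta>"
proof -
  obtain \<sigma> r' where s: "\<sigma> > 1" "0 < r'" "ereal r' < areach \<phi> A a \<eta>" "r < \<sigma> * r'"
    and dens: "density_one {x. x \<notin> A \<and> arho \<phi> A x \<ge> ereal \<sigma>} (a + r' *\<^sub>R \<eta>)"
    using r unfolding areach_low_def less_Sup_iff by auto
  obtain s0 where s0: "r' < s0" "adist \<phi> A (a + s0 *\<^sub>R \<eta>) = s0"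
    using s(3) unfolding areach_def less_Sup_iff by auto
  define p where "p = a + r' *\<^sub>R \<eta>"
  have proj: "aproj \<phi> A p = {a}" unfolding p_def by (rule aproj_unique[OF A a eta s0(2) s(2) s0(1)])
  have adp: "adist \<phi> A p = r'" unfolding p_def by (rule adist_shorten[OF A a eta s0(2)]) (use s s0 in auto)
  \<comment> \<open>Strictly between r and \<sigma> r', so that \<theta> = s / r' stays below
    \<sigma> while the radius reached still exceeds r.\<close>
  define s where "s = (r + \<sigma> * r') / 2"
  have sr: "r < s" "s < \<sigma> * r'" using \<open>r < \<sigma> * r'\<close> by (auto simp: s_def)
  define \<theta> where "\<theta> = s / r'"
  have th: "\<theta> > 0" "\<theta> < \<sigma>" "s = \<theta> * r'" using sr r \<open>0 < r'\<close> by (auto simp: \<theta>_def field_simps)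
  have "\<bar>adist \<phi> A (a + s *\<^sub>R \<eta>) - s\<bar> \<le> 0"
  proof (rule le_limit_small[of 1])
    fix e :: real assume e: "0 < e" "e < 1"
    obtain \<delta> where \<delta>: "\<delta> > 0" "\<And>y c. c \<in> aproj \<phi> A y \<Longrightarrow> norm (y - p) < \<delta> \<Longrightarrow> norm (c - a) < e"
      using aproj_tendsto[OF A proj e(1)] by blast
    have "{x. x \<notin> A \<and> arho \<phi> A x \<ge> ereal \<sigma>} \<inter> ball p (min \<delta> e) \<noteq> {}"
      unfolding p_def by (rule density_one_meets_ball[OF dens]) (use \<delta>(1) e(1) in simp)
    then obtain x where x: "x \<notin> A" "arho \<phi> A x \<ge> ereal \<sigma>" "norm (x - p) < min \<delta> e"
      by (metis (mono_tags, lifting) IntE dist_commute dist_norm ex_in_conv mem_Collect_eq mem_ball)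
    define c where "c = (SOME c. c \<in> aproj \<phi> A x)"
    have c: "c \<in> aproj \<phi> A x" unfolding c_def using aproj_nonempty[OF A, of x] by (simp add: some_in_eq)
    have ca: "norm (c - a) < e" using \<delta>(2)[OF c] x by simp
    define d where "d = adist \<phi> A x"
    have d: "d > 0" using adist_pos[OF A x(1)] by (simp add: d_def)
    have "ereal \<theta> < arho \<phi> A x" using th x(2) by (metis ereal_less_eq(3) less_ereal.simps(1) less_le_trans)
    then obtain s1 where s1: "\<theta> < s1" "adist \<phi> A (c + s1 *\<^sub>R (x - c)) = s1 * d"
      unfolding arho_def Let_def less_Sup_iff c_def[symmetric] d_def by auto
    define w where "w = (1 / d) *\<^sub>R (x - c)"
    have w: "dual_norm \<phi> w = 1" "x - c = d *\<^sub>R w" using c d by (auto simp: w_def dual_scale aproj_def d_def)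
    have cA: "c \<in> A" using c by (simp add: aproj_def)
    have "adist \<phi> A (c + (\<theta> * d) *\<^sub>R w) = \<theta> * d"
      by (rule adist_shorten[OF A cA w(1), of "s1 * d"]) (use s1 th d w in auto)
    then have 1: "adist \<phi> A (c + \<theta> *\<^sub>R (x - c)) = \<theta> * d" using w by simp
    have 2: "\<bar>adist \<phi> A (a + s *\<^sub>R \<eta>) - adist \<phi> A (c + \<theta> *\<^sub>R (x - c))\<bar> \<le> norm ((a + s *\<^sub>R \<eta>) - (c + \<theta> *\<^sub>R (x - c))) / \<gamma>"
      by (rule adist_lipschitz[OF A])
    have "(a + s *\<^sub>R \<eta>) - (c + \<theta> *\<^sub>R (x - c)) = (\<theta> - 1) *\<^sub>R (c - a) - \<theta> *\<^sub>R (x - p)"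
      by (simp add: th(3) p_def algebra_simps)
    then have "norm ((a + s *\<^sub>R \<eta>) - (c + \<theta> *\<^sub>R (x - c))) \<le> \<bar>\<theta> - 1\<bar> * norm (c - a) + \<theta> * norm (x - p)"
      using norm_triangle_ineq4[of "(\<theta> - 1) *\<^sub>R (c - a)" "\<theta> *\<^sub>R (x - p)"] th by simp
    also have "\<dots> \<le> \<bar>\<theta> - 1\<bar> * e + \<theta> * e" using ca x(3) th by (intro add_mono mult_left_mono) auto
    finally have "norm ((a + s *\<^sub>R \<eta>) - (c + \<theta> *\<^sub>R (x - c))) / \<gamma> \<le> (\<bar>\<theta> - 1\<bar> * e + \<theta> * e) / \<gamma>"
      using gamma_pos by (intro divide_right_mono) auto
    moreover have "\<bar>\<theta> * d - s\<bar> \<le> \<theta> * (e / \<gamma>)"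
    proof -
      have "\<bar>d - r'\<bar> \<le> norm (x - p) / \<gamma>" using adist_lipschitz[OF A, of x p] adp by (simp add: d_def)
      also have "\<dots> \<le> e / \<gamma>" using x(3) gamma_pos by (intro divide_right_mono) auto
      finally have "\<theta> * \<bar>d - r'\<bar> \<le> \<theta> * (e / \<gamma>)" using th by (intro mult_left_mono) auto
      moreover have "\<bar>\<theta> * d - s\<bar> = \<theta> * \<bar>d - r'\<bar>" using th
        by (simp only: th(3) right_diff_distrib[symmetric] abs_mult abs_of_pos)
      ultimately show ?thesis by simp
    qed
    ultimately have "\<bar>adist \<phi> A (a + s *\<^sub>R \<eta>) - s\<bar> \<le> (\<bar>\<theta> - 1\<bar> * e + \<theta> * e) / \<gamma> + \<theta> * (e / \<gamma>)"
      using 1 2 by linarith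
    also have "\<dots> = 0 + ((\<bar>\<theta> - 1\<bar> + 2 * \<theta>) / \<gamma>) * e"
      using gamma_pos by (simp add: field_simps)
    finally show "\<bar>adist \<phi> A (a + s *\<^sub>R \<eta>) - s\<bar> \<le> 0 + ((\<bar>\<theta> - 1\<bar> + 2 * \<theta>) / \<gamma>) * e" .
  qed simp
  then have "adist \<phi> A (a + s *\<^sub>R \<eta>) = s" by simp
  then have "ereal s \<le> areach \<phi> A a \<eta>" unfolding areach_def using sr r by (intro Sup_upper) auto
  then show ?thesis using sr by (metis ereal_less_eq(3) less_ereal.simps(1) less_le_trans)
qed

end

locale wulff_pos_reach = wulff_norm \<phi> g Dg \<gamma> + pos_reach A \<rho>
  for \<phi> :: "'a::euclidean_space \<Rightarrow> real" and g :: "'a \<Rightarrow> 'a" and Dg :: "'a \<Rightarrow> 'a \<Rightarrow>\<^sub>L 'a"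
    and \<gamma> :: real and A :: "'a set" and \<rho> :: real
begin

text \<open>The Wulff shape of size t about c + t \<open>g v\<close> lies in the Euclidean ball of
  radius t R touching at c. For 2 t R < \<rho> that ball is smaller than the touching ball of A in
  direction v, so c is the only point of A in it.\<close>

lemma adist_normal_ray:
  "\<exists>r1>0. \<forall>c v t. v \<in> normal_fibre A c \<and> 0 < t \<and> t < r1 \<longrightarrow> adist \<phi> A (c + t *\<^sub>R g v) = t"
proof -
  obtain R where R: "R > 0" "\<And>v z. norm v = 1 \<Longrightarrow> dual_norm \<phi> z \<le> 1 \<Longrightarrow> norm (z - (g v - R *\<^sub>R v)) \<le> R"
    using Wulff_outer_ball by blast
  have "adist \<phi> A (c + t *\<^sub>R g v) = t" if v: "v \<in> normal_fibre A c" and t: "0 < t" "t < \<rho> / (2 * R)" for c v t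
  proof (rule adist_eqI[OF closed nonempty])
    have nv: "norm v = 1" and c: "c \<in> A" using v by (auto simp: normal_fibre_def unit_sphere_def)
    have v0: "v \<noteq> 0" using nv by auto
    have dg: "dual_norm \<phi> (t *\<^sub>R g v) = t" using dual_g[OF v0] t by (simp add: dual_scale)
    show "c \<in> A" by (rule c)
    show "dual_norm \<phi> (c + t *\<^sub>R g v - c) = t" using dg by simp
    fix z assume z: "z \<in> A"
    show "t \<le> dual_norm \<phi> (c + t *\<^sub>R g v - z)"
    proof (rule ccontr)
      assume "\<not> ?thesis"
      then have lt: "dual_norm \<phi> (c + t *\<^sub>R g v - z) < t" by simp
      have "dual_norm \<phi> ((1 / t) *\<^sub>R (c + t *\<^sub>R g v - z)) \<le> 1" using lt t by (simp add: dual_scale)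
      from R(2)[OF nv this] have "t * norm ((1 / t) *\<^sub>R (c + t *\<^sub>R g v - z) - (g v - R *\<^sub>R v)) \<le> t * R" using t by simp
      then have "norm (t *\<^sub>R ((1 / t) *\<^sub>R (c + t *\<^sub>R g v - z) - (g v - R *\<^sub>R v))) \<le> t * R" using t by simp
      also have "t *\<^sub>R ((1 / t) *\<^sub>R (c + t *\<^sub>R g v - z) - (g v - R *\<^sub>R v)) = - ((z - c) - (t * R) *\<^sub>R v)"
        using t by (simp add: algebra_simps)
      finally have "norm ((z - c) - (t * R) *\<^sub>R v) \<le> t * R" unfolding norm_minus_cancel .
      then have "(norm ((z - c) - (t * R) *\<^sub>R v))\<^sup>2 \<le> (t * R)\<^sup>2" by (intro power_mono) auto
      moreover have "(norm ((z - c) - (t * R) *\<^sub>R v))\<^sup>2 = (norm (z - c))\<^sup>2 - 2 * (t * R) * (v \<bullet> (z - c)) + (t * R)\<^sup>2"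
        unfolding power2_norm_eq_inner inner_diff_left[of "z - c"] inner_diff_right[of _ "z - c"]
        using nv by (simp add: inner_commute[of "z - c" v] norm_eq_1 power2_eq_square)
      ultimately have 1: "(norm (z - c))\<^sup>2 \<le> 2 * (t * R) * (v \<bullet> (z - c))" by simp
      have 2: "\<rho> * (v \<bullet> (z - c)) \<le> (norm (z - c))\<^sup>2" by (rule normal_ineq[OF v z])
      have tR: "2 * (t * R) < \<rho>" using t R(1) by (simp add: field_simps)
      have "z = c"
      proof (rule ccontr)
        assume "z \<noteq> c"
        then have "0 < (norm (z - c))\<^sup>2" by simp
        then have "0 < 2 * (t * R) * (v \<bullet> (z - c))" using 1 by linarith
        moreover have "2 * (t * R) > 0" using t R(1) by simp
        ultimately have "v \<bullet> (z - c) > 0" using zero_less_mult_pos by blast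
        then have "2 * (t * R) * (v \<bullet> (z - c)) < \<rho> * (v \<bullet> (z - c))" using tR by simp
        then show False using 1 2 by simp
      qed
      then show False using lt dg by simp
    qed
  qed
  moreover have "\<rho> / (2 * R) > 0" using R rho_pos by simp
  ultimately show ?thesis by blast
qed

text \<open>The density condition holds trivially with \<sigma> = 2 at radius r1 / 4: every x near
  that point has anisotropic distance below r1 / 2 and a normal at its nearest point, so
  \<open>adist_normal_ray\<close> lets its ray be doubled. The radius obtained is uniform in a and
  v.\<close>

lemma areach_low_pos:
  "\<exists>r2>0. \<forall>a v. v \<in> normal_fibre A a \<longrightarrow> ereal r2 \<le> areach_low \<phi> A a (g v) \<and>
      (\<forall>t. 0 < t \<and> t < r2 \<longrightarrow> adist \<phi> A (a + t *\<^sub>R g v) = t \<and> aproj \<phi> A (a + t *\<^sub>R g v) = {a})"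
proof -
  obtain r1 where r1: "r1 > 0" "\<And>c v t. v \<in> normal_fibre A c \<Longrightarrow> 0 < t \<Longrightarrow> t < r1 \<Longrightarrow> adist \<phi> A (c + t *\<^sub>R g v) = t"
    using adist_normal_ray by blast
  have "ereal (r1 / 2) \<le> areach_low \<phi> A a (g v)"
    and "\<And>t. 0 < t \<Longrightarrow> t < r1 / 2 \<Longrightarrow> adist \<phi> A (a + t *\<^sub>R g v) = t \<and> aproj \<phi> A (a + t *\<^sub>R g v) = {a}"
    if v: "v \<in> normal_fibre A a" for a v
  proof -
    have nv: "norm v = 1" "v \<noteq> 0" and a: "a \<in> A" using v by (auto simp: normal_fibre_def unit_sphere_def)
    define p where "p = a + (r1 / 4) *\<^sub>R g v"
    have half: "adist \<phi> A (a + (r1 / 2) *\<^sub>R g v) = r1 / 2" by (rule r1(2)[OF v]) (use r1 in auto)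
    show "adist \<phi> A (a + t *\<^sub>R g v) = t \<and> aproj \<phi> A (a + t *\<^sub>R g v) = {a}" if t: "0 < t" "t < r1 / 2" for t
      using r1(2)[OF v, of t] aproj_unique[OF closed nonempty a dual_g[OF nv(2)] half t] t by auto
    have "ereal (r1 / 2) \<le> areach \<phi> A a (g v)" unfolding areach_def
      by (intro Sup_upper CollectI exI[of _ "r1 / 2"]) (use half r1 in simp)
    moreover have "ereal (r1 / 4) < ereal (r1 / 2)" using r1 by simp
    ultimately have lt: "ereal (r1 / 4) < areach \<phi> A a (g v)" by (rule less_le_trans[rotated])
    have adp: "adist \<phi> A p = r1 / 4" unfolding p_def by (rule r1(2)[OF v]) (use r1 in auto)
    \<comment> \<open>The anisotropic distance is Lipschitz with constant 1 / \<gamma>, so on this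
      ball it stays strictly between 0 and r1 / 2.\<close>
    have "ball p (r1 / 4 * \<gamma>) \<subseteq> {x. x \<notin> A \<and> arho \<phi> A x \<ge> ereal 2}"
    proof (rule subsetI, rule CollectI)
      fix x assume "x \<in> ball p (r1 / 4 * \<gamma>)"
      then have "norm (x - p) / \<gamma> < r1 / 4" using gamma_pos by (simp add: dist_norm norm_minus_commute field_simps)
      then have d: "0 < adist \<phi> A x" "adist \<phi> A x < r1 / 2"
        using adist_lipschitz[OF closed nonempty, of x p] adp by linarith+
      have xA: "x \<notin> A"
      proof
        assume "x \<in> A"
        then show False using adist_le[OF closed nonempty, of x x] d by simp
      qed
      define c where "c = (SOME c. c \<in> aproj \<phi> A x)"
      have c: "c \<in> aproj \<phi> A x" unfolding c_def using aproj_nonempty[OF closed nonempty, of x] by (simp add: some_in_eq)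
      obtain w where w: "norm w = 1" "x = c + adist \<phi> A x *\<^sub>R g w"
        "\<And>z. z \<in> A \<Longrightarrow> 2 * (adist \<phi> A x * \<gamma>) * (w \<bullet> (z - c)) \<le> (norm (z - c))\<^sup>2"
        using aproj_normal[OF closed nonempty xA c] by blast
      have "adist \<phi> A x * \<gamma> > 0" using d gamma_pos by simp
      then have wN: "w \<in> normal_fibre A c" unfolding normal_fibre_iff using w c by (auto simp: aproj_def)
      have "adist \<phi> A (c + (2 * adist \<phi> A x) *\<^sub>R g w) = 2 * adist \<phi> A x" by (rule r1(2)[OF wN]) (use d in auto)
      moreover have "c + (2 * adist \<phi> A x) *\<^sub>R g w = c + 2 *\<^sub>R (x - c)" using w(2)
        by (metis add_diff_cancel_left' scaleR_scaleR)
      ultimately have "adist \<phi> A (c + 2 *\<^sub>R (x - c)) = 2 * adist \<phi> A x" by simp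
      then have "ereal 2 \<le> arho \<phi> A x"
        unfolding arho_def Let_def c_def[symmetric] by (intro Sup_upper) auto
      then show "x \<notin> A \<and> arho \<phi> A x \<ge> ereal 2" using xA by simp
    qed
    then have "density_one {x. x \<notin> A \<and> arho \<phi> A x \<ge> ereal 2} p"
      using r1 gamma_pos by (intro density_one_ball_subset[of "r1 / 4 * \<gamma>"]) auto
    then have "ereal (2 * (r1 / 4)) \<in> {0} \<union> {ereal (\<sigma> * r) | \<sigma> r. \<sigma> > 1 \<and> 0 < r \<and>
       ereal r < areach \<phi> A a (g v) \<and>
       density_one {x. x \<notin> A \<and> arho \<phi> A x \<ge> ereal \<sigma>} (a + r *\<^sub>R g v)}"
      using lt r1 unfolding p_def
      by (intro UnI2 CollectI exI[of _ 2] exI[of _ "r1 / 4"]) auto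
    then have "ereal (2 * (r1 / 4)) \<le> areach_low \<phi> A a (g v)" unfolding areach_low_def by (rule Sup_upper)
    then show "ereal (r1 / 2) \<le> areach_low \<phi> A a (g v)" by simp
  qed
  then show ?thesis using r1(1) by (intro exI[of _ "r1 / 2"]) auto
qed

end

section \<open>Asymptotics of nearest points at the base point\<close>

text \<open>The infinitesimal form of \<open>g_expand\<close>. As u + t x leaves the sphere it is
  normalised to w; g is homogeneous of degree 0 and does not notice, and |w - u| is still at least t
  |x| up to a factor tending to 1.\<close>

lemma (in wulff_norm) Dg_norm_lower:
  assumes u: "norm u = 1" and x: "x \<bullet> u = 0"
  shows "\<gamma> * norm x \<le> norm (Dg u x)"
proof (rule field_le_epsilon)
  fix e :: real assume e: "e > 0"
  have u0: "u \<noteq> 0" using u by auto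
  have lin: "linear (blinfun_apply (Dg u))" by (simp add: blinfun.bounded_linear_right bounded_linear.linear)
  define N where "N = norm x + 1"
  have N: "N > 0" "norm x < N" by (simp_all add: N_def add_nonneg_pos)
  obtain d where d: "d > 0" "\<And>y. norm (y - u) < d \<Longrightarrow> norm (g y - g u - Dg u (y - u)) \<le> e / (2 * N) * norm (y - u)"
    using g_deriv[OF u0] e N unfolding has_derivative_at_alt by (metis divide_pos_pos mult_pos_pos zero_less_numeral)
  show "\<gamma> * norm x \<le> norm (Dg u x) + e"
  proof (rule le_limit_small[of "d / N"])
    fix t assume t: "0 < t" "t < d / N"
    have tN: "t * N < d" using t(2) N by (simp add: pos_less_divide_eq)
    have tx: "norm (t *\<^sub>R x) \<le> t * N" using t N by simp
    define y where "y = u + t *\<^sub>R x"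
    have y2: "(norm y)\<^sup>2 = 1 + t\<^sup>2 * (norm x)\<^sup>2"
      unfolding y_def power2_norm_eq_inner inner_add_left inner_add_right
      using x u by (simp add: inner_commute[of u x] norm_eq_1 power2_eq_square)
    then have "(norm y)\<^sup>2 \<ge> 1\<^sup>2" by simp
    then have y1: "norm y \<ge> 1" by (rule power2_le_imp_le) simp
    define w where "w = (1 / norm y) *\<^sub>R y"
    have w: "norm w = 1" using y1 by (auto simp: w_def)
    have gw: "g w = g y" unfolding w_def using y1 by (intro g_scale) auto
    have "(norm (w - u))\<^sup>2 \<ge> (t * norm x / norm y)\<^sup>2"
    proof -
      have wu: "w - u = (1 / norm y - 1) *\<^sub>R u + (t / norm y) *\<^sub>R x"
        by (simp add: w_def y_def algebra_simps)
      have "(norm (w - u))\<^sup>2 = (1 / norm y - 1)\<^sup>2 + (t / norm y)\<^sup>2 * (norm x)\<^sup>2"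
        unfolding wu power2_norm_eq_inner inner_add_left inner_add_right
        using x u by (simp add: inner_commute[of u x] norm_eq_1 power2_eq_square)
      then show ?thesis by (simp add: power_mult_distrib power_divide)
    qed
    then have "norm (w - u) \<ge> t * norm x / norm y" by (rule power2_le_imp_le) simp
    then have "\<gamma> * (t * norm x / norm y) \<le> \<gamma> * norm (w - u)"
      by (rule mult_left_mono) (use gamma_pos in simp)
    also have "\<dots> \<le> norm (g y - g u)" using g_expand[OF w u] gw by simp
    also have "\<dots> \<le> norm (Dg u (t *\<^sub>R x)) + e / (2 * N) * norm (t *\<^sub>R x)"
      using d(2)[of y] tx tN norm_triangle_ineq[of "g y - g u - Dg u (y - u)" "Dg u (y - u)"] by (simp add: y_def)
    also have "\<dots> \<le> t * norm (Dg u x) + e / (2 * N) * (t * N)"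
      using t e N tx by (intro add_mono mult_left_mono) (auto simp: linear_cmul[OF lin])
    also have "\<dots> = t * (norm (Dg u x) + e / 2)" using N by (simp add: field_simps)
    finally have "t * (\<gamma> * norm x / norm y) \<le> t * (norm (Dg u x) + e / 2)" by (simp add: mult_ac)
    then have 1: "\<gamma> * norm x / norm y \<le> norm (Dg u x) + e / 2" using t(1) by (rule mult_left_le_imp_le)
    have "norm y \<le> 1 + t * norm x" using norm_triangle_ineq[of u "t *\<^sub>R x"] u t by (simp add: y_def)
    have "\<gamma> * norm x = norm y * (\<gamma> * norm x / norm y)" using y1 by auto
    also have "\<dots> \<le> norm y * (norm (Dg u x) + e / 2)" using 1 by (intro mult_left_mono) auto
    also have "\<dots> \<le> (1 + t * norm x) * (norm (Dg u x) + e / 2)"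
      using \<open>norm y \<le> 1 + t * norm x\<close> e by (intro mult_right_mono) auto
    also have "\<dots> \<le> norm (Dg u x) + e + (norm x * (norm (Dg u x) + e / 2)) * t"
      using e by (simp add: algebra_simps)
    finally show "\<gamma> * norm x \<le> norm (Dg u x) + e + (norm x * (norm (Dg u x) + e / 2)) * t" .
  qed (use d N in simp)
qed

text \<open>An arbitrary f as in (a). Semiconvexity and the Lipschitz bound are global on the plane,
  whereas f and A are linked only inside the cylinder.\<close>

locale epigraph_point = wulff_pos_reach \<phi> g Dg \<gamma> A \<rho>
  for \<phi> :: "'a::euclidean_space \<Rightarrow> real" and g :: "'a \<Rightarrow> 'a" and Dg :: "'a \<Rightarrow> 'a \<Rightarrow>\<^sub>L 'a"
    and \<gamma> :: real and A :: "'a set" and \<rho> :: real +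
  fixes a u :: 'a and \<epsilon> \<delta> \<kappa> K :: real and f :: "'a \<Rightarrow> real"
  assumes normals: "normal_fibre A a = {u}" and eps_pos: "\<epsilon> > 0" and delta_pos: "\<delta> > 0"
    and kap: "\<kappa> \<ge> 0" and cvx: "convex_on (hplane a u) (\<lambda>x. \<kappa> * (norm (x - a))\<^sup>2 + f x)"
    and lip: "K-lipschitz_on (hplane a u) f" and fa: "f a = 0"
    and der: "(f has_derivative (\<lambda>h. 0)) (at a within hplane a u)"
    and graph: "fgraph a u f \<inter> cyl \<epsilon> \<delta> a u = frontier A \<inter> cyl \<epsilon> \<delta> a u"
    and epi: "fepi a u f \<inter> cyl \<epsilon> \<delta> a u = A \<inter> cyl \<epsilon> \<delta> a u"
begin

abbreviation V :: "'a set" where "V \<equiv> {z. z \<bullet> u = 0}"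

abbreviation F :: "'a \<Rightarrow> real" where "F \<equiv> \<lambda>z. f (a + z)"

abbreviation sub :: "'a \<Rightarrow> 'a \<Rightarrow> bool" where "sub \<equiv> proximal_subgradient V F \<kappa>"

definition P :: "'a \<Rightarrow> 'a" where "P z = z - (z \<bullet> u) *\<^sub>R u"

text \<open>Based on \<open>nhds 0\<close>, so that the origin itself is included.\<close>

definition V0 :: "'a filter" where "V0 = inf (nhds 0) (principal V)"

lemma u1: "norm u = 1" and aA: "a \<in> A" and u0: "u \<noteq> 0"
proof -
  have "u \<in> normal_fibre A a" using normals by simp
  then show "norm u = 1" "a \<in> A" by (simp_all add: normal_fibre_def unit_sphere_def)
  then show "u \<noteq> 0" by auto
qed

lemma uu: "u \<bullet> u = 1" using u1 by (simp add: norm_eq_1)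

lemma gu: "g u \<bullet> u = \<phi> u" and phi_u: "\<phi> u > 0" and dual_gu: "dual_norm \<phi> (g u) = 1"
  by (rule euler[OF u0], rule phi_pos[OF u0], rule dual_g[OF u0])

lemma subspace_V: "subspace V" by (auto simp: subspace_def inner_add_left)

lemma linear_P: "linear P" by (rule linearI) (auto simp: P_def algebra_simps)

lemma P_V: "P z \<in> V" using uu by (simp add: P_def inner_diff_left)

lemma P_id: "z \<in> V \<Longrightarrow> P z = z" by (simp add: P_def)

lemma norm_P: "norm (P z) \<le> norm z"
proof -
  have "(norm (P z))\<^sup>2 = (norm z)\<^sup>2 - (z \<bullet> u)\<^sup>2"
    unfolding P_def power2_norm_eq_inner inner_diff_left inner_diff_right
    using uu by (simp add: inner_commute[of u z] power2_eq_square)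
  then have "(norm (P z))\<^sup>2 \<le> (norm z)\<^sup>2" by simp
  then show ?thesis by (rule power2_le_imp_le) simp
qed

lemma plane_iff: "x \<in> hplane a u \<longleftrightarrow> x - a \<in> V" by (simp add: hplane_def)

lemma eventually_V0: "eventually Q V0 \<longleftrightarrow> (\<exists>d>0. \<forall>x\<in>V. norm x < d \<longrightarrow> Q x)"
proof -
  have "eventually Q V0 \<longleftrightarrow> (\<exists>d>0. \<forall>x. dist x 0 < d \<longrightarrow> x \<in> V \<longrightarrow> Q x)"
    unfolding V0_def eventually_inf_principal eventually_nhds_metric by (rule refl)
  also have "\<dots> \<longleftrightarrow> (\<exists>d>0. \<forall>x\<in>V. norm x < d \<longrightarrow> Q x)"
    by (rule ex_cong1) (simp add: Ball_def, blast)
  finally show ?thesis .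
qed

lemma linear_little_o_zero:
  fixes l :: "'a \<Rightarrow> 'b::real_normed_vector"
  assumes l: "linear l" and o: "little_o V0 l norm" and h: "h \<in> V" shows "l h = 0"
proof -
  have "norm (l h) \<le> 0"
  proof (rule le_limit_small[of 1])
    fix e :: real assume e: "0 < e" "e < 1"
    from little_oD[OF o e(1)] obtain d where d: "d > 0" "\<And>x. x \<in> V \<Longrightarrow> norm x < d \<Longrightarrow> norm (l x) \<le> e * norm x"
      unfolding eventually_V0 by blast
    define N where "N = norm h + 1"
    have N: "N > 0" "norm h < N" by (simp_all add: N_def add_nonneg_pos)
    define t where "t = d / (2 * N)"
    have t: "t > 0" using d N by (simp add: t_def)
    have "t * norm h < t * N" using t N by simp
    also have "t * N = d / 2" using N by (simp add: t_def)
    finally have "norm (t *\<^sub>R h) < d" using t d by simp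
    then have "norm (l (t *\<^sub>R h)) \<le> e * norm (t *\<^sub>R h)" using d(2)[of "t *\<^sub>R h"] h by simp
    then have "t * norm (l h) \<le> t * (0 + norm h * e)" using t by (simp add: linear_cmul[OF l] mult_ac)
    then show "norm (l h) \<le> 0 + norm h * e" using t by (rule mult_left_le_imp_le)
  qed simp
  then show ?thesis by simp
qed

lemma cylI: "z \<in> V \<Longrightarrow> norm z < \<epsilon> \<Longrightarrow> \<bar>t\<bar> < \<delta> \<Longrightarrow> a + z - t *\<^sub>R u \<in> cyl \<epsilon> \<delta> a u"
  unfolding cyl_def
  by (rule CollectI, rule exI[of _ "a + z"], rule exI[of _ "- t"]) (simp add: plane_iff)

text \<open>Half the cylinder, so that test points around a graph point within this distance of a
  still lie in the cylinder.\<close>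

definition R0 :: real where "R0 = min \<epsilon> \<delta> / 2"

lemma R0_pos: "R0 > 0" using eps_pos delta_pos by (simp add: R0_def)

lemma graph_norms:
  assumes "z \<in> V" shows "norm z \<le> norm (z - s *\<^sub>R u)" "\<bar>s\<bar> \<le> norm (z - s *\<^sub>R u)"
proof -
  have "(norm (z - s *\<^sub>R u))\<^sup>2 = (norm z)\<^sup>2 + s\<^sup>2"
    unfolding power2_norm_eq_inner inner_diff_left inner_diff_right
    using assms uu by (simp add: inner_commute[of u z] power2_eq_square)
  then have "(norm z)\<^sup>2 \<le> (norm (z - s *\<^sub>R u))\<^sup>2" "\<bar>s\<bar>\<^sup>2 \<le> (norm (z - s *\<^sub>R u))\<^sup>2" by auto
  then show "norm z \<le> norm (z - s *\<^sub>R u)" "\<bar>s\<bar> \<le> norm (z - s *\<^sub>R u)"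
    by (auto intro: power2_le_imp_le)
qed

lemma frontier_point:
  assumes c: "c \<in> frontier A" "norm (c - a) < R0"
  shows "c = a + P (c - a) - F (P (c - a)) *\<^sub>R u"
proof -
  define z where "z = P (c - a)"
  define s where "s = - ((c - a) \<bullet> u)"
  have zV: "z \<in> V" using P_V by (simp add: z_def)
  have ca: "c - a = z - s *\<^sub>R u" by (simp add: z_def s_def P_def)
  have "norm z < \<epsilon>" "\<bar>s\<bar> < \<delta>" using graph_norms[OF zV, of s] c(2) R0_pos unfolding ca R0_def by linarith+
  from cylI[OF zV this] have "c \<in> cyl \<epsilon> \<delta> a u" using ca by (metis add_diff_eq diff_add_cancel add.commute)
  then have "c \<in> fgraph a u f" using graph c(1) by blast
  then obtain x where x: "x - a \<in> V" "c = x - f x *\<^sub>R u" by (auto simp: fgraph_def plane_iff)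
  have "c - a = (x - a) - f x *\<^sub>R u" unfolding x(2) by (simp only: diff_diff_eq diff_diff_eq2 add.commute)
  then have "z = P ((x - a) - f x *\<^sub>R u)" by (simp only: z_def)
  also have "\<dots> = x - a" using x(1) uu by (simp add: P_def inner_diff_left algebra_simps)
  finally have "x = a + z" by simp
  then show ?thesis using x(2) by (simp add: z_def)
qed

lemma sub_of_normal:
  assumes z: "z \<in> V" and c: "norm (z - F z *\<^sub>R u) < R0" and v: "norm v = 1" and s: "\<sigma> > 0"
    and touch: "\<And>y. y \<in> A \<Longrightarrow> 2 * \<sigma> * (v \<bullet> (y - (a + z - F z *\<^sub>R u))) \<le> (norm (y - (a + z - F z *\<^sub>R u)))\<^sup>2"
  shows "v \<bullet> u > 0" "sub z ((1 / (v \<bullet> u)) *\<^sub>R v - u)"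
proof -
  have K: "K \<ge> 0" using lip by (rule lipschitz_on_nonneg)
  \<comment> \<open>Over distance r0 the graph moves by at most K r0, and the test heights add r0;
    the room left for both is \<delta> / 2.\<close>
  define r0 where "r0 = min (\<epsilon> / 2) (\<delta> / (2 * (K + 1)))"
  have r0: "r0 > 0" using eps_pos delta_pos K by (simp add: r0_def)
  have "r0 \<le> \<delta> / (2 * (K + 1))" by (simp add: r0_def)
  then have r0K: "(K + 1) * r0 \<le> \<delta> / 2" using K by (simp add: field_simps)
  have nz: "norm z < \<epsilon> / 2" "\<bar>F z\<bar> < \<delta> / 2" using graph_norms[OF z, of "F z"] c unfolding R0_def by auto
  have b: "a + z \<in> hplane a u" using z by (simp add: plane_iff)
  have E: "x - s *\<^sub>R u \<in> A" if x: "x \<in> hplane a u" "norm (x - (a + z)) < r0" "f x \<le> s" "s < f x + r0" for x s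
  proof -
    have xV: "x - a \<in> V" using x plane_iff by blast
    have "norm (x - a) \<le> norm (x - (a + z)) + norm z" using norm_triangle_ineq[of "x - (a + z)" z] by simp
    then have 1: "norm (x - a) < \<epsilon>" using x(2) nz by (simp add: r0_def)
    have "\<bar>f x - F z\<bar> \<le> K * norm (x - (a + z))" using lipschitz_onD[OF lip x(1) b] by (simp add: dist_norm)
    also have "\<dots> \<le> K * r0" using x(2) K by (intro mult_left_mono) auto
    finally have "\<bar>s\<bar> < \<delta> / 2 + K * r0 + r0" using x(3,4) nz(2) by linarith
    then have 2: "\<bar>s\<bar> < \<delta>" using r0K by (simp add: distrib_right)
    have "x - s *\<^sub>R u \<in> cyl \<epsilon> \<delta> a u" using cylI[OF xV 1 2] by simp
    moreover have "x - s *\<^sub>R u \<in> fepi a u f" using x unfolding fepi_def by blast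
    ultimately show ?thesis using epi by blast
  qed
  note * = proximal_subgradient_of_normal[OF u1 v cvx kap lip b r0 E s touch]
  show "v \<bullet> u > 0" by (rule *(1))
  show "sub z ((1 / (v \<bullet> u)) *\<^sub>R v - u)" using *(2) by simp
qed

lemma sub_zero: "sub 0 0"
proof -
  have 1: "u \<in> normal_fibre A a" unfolding normals by (rule singletonI)
  have 2: "norm u = 1 \<and> a \<in> A \<and> (\<exists>s>0. \<forall>z\<in>A. 2 * s * (u \<bullet> (z - a)) \<le> (norm (z - a))\<^sup>2)"
    using 1 unfolding normal_fibre_iff .
  from 2 obtain s where s: "s > 0" "\<forall>y\<in>A. 2 * s * (u \<bullet> (y - a)) \<le> (norm (y - a))\<^sup>2" by (elim conjE exE)
  have 0: "a + 0 - f (a + 0) *\<^sub>R u = a" using fa by simp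
  have 3: "0 \<in> V" by simp
  have 4: "norm (0 - f (a + 0) *\<^sub>R u) < R0" using fa R0_pos by simp
  have "sub 0 ((1 / (u \<bullet> u)) *\<^sub>R u - u)"
  proof (rule sub_of_normal(2)[OF 3 4 u1 s(1)])
    fix y assume "y \<in> A"
    then show "2 * s * (u \<bullet> (y - (a + 0 - f (a + 0) *\<^sub>R u))) \<le> (norm (y - (a + 0 - f (a + 0) *\<^sub>R u)))\<^sup>2"
      unfolding 0 using s(2) by blast
  qed
  then show ?thesis unfolding uu by simp
qed

lemma sub_ex: "\<exists>R>0. \<forall>z\<in>V. norm z < R \<longrightarrow> (\<exists>q. sub z q)"
proof -
  have K: "K \<ge> 0" using lip by (rule lipschitz_on_nonneg)
  define R where "R = R0 / (K + 1)"
  have "R > 0" using K R0_pos by (simp add: R_def)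
  moreover have "\<exists>q. sub z q" if z: "z \<in> V" "norm z < R" for z
  proof -
    have "\<bar>F z\<bar> \<le> K * norm z"
      using lipschitz_onD[OF lip, of "a + z" a] z fa by (simp add: plane_iff dist_norm)
    then have "norm (z - F z *\<^sub>R u) \<le> (K + 1) * norm z"
      using norm_triangle_ineq4[of z "F z *\<^sub>R u"] u1 by (simp add: distrib_right)
    also have "\<dots> < R0" using z(2) K by (simp add: R_def field_simps)
    finally have n: "norm (z - F z *\<^sub>R u) < R0" .
    then have nz: "norm z < \<epsilon>" "\<bar>F z\<bar> < \<delta>" using graph_norms[OF z(1), of "F z"] R0_pos unfolding R0_def by linarith+
    have "a + z - F z *\<^sub>R u \<in> fgraph a u f" using z unfolding fgraph_def by (auto simp: plane_iff)
    then have "a + z - F z *\<^sub>R u \<in> frontier A" using cylI[OF z(1) nz] graph by blast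
    then obtain v where v: "v \<in> normal_fibre A (a + z - F z *\<^sub>R u)" using frontier_normal_ex by blast
    then obtain s where s: "norm v = 1" "s > 0" "\<And>y. y \<in> A \<Longrightarrow> 2 * s * (v \<bullet> (y - (a + z - F z *\<^sub>R u))) \<le> (norm (y - (a + z - F z *\<^sub>R u)))\<^sup>2"
      unfolding normal_fibre_iff by blast
    show ?thesis using sub_of_normal(2)[OF z(1) n s] by blast
  qed
  ultimately show ?thesis by blast
qed

lemma F_flat:
  assumes "e > 0" shows "\<exists>d>0. \<forall>z\<in>V. norm z < d \<longrightarrow> \<bar>F z\<bar> \<le> e * norm z"
proof -
  from der assms obtain d where d: "d > 0" "\<And>y. y \<in> hplane a u \<Longrightarrow> norm (y - a) < d \<Longrightarrow> norm (f y - f a - 0) \<le> e * norm (y - a)"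
    unfolding has_derivative_within_alt by blast
  then show ?thesis using d(2)[of "a + _"] fa by (intro exI[of _ d]) (auto simp: plane_iff)
qed

lemma anu_ray:
  assumes "aproj \<phi> A (a + r *\<^sub>R g u) = {a}" "adist \<phi> A (a + r *\<^sub>R g u) = r" "r > 0"
  shows "anu \<phi> A (a + r *\<^sub>R g u) = {g u}"
  using assms by (auto simp: anu_def)

text \<open>The common asymptotics at the base point: \<open>y\<close> runs through points near \<open>a + r \<nabla>\<phi>(u)\<close>, \<open>c\<close> is a
  nearest point of \<open>y\<close>, \<open>w\<close> its anisotropic and \<open>v\<close> its Euclidean normal, \<open>z\<close> its projection to the
  tangent plane and \<open>q\<close> the slope of the graph.\<close>

lemma nearest_asymptotics:
  fixes Fl :: "'i filter" and y c :: "'i \<Rightarrow> 'a"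
  assumes proj: "aproj \<phi> A (a + r *\<^sub>R g u) = {a}" and dist: "adist \<phi> A (a + r *\<^sub>R g u) = r" and r: "r > 0"
    and y: "(y \<longlongrightarrow> a + r *\<^sub>R g u) Fl"
    and c: "\<forall>\<^sub>F i in Fl. y i \<notin> A \<and> c i \<in> aproj \<phi> A (y i)"
  defines "w \<equiv> \<lambda>i. (1 / adist \<phi> A (y i)) *\<^sub>R (y i - c i)" and "z \<equiv> \<lambda>i. P (c i - a)"
    and "d \<equiv> \<lambda>i. adist \<phi> A (y i)"
  obtains v q where
    "(w \<longlongrightarrow> g u) Fl" "(v \<longlongrightarrow> u) Fl" "(z \<longlongrightarrow> 0) Fl"
    "\<forall>\<^sub>F i in Fl. norm (v i) = 1 \<and> w i = g (v i) \<and> \<gamma> * norm (v i - u) \<le> norm (w i - g u)"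
    "\<forall>\<^sub>F i in Fl. norm (v i - u - q i) \<le> (norm (q i))\<^sup>2 \<and> norm (q i - (v i - u)) \<le> 2 * (norm (v i - u))\<^sup>2"
    "\<forall>\<^sub>F i in Fl. z i \<in> V \<and> sub (z i) (q i)"
    "\<forall>\<^sub>F i in Fl. \<bar>d i - r\<bar> \<le> norm (y i - (a + r *\<^sub>R g u)) / \<gamma>"
    "\<forall>\<^sub>F i in Fl. y i - (a + r *\<^sub>R g u) =
       z i - F (z i) *\<^sub>R u + r *\<^sub>R (w i - g u) + (d i - r) *\<^sub>R g u + (d i - r) *\<^sub>R (w i - g u)"
    "little_o Fl (\<lambda>i. F (z i)) (\<lambda>i. norm (z i))"
proof -
  note cl = closed nonempty
  let ?x = "a + r *\<^sub>R g u"
  have clim: "(c \<longlongrightarrow> a) Fl"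
  proof (rule tendstoI)
    fix e :: real assume "e > 0"
    then obtain \<delta>' where \<delta>': "\<delta>' > 0" "\<And>y c. c \<in> aproj \<phi> A y \<Longrightarrow> norm (y - ?x) < \<delta>' \<Longrightarrow> norm (c - a) < e"
      using aproj_tendsto[OF cl proj] by blast
    from tendstoD[OF y \<delta>'(1)] c show "\<forall>\<^sub>F i in Fl. dist (c i) a < e"
      by eventually_elim (use \<delta>'(2) in \<open>auto simp: dist_norm\<close>)
  qed
  have dlim: "(d \<longlongrightarrow> r) Fl"
  proof -
    have "isCont (adist \<phi> A) ?x" using adist_cont[OF cl] by (simp add: continuous_on_eq_continuous_at)
    from isCont_tendsto_compose[OF this y] show ?thesis unfolding d_def dist .
  qed
  have wlim: "(w \<longlongrightarrow> g u) Fl"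
  proof -
    have "((\<lambda>i. (1 / d i) *\<^sub>R (y i - c i)) \<longlongrightarrow> (1 / r) *\<^sub>R (?x - a)) Fl"
      using r by (intro tendsto_intros dlim y clim) auto
    then show ?thesis using r unfolding w_def d_def by simp
  qed
  have zlim: "(z \<longlongrightarrow> 0) Fl"
  proof -
    have "((\<lambda>i. (c i - a) - ((c i - a) \<bullet> u) *\<^sub>R u) \<longlongrightarrow> (a - a) - ((a - a) \<bullet> u) *\<^sub>R u) Fl"
      by (intro tendsto_intros clim)
    then show ?thesis unfolding z_def P_def by simp
  qed
  define v where "v i = (SOME v. norm v = 1 \<and> y i = c i + d i *\<^sub>R g v \<and>
    (\<forall>x\<in>A. 2 * (d i * \<gamma>) * (v \<bullet> (x - c i)) \<le> (norm (x - c i))\<^sup>2))" for i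
  define q where "q i = (1 / (v i \<bullet> u)) *\<^sub>R v i - u" for i
  have v: "\<forall>\<^sub>F i in Fl. d i > 0 \<and> norm (v i) = 1 \<and> y i = c i + d i *\<^sub>R g (v i) \<and>
    (\<forall>x\<in>A. 2 * (d i * \<gamma>) * (v i \<bullet> (x - c i)) \<le> (norm (x - c i))\<^sup>2) \<and> c i \<in> A"
    using c
  proof eventually_elim
    case (elim i)
    then have yA: "y i \<notin> A" and ci: "c i \<in> aproj \<phi> A (y i)" by auto
    have "\<exists>v. norm v = 1 \<and> y i = c i + d i *\<^sub>R g v \<and>
      (\<forall>x\<in>A. 2 * (d i * \<gamma>) * (v \<bullet> (x - c i)) \<le> (norm (x - c i))\<^sup>2)"
      unfolding d_def by (rule aproj_normal[OF cl yA ci]) blast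
    from someI_ex[OF this] show ?case using adist_pos[OF cl yA] ci
      unfolding v_def[symmetric] by (auto simp: d_def aproj_def)
  qed
  have vw: "\<forall>\<^sub>F i in Fl. norm (v i) = 1 \<and> w i = g (v i) \<and> \<gamma> * norm (v i - u) \<le> norm (w i - g u)"
    using v
  proof eventually_elim
    case (elim i)
    then have "y i - c i = d i *\<^sub>R g (v i)" "d i > 0" by simp_all
    moreover have "w i = (1 / d i) *\<^sub>R (y i - c i)" by (simp only: w_def d_def)
    ultimately have wv: "w i = g (v i)" by simp
    show ?case using elim g_expand[of "v i" u] u1 wv by auto
  qed
  have vlim: "(v \<longlongrightarrow> u) Fl"
  proof (rule tendstoI)
    fix e :: real assume e: "e > 0"
    then have "\<gamma> * e > 0" using gamma_pos by simp
    from tendstoD[OF wlim this] vw show "\<forall>\<^sub>F i in Fl. dist (v i) u < e"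
    proof eventually_elim
      case (elim i)
      then have "\<gamma> * norm (v i - u) < \<gamma> * e" by (metis dist_norm le_less_trans)
      then show ?case using gamma_pos by (simp add: dist_norm)
    qed
  qed
  \<comment> \<open>Nearest points are frontier points, by the Euclidean touching ball at them;
    close to a they therefore lie on the graph.\<close>
  have cz: "\<forall>\<^sub>F i in Fl. c i = a + z i - F (z i) *\<^sub>R u \<and> norm (c i - a) < R0"
    using v tendstoD[OF clim R0_pos]
  proof eventually_elim
    case (elim i)
    then have n: "norm (c i - a) < R0" by (simp add: dist_norm)
    have "c i \<in> frontier A"
      by (rule touching_frontier[of "v i" _ _ "d i * \<gamma>"]) (use elim gamma_pos in auto)
    then show ?case using frontier_point n by (simp add: z_def)
  qed
  have zV: "z i \<in> V" for i unfolding z_def by (rule P_V)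
  have sb: "\<forall>\<^sub>F i in Fl. v i \<bullet> u > 0 \<and> sub (z i) (q i)"
    using v cz
  proof eventually_elim
    case (elim i)
    have n: "norm (z i - F (z i) *\<^sub>R u) < R0" using elim by (metis add_diff_cancel_left' add_diff_eq)
    have ci: "a + z i - F (z i) *\<^sub>R u = c i" using elim by simp
    have s: "d i * \<gamma> > 0" using elim gamma_pos by simp
    have nv: "norm (v i) = 1" using elim by simp
    have t: "2 * (d i * \<gamma>) * (v i \<bullet> (x - (a + z i - F (z i) *\<^sub>R u))) \<le> (norm (x - (a + z i - F (z i) *\<^sub>R u)))\<^sup>2"
      if "x \<in> A" for x using elim that unfolding ci by blast
    show ?case using sub_of_normal[OF zV n nv s t] unfolding q_def by blast
  qed
  have vq: "\<forall>\<^sub>F i in Fl. norm (v i - u - q i) \<le> (norm (q i))\<^sup>2 \<and> norm (q i - (v i - u)) \<le> 2 * (norm (v i - u))\<^sup>2"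
    using sb v tendstoD[OF vlim zero_less_one]
  proof eventually_elim
    case (elim i)
    then have "norm (v i - u) \<le> 1" "norm (v i) = 1" "v i \<bullet> u > 0" by (auto simp: dist_norm)
    then show ?case using normal_slope_bounds(2,3)[OF u1, of "v i"] unfolding q_def by blast
  qed
  have dd: "\<forall>\<^sub>F i in Fl. \<bar>d i - r\<bar> \<le> norm (y i - ?x) / \<gamma>"
    using adist_lipschitz[OF cl, of _ ?x] dist by (simp add: d_def)
  \<comment> \<open>The identity y = c + d w written around a + r \<open>g u\<close>. The product of
    the increments of d and w is kept apart: the first factor is bounded by a multiple of the
    displacement of y, the second tends to 0.\<close>
  have yy: "\<forall>\<^sub>F i in Fl. y i - ?x =
       z i - F (z i) *\<^sub>R u + r *\<^sub>R (w i - g u) + (d i - r) *\<^sub>R g u + (d i - r) *\<^sub>R (w i - g u)"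
    using v vw cz
  proof eventually_elim
    case (elim i)
    then have "y i = a + z i - F (z i) *\<^sub>R u + d i *\<^sub>R w i" by simp
    then show ?case by (simp add: algebra_simps)
  qed
  have Fz: "little_o Fl (\<lambda>i. F (z i)) (\<lambda>i. norm (z i))"
    unfolding little_o_def
  proof (intro allI impI)
    fix e :: real assume "e > 0"
    from F_flat[OF this] obtain d' where d': "d' > 0" "\<And>z. z \<in> V \<Longrightarrow> norm z < d' \<Longrightarrow> \<bar>F z\<bar> \<le> e * norm z" by blast
    from tendstoD[OF zlim d'(1)] show "\<forall>\<^sub>F i in Fl. norm (F (z i)) \<le> e * norm (z i)"
      by eventually_elim (use d'(2)[OF zV] in auto)
  qed
  have sb': "\<forall>\<^sub>F i in Fl. z i \<in> V \<and> sub (z i) (q i)" using sb by eventually_elim (use zV in blast)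
  show ?thesis by (rule that[OF wlim vlim zlim vw vq sb' dd yy Fz])
qed

text \<open>The projection onto \<open>V\<close> along \<open>g u\<close>. The radial term (d - r) g
  u is of first order and in general not parallel to u, so the orthogonal \<open>P\<close> could
  leave a part of it; \<open>Pg\<close> removes it entirely.\<close>

definition Pg :: "'a \<Rightarrow> 'a" where "Pg x = x - ((x \<bullet> u) / \<phi> u) *\<^sub>R g u"

lemma linear_Pg: "linear Pg"
  by (rule linearI) (auto simp: Pg_def algebra_simps add_divide_distrib)

lemma Pg_V: "x \<in> V \<Longrightarrow> Pg x = x" by (simp add: Pg_def)

lemma Pg_gu: "Pg (g u) = 0" using gu phi_u by (simp add: Pg_def)

lemma linear_Dg: "linear (blinfun_apply (Dg u))"
  by (simp add: blinfun.bounded_linear_right bounded_linear.linear)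

lemma Dg_V: "Dg u h \<in> V" using Dg_orth[OF u0] by simp

end

section \<open>Differentiability of the anisotropic normal and second order expansions\<close>

lemma linear_inverseE:
  fixes T :: "'a::euclidean_space \<Rightarrow> 'a"
  assumes T: "linear T" and inj: "\<And>x. T x = 0 \<Longrightarrow> x = 0"
  obtains S where "linear S" "\<And>x. S (T x) = x" "\<And>x. T (S x) = x"
proof -
  have i: "inj T" using inj linear_injective_0[OF T] by blast
  obtain S where S: "linear S" "S \<circ> T = id" using linear_injective_left_inverse[OF T i] by blast
  have 1: "S (T x) = x" for x using S(2) by (metis comp_apply id_apply)
  have "surj T" by (rule linear_injective_imp_surjective[OF T i refl])
  then have 2: "T (S x) = x" for x using 1 by (metis surjD)
  show ?thesis by (rule that[OF S(1) 1 2])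
qed

text \<open>\<open>aNor_n\<close> tests the eigenvalue condition for every derivative L, so all of
  them must agree. Closedness of A makes x + t h admissible for small t in every direction
  h.\<close>

lemma anu_deriv_unique:
  assumes A: "closed A" and ne: "\<And>y. anu \<phi> A y \<noteq> {}" and L: "anu_deriv \<phi> A x L" and L': "anu_deriv \<phi> A x L'"
  shows "L = L'"
proof
  fix h
  from L obtain w where xA: "x \<notin> A" and l: "linear L" and w: "anu \<phi> A x = {w}" and
    d: "\<And>e. e > 0 \<Longrightarrow> \<exists>d>0. \<forall>y w'. y \<notin> A \<and> norm (y - x) < d \<and> w' \<in> anu \<phi> A y \<longrightarrow>
            norm (w' - w - L (y - x)) \<le> e * norm (y - x)"
    unfolding anu_deriv_def by blast
  from L' w have l': "linear L'" and
    d': "\<And>e. e > 0 \<Longrightarrow> \<exists>d>0. \<forall>y w'. y \<notin> A \<and> norm (y - x) < d \<and> w' \<in> anu \<phi> A y \<longrightarrow>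
            norm (w' - w - L' (y - x)) \<le> e * norm (y - x)"
    unfolding anu_deriv_def by auto
  have "open (- A)" using A by (simp add: open_Compl)
  then obtain r where r: "r > 0" "ball x r \<subseteq> - A" using xA by (auto simp: open_contains_ball)
  have "norm (L h - L' h) \<le> 0"
  proof (rule le_limit_small[of 1])
    fix e :: real assume e: "0 < e" "e < 1"
    obtain d1 where d1: "d1 > 0" "\<And>y w'. y \<notin> A \<Longrightarrow> norm (y - x) < d1 \<Longrightarrow> w' \<in> anu \<phi> A y \<Longrightarrow>
            norm (w' - w - L (y - x)) \<le> e * norm (y - x)" using d[OF e(1)] by blast
    obtain d2 where d2: "d2 > 0" "\<And>y w'. y \<notin> A \<Longrightarrow> norm (y - x) < d2 \<Longrightarrow> w' \<in> anu \<phi> A y \<Longrightarrow>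
            norm (w' - w - L' (y - x)) \<le> e * norm (y - x)" using d'[OF e(1)] by blast
    define N where "N = norm h + 1"
    have N: "N > 0" "norm h < N" by (simp_all add: N_def add_nonneg_pos)
    define m where "m = min r (min d1 d2)"
    have m: "m > 0" using r d1 d2 by (simp add: m_def)
    define t where "t = m / N"
    have t: "t > 0" using m N by (simp add: t_def)
    have "t * norm h < t * N" using t N by simp
    also have "t * N = m" using N by (simp add: t_def)
    finally have th: "norm (t *\<^sub>R h) < m" using t by simp
    have yA: "x + t *\<^sub>R h \<notin> A" using r(2) th by (auto simp: subset_iff dist_norm m_def)
    obtain w' where w': "w' \<in> anu \<phi> A (x + t *\<^sub>R h)" using ne by blast
    have 1: "norm (w' - w - L (t *\<^sub>R h)) \<le> e * norm (t *\<^sub>R h)"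
      using d1(2)[OF yA _ w'] th by (simp add: m_def)
    have 2: "norm (w' - w - L' (t *\<^sub>R h)) \<le> e * norm (t *\<^sub>R h)"
      using d2(2)[OF yA _ w'] th by (simp add: m_def)
    have "norm ((w' - w - L' (t *\<^sub>R h)) - (w' - w - L (t *\<^sub>R h))) \<le> 2 * e * norm (t *\<^sub>R h)"
      using norm_triangle_ineq4[of "w' - w - L' (t *\<^sub>R h)" "w' - w - L (t *\<^sub>R h)"] 1 2 by linarith
    moreover have "(w' - w - L' (t *\<^sub>R h)) - (w' - w - L (t *\<^sub>R h)) = t *\<^sub>R (L h - L' h)"
      by (simp add: linear_cmul[OF l] linear_cmul[OF l'] scaleR_diff_right)
    ultimately have "t * norm (L h - L' h) \<le> t * (0 + (2 * norm h) * e)" using t by (simp add: mult_ac)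
    then show "norm (L h - L' h) \<le> 0 + (2 * norm h) * e" using t by (rule mult_left_le_imp_le)
  qed simp
  then show "L h = L' h" by simp
qed

context epigraph_point
begin

lemma anu_nonempty: "anu \<phi> A y \<noteq> {}"
  using aproj_nonempty[OF closed nonempty, of y] by (auto simp: anu_def)

lemma ray_not_in: assumes "adist \<phi> A x = r" "r > 0" shows "x \<notin> A"
proof
  assume "x \<in> A"
  then show False using adist_le[OF closed nonempty, of x x] assms by simp
qed

text \<open>With H = \<open>Dg u\<close> after D, the tangential part z satisfies Pg (y - x0) = z +
  r H z up to lower order, so the normal has the derivative L = H (I + r H)^-1 after
  \<open>Pg\<close>. On \<open>V\<close> this means r L = I - (I + r H)^-1, so no eigenvalue k can
  have r k = 1.\<close>

lemma second_order_imp_aNor_n: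
  assumes D: "linear D" "\<And>z. D z \<bullet> u = 0" and sym: "\<And>x z. x \<in> V \<Longrightarrow> z \<in> V \<Longrightarrow> D x \<bullet> z = D z \<bullet> x"
    and ex: "\<And>\<epsilon>. \<epsilon> > 0 \<Longrightarrow> \<exists>\<delta>>0. \<forall>z\<in>V. norm z < \<delta> \<longrightarrow> \<bar>F z - D z \<bullet> z / 2\<bar> \<le> \<epsilon> * (norm z)\<^sup>2"
  shows "(a, g u) \<in> aNor_n \<phi> A"
proof -
  note cl = closed nonempty
  define H where "H x = Dg u (D x)" for x
  have linH: "linear H" unfolding H_def by (rule linear_compose[OF D(1) linear_Dg, unfolded o_def])
  have HV: "H x \<in> V" for x unfolding H_def by (rule Dg_V)
  obtain M where M: "M > 0" "\<And>x. norm (H x) \<le> M * norm x" using linear_normE[OF linH] by blast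
  have uN: "u \<in> normal_fibre A a" using normals by simp
  obtain r2 where r2: "r2 > 0" "ereal r2 \<le> areach_low \<phi> A a (g u)"
    "\<And>t. 0 < t \<Longrightarrow> t < r2 \<Longrightarrow> adist \<phi> A (a + t *\<^sub>R g u) = t \<and> aproj \<phi> A (a + t *\<^sub>R g u) = {a}"
    using areach_low_pos uN by blast
  \<comment> \<open>The bound r M \<le> 1/2 makes I + r H injective, and r < r2 keeps a the unique
    nearest point.\<close>
  define r where "r = min (r2 / 2) (1 / (2 * M))"
  have r: "r > 0" "r < r2" using r2 M by (auto simp: r_def)
  have "r \<le> 1 / (2 * M)" by (simp add: r_def)
  then have rM: "r * M \<le> 1/2" using M by (simp add: field_simps)
  define x0 where "x0 = a + r *\<^sub>R g u"
  have proj: "aproj \<phi> A x0 = {a}" and dist: "adist \<phi> A x0 = r" using r2(3)[OF r] by (auto simp: x0_def)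
  have x0A: "x0 \<notin> A" by (rule ray_not_in[OF dist r(1)])
  have anu0: "anu \<phi> A x0 = {g u}" using anu_ray proj dist r unfolding x0_def by blast
  \<comment> \<open>Composing with \<open>P\<close> extends I + r H from \<open>V\<close> to an
    endomorphism of the whole space, so that injectivity gives a two-sided inverse.\<close>
  define T where "T x = x + r *\<^sub>R H (P x)" for x
  have linT: "linear T"
    by (rule linearI) (simp_all add: T_def linear_add[OF linear_P] linear_add[OF linH] linear_cmul[OF linear_P]
        linear_cmul[OF linH] algebra_simps)
  have T0: "x = 0" if "T x = 0" for x
  proof -
    have "x = - (r *\<^sub>R H (P x))" using that by (simp add: T_def eq_neg_iff_add_eq_0)
    then have "norm x = r * norm (H (P x))" using r by (metis norm_minus_cancel norm_scaleR abs_of_pos)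
    also have "\<dots> \<le> r * (M * norm x)"
      using order_trans[OF M(2)[of "P x"] mult_left_mono[OF norm_P[of x], of M]] M(1) r
      by (intro mult_left_mono) auto
    also have "\<dots> \<le> 1/2 * norm x" using mult_right_mono[OF rM norm_ge_zero[of x]] by (simp add: mult_ac)
    finally show "x = 0" by simp
  qed
  obtain Ti where Ti: "linear Ti" "\<And>x. Ti (T x) = x" "\<And>x. T (Ti x) = x" using linear_inverseE[OF linT T0] by blast
  define S where "S x = Ti (Pg x)" for x
  have linS: "linear S" unfolding S_def by (rule linear_compose[OF linear_Pg Ti(1), unfolded o_def])
  define L where "L x = H (P (S x))" for x
  have linHP: "linear (\<lambda>x. H (P x))" by (rule linear_compose[OF linear_P linH, unfolded o_def])
  have linL: "linear L" unfolding L_def by (rule linear_compose[OF linS linHP, unfolded o_def])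
  have deriv: "anu_deriv \<phi> A x0 L"
    unfolding anu_deriv_def
  proof (intro conjI exI[of _ "g u"] x0A linL anu0 allI impI)
    \<comment> \<open>\<open>anu_deriv\<close> quantifies over all w in
      \<open>anu \<phi> A y\<close>, also where y has several nearest points. A filter on the pairs
      (y, w) with y tending to x0 turns this into a single limit.\<close>
    define I where "I = {(y, w). y \<notin> A \<and> w \<in> anu \<phi> A y}"
    define Fl where "Fl = inf (filtercomap fst (nhds x0)) (principal I)"
    define y :: "'a \<times> 'a \<Rightarrow> 'a" where "y = fst"
    define d where "d i = adist \<phi> A (y i)" for i
    define c where "c i = y i - d i *\<^sub>R snd i" for i
    have evI: "\<forall>\<^sub>F i in Fl. i \<in> I" unfolding Fl_def eventually_inf_principal by simp
    have cI: "\<forall>\<^sub>F i in Fl. y i \<notin> A \<and> c i \<in> aproj \<phi> A (y i) \<and> snd i = (1 / d i) *\<^sub>R (y i - c i)"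
      using evI
    proof eventually_elim
      case (elim i)
      then have yA: "y i \<notin> A" and "snd i \<in> anu \<phi> A (y i)" by (auto simp: I_def y_def)
      then obtain c' where c': "c' \<in> aproj \<phi> A (y i)" "snd i = (1 / d i) *\<^sub>R (y i - c')"
        unfolding anu_def d_def by blast
      have "d i > 0" unfolding d_def by (rule adist_pos[OF cl yA])
      then have "c i = c'" unfolding c_def c'(2) by simp
      then show ?case using c' yA by simp
    qed
    have ylim: "(y \<longlongrightarrow> x0) Fl"
      unfolding y_def Fl_def by (rule tendsto_mono[OF inf_le1 filterlim_filtercomap])
    have cI': "\<forall>\<^sub>F i in Fl. y i \<notin> A \<and> c i \<in> aproj \<phi> A (y i)" using cI by eventually_elim blast
    define w where "w i = (1 / d i) *\<^sub>R (y i - c i)" for i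
    define z where "z i = P (c i - a)" for i
    define Y where "Y i = y i - x0" for i
    obtain v q where vq:
      "(w \<longlongrightarrow> g u) Fl" "(v \<longlongrightarrow> u) Fl" "(z \<longlongrightarrow> 0) Fl"
      "\<forall>\<^sub>F i in Fl. norm (v i) = 1 \<and> w i = g (v i) \<and> \<gamma> * norm (v i - u) \<le> norm (w i - g u)"
      "\<forall>\<^sub>F i in Fl. norm (v i - u - q i) \<le> (norm (q i))\<^sup>2 \<and> norm (q i - (v i - u)) \<le> 2 * (norm (v i - u))\<^sup>2"
      "\<forall>\<^sub>F i in Fl. z i \<in> V \<and> sub (z i) (q i)"
      "\<forall>\<^sub>F i in Fl. \<bar>d i - r\<bar> \<le> norm (y i - x0) / \<gamma>"
      "\<forall>\<^sub>F i in Fl. y i - x0 =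
         z i - F (z i) *\<^sub>R u + r *\<^sub>R (w i - g u) + (d i - r) *\<^sub>R g u + (d i - r) *\<^sub>R (w i - g u)"
      "little_o Fl (\<lambda>i. F (z i)) (\<lambda>i. norm (z i))"
      by (rule nearest_asymptotics[OF proj[unfolded x0_def] dist[unfolded x0_def] r(1) ylim[unfolded x0_def] cI',
            folded x0_def z_def d_def, folded w_def])
    have sg: "\<exists>\<delta>>0. \<forall>z\<in>V. \<forall>q. norm z < \<delta> \<and> sub z q \<longrightarrow> norm (q - D z) \<le> \<epsilon> * norm z" if "\<epsilon> > 0" for \<epsilon>
      by (rule subgradient_expansion[OF subspace_V D(1) _ sym kap ex that]) (use D(2) in auto)
    have q: "little_o Fl (\<lambda>i. q i - D (z i)) (\<lambda>i. norm (z i))"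
      by (rule little_o_of_eps_delta[OF sg vq(3,6)])
    obtain KD where KD: "KD > 0" "\<And>x. norm (D x) \<le> KD * norm x" using linear_normE[OF D(1)] by blast
    have qb: "\<forall>\<^sub>F i in Fl. norm (q i) \<le> (KD + 1) * norm (z i)"
      using little_oD[OF q zero_less_one]
    proof eventually_elim
      case (elim i)
      then show ?case using norm_triangle_ineq[of "q i - D (z i)" "D (z i)"] KD(2)[of "z i"]
        by (simp add: algebra_simps)
    qed
    have nzlim: "((\<lambda>i. norm (z i)) \<longlongrightarrow> 0) Fl" using vq(3) by (rule tendsto_norm_zero)
    have vuq: "little_o Fl (\<lambda>i. v i - u - q i) (\<lambda>i. norm (z i))"
    proof (rule little_o_tendsto)
      show "((\<lambda>i. (KD + 1)\<^sup>2 * norm (z i)) \<longlongrightarrow> 0) Fl" using tendsto_mult_right_zero[OF nzlim] .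
      show "\<forall>\<^sub>F i in Fl. norm (v i - u - q i) \<le> (KD + 1)\<^sup>2 * norm (z i) * norm (z i)"
        using vq(5) qb
      proof eventually_elim
        case (elim i)
        have "(norm (q i))\<^sup>2 \<le> ((KD + 1) * norm (z i))\<^sup>2" using elim(2) by (intro power_mono) auto
        then show ?case using elim(1) by (simp add: power2_eq_square mult_ac)
      qed
    qed simp
    have vD: "little_o Fl (\<lambda>i. v i - u - D (z i)) (\<lambda>i. norm (z i))"
      using little_o_add[OF vuq q] by simp
    have vb: "\<forall>\<^sub>F i in Fl. norm (v i - u) \<le> (KD + 1) * norm (z i)"
      using little_oD[OF vD zero_less_one]
    proof eventually_elim
      case (elim i)
      then show ?case using norm_triangle_ineq[of "v i - u - D (z i)" "D (z i)"] KD(2)[of "z i"]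
        by (simp add: algebra_simps)
    qed
    have "little_o Fl (\<lambda>i. g (v i) - g u - Dg u (v i - u)) (\<lambda>i. norm (v i - u))"
      by (rule little_o_derivative[OF g_deriv[OF u0] vq(2)])
    then have gv: "little_o Fl (\<lambda>i. g (v i) - g u - Dg u (v i - u)) (\<lambda>i. norm (z i))"
      by (rule little_o_gauge[OF _ _ vb]) (use KD in simp)
    have "little_o Fl (\<lambda>i. (g (v i) - g u - Dg u (v i - u)) + Dg u (v i - u - D (z i))) (\<lambda>i. norm (z i))"
      by (rule little_o_add[OF gv little_o_linear[OF linear_Dg vD]])
    then have gH: "little_o Fl (\<lambda>i. g (v i) - g u - H (z i)) (\<lambda>i. norm (z i))"
      by (simp add: H_def linear_diff[OF linear_Dg])
    have wH: "little_o Fl (\<lambda>i. w i - g u - H (z i)) (\<lambda>i. norm (z i))"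
      by (rule little_o_norm_le[OF gH zero_less_one], use vq(4) in eventually_elim) auto
    \<comment> \<open>All terms of y - x0 other than z + r H z and the radial one. Some are small
      against |z|, one against |Y|; \<open>little_o_absorb\<close> later bounds |z| by |Y|.\<close>
    define E where "E i = r *\<^sub>R (w i - g u - H (z i)) - F (z i) *\<^sub>R u + (d i - r) *\<^sub>R (w i - g u)" for i
    have E1: "little_o Fl (\<lambda>i. r *\<^sub>R (w i - g u - H (z i)) - F (z i) *\<^sub>R u) (\<lambda>i. norm (z i))"
      by (intro little_o_diff little_o_linear[OF _ wH] little_o_linear[OF _ vq(9)] linear_scaleR linear_compose_scale_right)
         (auto intro!: linearI simp: algebra_simps)
    have E2: "little_o Fl (\<lambda>i. (d i - r) *\<^sub>R (w i - g u)) (\<lambda>i. norm (Y i))"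
    proof (rule little_o_tendsto)
      have "((\<lambda>i. norm (w i - g u)) \<longlongrightarrow> 0) Fl"
        using vq(1) by (intro tendsto_norm_zero) (simp add: LIM_zero)
      from tendsto_mult_right_zero[OF this] show "((\<lambda>i. (1 / \<gamma>) * norm (w i - g u)) \<longlongrightarrow> 0) Fl" .
      show "\<forall>\<^sub>F i in Fl. norm ((d i - r) *\<^sub>R (w i - g u)) \<le> (1 / \<gamma>) * norm (w i - g u) * norm (Y i)"
        using vq(7)
      proof eventually_elim
        case (elim i)
        from mult_right_mono[OF this norm_ge_zero[of "w i - g u"]] show ?case by (simp add: Y_def mult_ac)
      qed
    qed simp
    have E: "little_o Fl E (\<lambda>i. norm (z i) + norm (Y i))"
      unfolding E_def
      by (intro little_o_add little_o_gauge[OF E1 zero_less_one] little_o_gauge[OF E2 zero_less_one]) auto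
    define e where "e i = - S (E i)" for i
    have eo: "little_o Fl e (\<lambda>i. norm (z i) + norm (Y i))"
      unfolding e_def by (intro little_o_minus little_o_linear[OF linS E])
    have ze: "\<forall>\<^sub>F i in Fl. z i = S (Y i) + e i"
      using vq(6,8)
    proof eventually_elim
      case (elim i)
      then have zV: "z i \<in> V" by blast
      have "Y i = z i + r *\<^sub>R H (z i) + (d i - r) *\<^sub>R g u + E i"
        using elim(2) unfolding Y_def E_def by (simp add: algebra_simps)
      then have "Pg (Y i) = Pg (z i) + r *\<^sub>R Pg (H (z i)) + Pg (E i)"
        by (simp add: linear_add[OF linear_Pg] linear_cmul[OF linear_Pg] Pg_gu)
      also have "\<dots> = T (z i) + Pg (E i)" using zV HV by (simp add: Pg_V T_def P_id)
      finally have "S (Y i) = z i + S (E i)" unfolding S_def by (simp add: linear_add[OF Ti(1)] Ti(2))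
      then show ?case by (simp add: e_def)
    qed
    obtain KS where KS: "KS > 0" "\<And>x. norm (S x) \<le> KS * norm x" using linear_normE[OF linS] by blast
    have zb: "\<forall>\<^sub>F i in Fl. norm (z i) \<le> (2 * KS + 1) * norm (Y i)"
    proof (rule little_o_absorb[OF _ eo])
      show "\<forall>\<^sub>F i in Fl. norm (z i) \<le> KS * norm (Y i) + norm (e i)"
        using ze
      proof eventually_elim
        case (elim i)
        then show ?case using norm_triangle_ineq[of "S (Y i)" "e i"] KS(2)[of "Y i"] by simp
      qed
    qed
    have eY: "little_o Fl e (\<lambda>i. norm (Y i))"
      by (rule little_o_gauge[OF eo, of "2 * KS + 2"], use KS in simp, use zb in eventually_elim)
         (simp add: algebra_simps)
    have wY: "little_o Fl (\<lambda>i. w i - g u - H (z i)) (\<lambda>i. norm (Y i))"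
      by (rule little_o_gauge[OF wH _ zb]) (use KS in simp)
    have "little_o Fl (\<lambda>i. (w i - g u - H (z i)) + H (P (e i))) (\<lambda>i. norm (Y i))"
      by (rule little_o_add[OF wY little_o_linear[OF linHP eY]])
    then have fin: "little_o Fl (\<lambda>i. w i - g u - L (Y i)) (\<lambda>i. norm (Y i))"
    proof (rule little_o_norm_le[OF _ zero_less_one])
      show "\<forall>\<^sub>F i in Fl. norm (w i - g u - L (Y i)) \<le> 1 * norm ((w i - g u - H (z i)) + H (P (e i)))"
        using ze vq(6)
      proof eventually_elim
        case (elim i)
        have "P (z i) = z i" using elim(2) by (simp only: P_id)
        moreover have "P (z i) = P (S (Y i)) + P (e i)" using elim(1) linear_add[OF linear_P] by metis
        ultimately have "H (z i) = H (P (S (Y i))) + H (P (e i))" using linear_add[OF linH] by metis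
        then show ?case by (simp add: L_def)
      qed
    qed
    fix \<epsilon>' :: real assume "\<epsilon>' > 0"
    from little_oD[OF fin this] cI have "\<forall>\<^sub>F i in Fl. norm (snd i - g u - L (fst i - x0)) \<le> \<epsilon>' * norm (fst i - x0)"
      by eventually_elim (simp add: w_def Y_def y_def)
    then obtain Q where Q: "eventually Q (nhds x0)" "\<And>i. Q (fst i) \<Longrightarrow> i \<in> I \<Longrightarrow> norm (snd i - g u - L (fst i - x0)) \<le> \<epsilon>' * norm (fst i - x0)"
      unfolding Fl_def eventually_inf_principal eventually_filtercomap by blast
    obtain d0 where d0: "d0 > 0" "\<And>y. dist y x0 < d0 \<Longrightarrow> Q y" using Q(1) unfolding eventually_nhds_metric by blast
    show "\<exists>\<delta>>0. \<forall>y w'. y \<notin> A \<and> norm (y - x0) < \<delta> \<and> w' \<in> anu \<phi> A y \<longrightarrow>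
        norm (w' - g u - L (y - x0)) \<le> \<epsilon>' * norm (y - x0)"
    proof (intro exI[of _ d0] conjI d0(1) allI impI)
      fix y w' assume "y \<notin> A \<and> norm (y - x0) < d0 \<and> w' \<in> anu \<phi> A y"
      then show "norm (w' - g u - L (y - x0)) \<le> \<epsilon>' * norm (y - x0)"
        using Q(2)[of "(y, w')"] d0(2)[of y] by (simp add: I_def dist_norm)
    qed
  qed
  have eig: "1 - r * k \<noteq> 0"
    if L': "anu_deriv \<phi> A x0 L'" and wkv: "anu \<phi> A x0 = {w} \<and> x \<noteq> 0 \<and> Wnormal \<phi> w \<bullet> x = 0 \<and> L' x = k *\<^sub>R x" for L' w k x
  proof
    assume 0: "1 - r * k = 0"
    have "w = g u" using wkv anu0 by simp
    then have xV: "x \<in> V" using wkv Wnormal_g[OF u1] by (simp add: inner_commute)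
    have "L' = L" by (rule anu_deriv_unique[OF closed anu_nonempty L' deriv])
    then have Lx: "H (P (Ti x)) = k *\<^sub>R x" using wkv Pg_V[OF xV] by (simp add: L_def S_def)
    have "T (Ti x) = Ti x + (r * k) *\<^sub>R x" by (simp add: T_def Lx)
    then have "x = Ti x + x" using Ti(3)[of x] 0 by simp
    then have "Ti x = 0" by simp
    then have "x = 0" using Ti(3)[of x] linear_0[OF linT] by simp
    then show False using wkv by simp
  qed
  have "(a, g u) \<in> aNor \<phi> A"
    unfolding aNor_def using aA g_in_frontier_Wulff[OF u0] dist r unfolding x0_def by blast
  moreover have "ereal r < areach_low \<phi> A a (g u)" using r(2) r2(2) by (metis less_ereal.simps(1) less_le_trans)
  moreover have "x0 \<in> anu_dmn \<phi> A" using deriv by (auto simp: anu_dmn_def)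
  ultimately show ?thesis
    unfolding aNor_n_def using r(1) eig unfolding x0_def by blast
qed

text \<open>Slopes are read off from L \<tau> by inverting \<open>Dg u\<close> on \<open>V\<close>,
  base points from \<tau> by inverting I - r L; eliminating \<tau> gives D. The estimate at these
  base points is then spread to all subgradients and integrated.\<close>

lemma aNor_n_imp_second_order:
  assumes N: "(a, g u) \<in> aNor_n \<phi> A"
  obtains D where "linear D"
    "\<And>\<epsilon>. \<epsilon> > 0 \<Longrightarrow> \<exists>\<delta>>0. \<forall>z\<in>V. norm z < \<delta> \<longrightarrow> \<bar>F z - D z \<bullet> z / 2\<bar> \<le> \<epsilon> * (norm z)\<^sup>2"
proof -
  note cl = closed nonempty
  from N obtain r where r: "0 < r" "ereal r < areach_low \<phi> A a (g u)" and dmn: "a + r *\<^sub>R g u \<in> anu_dmn \<phi> A"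
    and eig: "\<And>L w k v. anu_deriv \<phi> A (a + r *\<^sub>R g u) L \<Longrightarrow> anu \<phi> A (a + r *\<^sub>R g u) = {w} \<Longrightarrow> v \<noteq> 0 \<Longrightarrow>
      Wnormal \<phi> w \<bullet> v = 0 \<Longrightarrow> L v = k *\<^sub>R v \<Longrightarrow> 1 - r * k \<noteq> 0"
    unfolding aNor_n_def by blast
  define x0 where "x0 = a + r *\<^sub>R g u"
  \<comment> \<open>\<open>aproj_unique\<close> needs the distance equality at some s0 beyond r; the
    ordinary reach supplies it.\<close>
  have "ereal r < areach \<phi> A a (g u)" by (rule less_areach_of_less_areach_low[OF cl aA dual_gu r])
  then obtain s0 where s0: "r < s0" "adist \<phi> A (a + s0 *\<^sub>R g u) = s0"
    unfolding areach_def less_Sup_iff by auto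
  have proj: "aproj \<phi> A x0 = {a}" unfolding x0_def by (rule aproj_unique[OF cl aA dual_gu s0(2) r(1) s0(1)])
  have dist: "adist \<phi> A x0 = r" unfolding x0_def
    by (rule adist_shorten[OF cl aA dual_gu s0(2)]) (use r s0 in auto)
  have x0A: "x0 \<notin> A" by (rule ray_not_in[OF dist r(1)])
  have anu0: "anu \<phi> A x0 = {g u}" using anu_ray proj dist r unfolding x0_def by blast
  obtain L where L: "anu_deriv \<phi> A x0 L" using dmn by (auto simp: anu_dmn_def x0_def)
  have linL: "linear L" and Ld: "\<And>e. e > 0 \<Longrightarrow> \<exists>d>0. \<forall>y w'. y \<notin> A \<and> norm (y - x0) < d \<and> w' \<in> anu \<phi> A y \<longrightarrow>
            norm (w' - g u - L (y - x0)) \<le> e * norm (y - x0)"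
    using L anu0 unfolding anu_deriv_def by auto
  define y where "y \<tau> = x0 + \<tau>" for \<tau>
  define c where "c \<tau> = (SOME c. c \<in> aproj \<phi> A (y \<tau>))" for \<tau>
  have c: "c \<tau> \<in> aproj \<phi> A (y \<tau>)" for \<tau>
    unfolding c_def using aproj_nonempty[OF cl, of "y \<tau>"] by (simp add: some_in_eq)
  have idlim: "((\<lambda>\<tau>. \<tau>) \<longlongrightarrow> 0) V0" unfolding V0_def by (rule tendsto_mono[OF inf_le1 filterlim_ident])
  have ylim: "(y \<longlongrightarrow> x0) V0"
    using tendsto_add[OF tendsto_const[of x0] idlim] unfolding y_def by simp
  have "open (- A)" using closed by (simp add: open_Compl)
  then have yA: "\<forall>\<^sub>F \<tau> in V0. y \<tau> \<notin> A" using topological_tendstoD[OF ylim] x0A by fastforce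
  have cI: "\<forall>\<^sub>F \<tau> in V0. y \<tau> \<notin> A \<and> c \<tau> \<in> aproj \<phi> A (y \<tau>)" using yA by eventually_elim (use c in blast)
  have inV: "\<forall>\<^sub>F \<tau> in V0. \<tau> \<in> V" unfolding V0_def eventually_inf_principal by simp
  define d where "d i = adist \<phi> A (y i)" for i
  define w where "w i = (1 / d i) *\<^sub>R (y i - c i)" for i
  define z where "z i = P (c i - a)" for i
  obtain v q where vq:
    "(w \<longlongrightarrow> g u) V0" "(v \<longlongrightarrow> u) V0" "(z \<longlongrightarrow> 0) V0"
    "\<forall>\<^sub>F i in V0. norm (v i) = 1 \<and> w i = g (v i) \<and> \<gamma> * norm (v i - u) \<le> norm (w i - g u)"
    "\<forall>\<^sub>F i in V0. norm (v i - u - q i) \<le> (norm (q i))\<^sup>2 \<and> norm (q i - (v i - u)) \<le> 2 * (norm (v i - u))\<^sup>2"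
    "\<forall>\<^sub>F i in V0. z i \<in> V \<and> sub (z i) (q i)"
    "\<forall>\<^sub>F i in V0. \<bar>d i - r\<bar> \<le> norm (y i - x0) / \<gamma>"
    "\<forall>\<^sub>F i in V0. y i - x0 =
       z i - F (z i) *\<^sub>R u + r *\<^sub>R (w i - g u) + (d i - r) *\<^sub>R g u + (d i - r) *\<^sub>R (w i - g u)"
    "little_o V0 (\<lambda>i. F (z i)) (\<lambda>i. norm (z i))"
    by (rule nearest_asymptotics[OF proj[unfolded x0_def] dist[unfolded x0_def] r(1) ylim[unfolded x0_def] cI,
          folded x0_def z_def d_def, folded w_def])
  have yx: "y \<tau> - x0 = \<tau>" for \<tau> by (simp add: y_def)
  have wL: "little_o V0 (\<lambda>\<tau>. w \<tau> - g u - L \<tau>) norm"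
    unfolding little_o_def
  proof (intro allI impI)
    fix e :: real assume "e > 0"
    from Ld[OF this] obtain d0 where d0: "d0 > 0" "\<And>y w'. y \<notin> A \<Longrightarrow> norm (y - x0) < d0 \<Longrightarrow> w' \<in> anu \<phi> A y \<Longrightarrow>
            norm (w' - g u - L (y - x0)) \<le> e * norm (y - x0)" by blast
    from yA tendstoD[OF idlim d0(1)] show "\<forall>\<^sub>F \<tau> in V0. norm (w \<tau> - g u - L \<tau>) \<le> e * norm \<tau>"
    proof eventually_elim
      case (elim \<tau>)
      have "w \<tau> \<in> anu \<phi> A (y \<tau>)" unfolding w_def d_def anu_def using c by blast
      then show ?case using d0(2)[OF elim(1), of "w \<tau>"] elim(2) by (simp add: yx)
    qed
  qed
  obtain KL where KL: "KL > 0" "\<And>x. norm (L x) \<le> KL * norm x" using linear_normE[OF linL] by blast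
  have wb: "\<forall>\<^sub>F \<tau> in V0. norm (w \<tau> - g u) \<le> (KL + 1) * norm \<tau>"
    using little_oD[OF wL zero_less_one]
  proof eventually_elim
    case (elim \<tau>)
    then show ?case using norm_triangle_ineq[of "w \<tau> - g u - L \<tau>" "L \<tau>"] KL(2)[of \<tau>]
      by (simp add: algebra_simps)
  qed
  define Cv where "Cv = (KL + 1) / \<gamma>"
  have Cv: "Cv > 0" using KL gamma_pos by (simp add: Cv_def)
  have vb: "\<forall>\<^sub>F \<tau> in V0. norm (v \<tau> - u) \<le> Cv * norm \<tau>"
    using vq(4) wb
  proof eventually_elim
    case (elim \<tau>)
    have "\<gamma> * norm (v \<tau> - u) \<le> norm (w \<tau> - g u)" using elim(1) by blast
    also have "\<dots> \<le> (KL + 1) * norm \<tau>" by (rule elim(2))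
    also have "\<dots> = \<gamma> * (Cv * norm \<tau>)" using gamma_pos by (simp add: Cv_def)
    finally show ?case using gamma_pos by simp
  qed
  have vu0: "((\<lambda>\<tau>. norm (v \<tau> - u)) \<longlongrightarrow> 0) V0"
    using vq(2) by (intro tendsto_norm_zero) (simp add: LIM_zero)
  \<comment> \<open>\<open>g u\<close> and \<open>g v\<close> are maximal in their own directions,
    so (w - g u) . u \<le> 0 \<le> (w - g u) . v. The gap (w - g u) . (v - u) is a product of two
    small terms; hence L maps \<open>V\<close> into \<open>V\<close>.\<close>
  have "little_o V0 (\<lambda>\<tau>. (w \<tau> - g u) \<bullet> u) norm"
  proof (rule little_o_tendsto)
    show "((\<lambda>\<tau>. (KL + 1) * norm (v \<tau> - u)) \<longlongrightarrow> 0) V0" using tendsto_mult_right_zero[OF vu0] .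
    show "\<forall>\<^sub>F \<tau> in V0. norm ((w \<tau> - g u) \<bullet> u) \<le> (KL + 1) * norm (v \<tau> - u) * norm \<tau>"
      using vq(4) wb
    proof eventually_elim
      case (elim \<tau>)
      then have v: "norm (v \<tau>) = 1" "w \<tau> = g (v \<tau>)" by auto
      then have v0: "v \<tau> \<noteq> 0" by auto
      have 1: "(w \<tau> - g u) \<bullet> u \<le> 0" using g_inner_le[OF v0 u0] gu v by (simp add: inner_diff_left)
      have 2: "(w \<tau> - g u) \<bullet> v \<tau> \<ge> 0" using g_inner_le[OF u0 v0] euler[OF v0] v by (simp add: inner_diff_left)
      have "(w \<tau> - g u) \<bullet> (v \<tau> - u) \<le> norm (w \<tau> - g u) * norm (v \<tau> - u)" by (rule norm_cauchy_schwarz)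
      also have "\<dots> \<le> (KL + 1) * norm \<tau> * norm (v \<tau> - u)" using elim(2) by (intro mult_right_mono) auto
      finally show ?case using 1 2 by (simp add: inner_diff_right mult_ac)
    qed
  qed simp
  moreover have "little_o V0 (\<lambda>\<tau>. (w \<tau> - g u - L \<tau>) \<bullet> u) norm"
    by (rule little_o_linear[OF _ wL]) (auto intro!: linearI simp: inner_add_left)
  ultimately have "little_o V0 (\<lambda>\<tau>. (w \<tau> - g u) \<bullet> u - (w \<tau> - g u - L \<tau>) \<bullet> u) norm" by (rule little_o_diff)
  then have Lu: "little_o V0 (\<lambda>\<tau>. L \<tau> \<bullet> u) norm" by (simp add: inner_diff_left)
  have linLu: "linear (\<lambda>x. L x \<bullet> u)"
    by (rule linearI) (simp_all add: linear_add[OF linL] linear_cmul[OF linL] inner_add_left)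
  have LV: "L h \<in> V" if "h \<in> V" for h
    using linear_little_o_zero[OF linLu Lu that] by simp
  \<comment> \<open>A kernel vector of B lies in \<open>V\<close> and is an eigenvector of L with
    eigenvalue 1 / r, which finiteness of the curvatures excludes. As before, \<open>P\<close>
    extends the map to the whole space.\<close>
  define B where "B x = x - r *\<^sub>R L (P x)" for x
  have linB: "linear B"
    by (rule linearI) (simp_all add: B_def linear_add[OF linear_P] linear_add[OF linL] linear_cmul[OF linear_P]
        linear_cmul[OF linL] algebra_simps)
  have B0: "x = 0" if "B x = 0" for x
  proof (rule ccontr)
    assume "x \<noteq> 0"
    have xe: "x = r *\<^sub>R L (P x)" using that by (simp add: B_def)
    have "L (P x) \<bullet> u = 0" using LV[OF P_V] by simp
    with arg_cong[OF xe, of "\<lambda>y. y \<bullet> u"] have xV: "x \<in> V" by simp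
    have xL: "x = r *\<^sub>R L x" using xe unfolding P_id[OF xV] .
    have "L x = (1 / r) *\<^sub>R (r *\<^sub>R L x)" using r(1) by simp
    then have "L x = (1 / r) *\<^sub>R x" unfolding xL[symmetric] .
    moreover have "Wnormal \<phi> (g u) \<bullet> x = 0" using Wnormal_g[OF u1] xV by (simp add: inner_commute)
    ultimately have "1 - r * (1 / r) \<noteq> 0" using eig[OF L[unfolded x0_def] anu0[unfolded x0_def] \<open>x \<noteq> 0\<close>] by blast
    then show False using r(1) by simp
  qed
  obtain Bi where Bi: "linear Bi" "\<And>x. Bi (B x) = x" "\<And>x. B (Bi x) = x" using linear_inverseE[OF linB B0] by blast
  have BiV: "Bi x \<in> V" if "x \<in> V" for x
  proof -
    have "Bi x = x + r *\<^sub>R L (P (Bi x))" using Bi(3)[of x] by (simp add: B_def algebra_simps)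
    moreover have "x + r *\<^sub>R L (P (Bi x)) \<in> V"
      using that LV[OF P_V] by (auto simp: inner_add_left)
    ultimately show ?thesis by metis
  qed
  define E where "E \<tau> = r *\<^sub>R (w \<tau> - g u - L \<tau>) + (d \<tau> - r) *\<^sub>R (w \<tau> - g u) - F (z \<tau>) *\<^sub>R u" for \<tau>
  have E1: "little_o V0 (\<lambda>\<tau>. r *\<^sub>R (w \<tau> - g u - L \<tau>)) norm"
    by (rule little_o_linear[OF _ wL]) (auto intro!: linearI simp: algebra_simps)
  have E2: "little_o V0 (\<lambda>i. (d i - r) *\<^sub>R (w i - g u)) norm"
  proof (rule little_o_tendsto)
    have "((\<lambda>i. norm (w i - g u)) \<longlongrightarrow> 0) V0"
      using vq(1) by (intro tendsto_norm_zero) (simp add: LIM_zero)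
    from tendsto_mult_right_zero[OF this] show "((\<lambda>i. (1 / \<gamma>) * norm (w i - g u)) \<longlongrightarrow> 0) V0" .
    show "\<forall>\<^sub>F i in V0. norm ((d i - r) *\<^sub>R (w i - g u)) \<le> (1 / \<gamma>) * norm (w i - g u) * norm i"
      using vq(7)
    proof eventually_elim
      case (elim i)
      from mult_right_mono[OF this norm_ge_zero[of "w i - g u"]] show ?case by (simp add: yx mult_ac)
    qed
  qed simp
  have E3: "little_o V0 (\<lambda>\<tau>. F (z \<tau>) *\<^sub>R u) (\<lambda>\<tau>. norm (z \<tau>))"
    by (rule little_o_linear[OF _ vq(9)]) (auto intro!: linearI simp: algebra_simps)
  have E: "little_o V0 E (\<lambda>\<tau>. norm (z \<tau>) + norm \<tau>)"
    unfolding E_def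
    by (intro little_o_add little_o_diff little_o_gauge[OF E1 zero_less_one] little_o_gauge[OF E2 zero_less_one]
        little_o_gauge[OF E3 zero_less_one]) auto
  define e where "e \<tau> = - Pg (E \<tau>)" for \<tau>
  have eo: "little_o V0 e (\<lambda>\<tau>. norm (z \<tau>) + norm \<tau>)"
    unfolding e_def by (intro little_o_minus little_o_linear[OF linear_Pg E])
  have ze: "\<forall>\<^sub>F \<tau> in V0. z \<tau> = B \<tau> + e \<tau>"
    using vq(6,8) inV
  proof eventually_elim
    case (elim \<tau>)
    then have zV: "z \<tau> \<in> V" by blast
    have "\<tau> = z \<tau> + r *\<^sub>R L \<tau> + (d \<tau> - r) *\<^sub>R g u + E \<tau>"
      using elim(2) unfolding yx E_def by (simp add: algebra_simps)
    then have "Pg \<tau> = Pg (z \<tau> + r *\<^sub>R L \<tau> + (d \<tau> - r) *\<^sub>R g u + E \<tau>)" by (rule arg_cong)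
    also have "\<dots> = Pg (z \<tau>) + r *\<^sub>R Pg (L \<tau>) + Pg (E \<tau>)"
      by (simp add: linear_add[OF linear_Pg] linear_cmul[OF linear_Pg] Pg_gu)
    also have "\<dots> = z \<tau> + r *\<^sub>R L \<tau> + Pg (E \<tau>)" using Pg_V[OF zV] Pg_V[OF LV[OF elim(3)]] by simp
    finally have "\<tau> = z \<tau> + r *\<^sub>R L \<tau> + Pg (E \<tau>)" using Pg_V[OF elim(3)] by simp
    then show ?case unfolding e_def B_def P_id[OF elim(3)] by (simp add: algebra_simps)
  qed
  obtain KB where KB: "KB > 0" "\<And>x. norm (B x) \<le> KB * norm x" using linear_normE[OF linB] by blast
  have zb: "\<forall>\<^sub>F \<tau> in V0. norm (z \<tau>) \<le> (2 * KB + 1) * norm \<tau>"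
  proof (rule little_o_absorb[OF _ eo])
    show "\<forall>\<^sub>F \<tau> in V0. norm (z \<tau>) \<le> KB * norm \<tau> + norm (e \<tau>)"
      using ze
    proof eventually_elim
      case (elim \<tau>)
      then show ?case using norm_triangle_ineq[of "B \<tau>" "e \<tau>"] KB(2)[of \<tau>] by simp
    qed
  qed
  have e\<tau>: "little_o V0 e norm"
    by (rule little_o_gauge[OF eo, of "2 * KB + 2"], use KB in simp, use zb in eventually_elim)
       (simp add: algebra_simps)
  have zB: "little_o V0 (\<lambda>\<tau>. z \<tau> - B \<tau>) norm"
    by (rule little_o_norm_le[OF e\<tau> zero_less_one], use ze in eventually_elim) simp
  \<comment> \<open>\<open>Dg u\<close> has range in \<open>V\<close>, hence is singular; adding the
    projection to the line of u makes it invertible, thanks to the lower bound of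
    \<open>Dg_norm_lower\<close> on \<open>V\<close>.\<close>
  define G where "G x = Dg u x + (x \<bullet> u) *\<^sub>R u" for x
  have linG: "linear G"
    by (rule linearI) (simp_all add: G_def linear_add[OF linear_Dg] linear_cmul[OF linear_Dg] algebra_simps)
  have G0: "x = 0" if "G x = 0" for x
  proof -
    have "G x \<bullet> u = x \<bullet> u" using Dg_orth[OF u0, of x] uu by (simp add: G_def inner_add_left)
    then have xV: "x \<bullet> u = 0" using that by simp
    then have D0: "Dg u x = 0" using that by (simp add: G_def)
    have "\<gamma> * norm x \<le> 0"
    proof (rule Dg_norm_lower[OF u1 xV, THEN order_trans])
    qed (use D0 in simp)
    then show ?thesis using gamma_pos by (simp add: mult_le_0_iff)
  qed
  obtain Gi where Gi: "linear Gi" "\<And>x. Gi (G x) = x" "\<And>x. G (Gi x) = x" using linear_inverseE[OF linG G0] by blast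
  have sq: "little_o V0 h norm" if "\<forall>\<^sub>F \<tau> in V0. norm (h \<tau>) \<le> 2 * (norm (v \<tau> - u))\<^sup>2" for h :: "'a \<Rightarrow> 'b::real_normed_vector"
  proof (rule little_o_tendsto)
    show "((\<lambda>\<tau>. (2 * Cv) * norm (v \<tau> - u)) \<longlongrightarrow> 0) V0" using tendsto_mult_right_zero[OF vu0] .
    show "\<forall>\<^sub>F \<tau> in V0. norm (h \<tau>) \<le> (2 * Cv) * norm (v \<tau> - u) * norm \<tau>"
      using that vb
    proof eventually_elim
      case (elim \<tau>)
      have "norm (v \<tau> - u) * norm (v \<tau> - u) \<le> norm (v \<tau> - u) * (Cv * norm \<tau>)"
        using elim(2) by (intro mult_left_mono) auto
      then show ?case using elim(1) by (simp add: power2_eq_square mult_ac)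
    qed
  qed simp
  have "little_o V0 (\<lambda>i. g (v i) - g u - Dg u (v i - u)) (\<lambda>i. norm (v i - u))"
    by (rule little_o_derivative[OF g_deriv[OF u0] vq(2)])
  then have gv: "little_o V0 (\<lambda>i. g (v i) - g u - Dg u (v i - u)) norm"
    by (rule little_o_gauge[OF _ Cv vb])
  \<comment> \<open>On the sphere (v - u) . u = - |v - u|^2 / 2, so the rank one part of G acts on v
    - u only to second order.\<close>
  have nu: "little_o V0 (\<lambda>\<tau>. ((v \<tau> - u) \<bullet> u) *\<^sub>R u) norm"
  proof (rule sq)
    show "\<forall>\<^sub>F \<tau> in V0. norm (((v \<tau> - u) \<bullet> u) *\<^sub>R u) \<le> 2 * (norm (v \<tau> - u))\<^sup>2"
      using vq(4)
    proof eventually_elim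
      case (elim \<tau>)
      have "(norm (v \<tau> - u))\<^sup>2 = - 2 * ((v \<tau> - u) \<bullet> u)"
        using unit_dist_sq[of "v \<tau>" u] elim u1 uu by (simp add: inner_diff_left)
      then have "(v \<tau> - u) \<bullet> u = - ((norm (v \<tau> - u))\<^sup>2 / 2)" by simp
      then show ?case using u1 by simp
    qed
  qed
  have "little_o V0 (\<lambda>i. (w i - g u - L i) - (g (v i) - g u - Dg u (v i - u)) + ((v i - u) \<bullet> u) *\<^sub>R u) norm"
    by (intro little_o_add little_o_diff wL gv nu)
  then have Gv: "little_o V0 (\<lambda>i. G (v i - u) - L i) norm"
    by (rule little_o_norm_le[OF _ zero_less_one], use vq(4) in eventually_elim)
       (simp add: G_def algebra_simps)
  have "little_o V0 (\<lambda>i. Gi (G (v i - u) - L i)) norm" by (rule little_o_linear[OF Gi(1) Gv])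
  then have vG: "little_o V0 (\<lambda>i. v i - u - Gi (L i)) norm" by (simp add: linear_diff[OF Gi(1)] Gi(2))
  have qv: "little_o V0 (\<lambda>i. q i - (v i - u)) norm"
    by (rule sq, use vq(5) in eventually_elim) simp
  have "little_o V0 (\<lambda>i. (q i - (v i - u)) + (v i - u - Gi (L i))) norm" by (rule little_o_add[OF qv vG])
  then have "little_o V0 (\<lambda>i. q i - Gi (L i)) norm" by simp
  then have "little_o V0 (\<lambda>i. P (q i - Gi (L i))) norm" by (rule little_o_linear[OF linear_P])
  then have qS: "little_o V0 (\<lambda>i. P (q i) - P (Gi (L i))) norm" by (simp add: linear_diff[OF linear_P])
  define D where "D x = P (Gi (L (Bi x)))" for x
  have linD: "linear D" unfolding D_def
    by (rule linearI) (simp_all add: linear_add[OF Bi(1)] linear_add[OF linL] linear_add[OF Gi(1)] linear_add[OF linear_P]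
        linear_cmul[OF Bi(1)] linear_cmul[OF linL] linear_cmul[OF Gi(1)] linear_cmul[OF linear_P])
  have DV: "D x \<in> V" for x unfolding D_def by (rule P_V)
  obtain KI where KI: "KI > 0" "\<And>x. norm (Bi x) \<le> KI * norm x" using linear_normE[OF Bi(1)] by blast
  have approx: "\<exists>\<delta>>0. \<forall>x\<in>V. norm x < \<delta> \<longrightarrow>
      (\<exists>b\<in>V. \<exists>q. sub b q \<and> norm (b - x) \<le> \<epsilon>' * norm x \<and> norm (q - D x) \<le> \<epsilon>' * norm x)" if e': "\<epsilon>' > 0" for \<epsilon>'
  proof -
    have e1: "\<epsilon>' / KI > 0" using e' KI by simp
    from little_oD[OF zB e1] little_oD[OF qS e1] vq(6)
    have "\<forall>\<^sub>F \<tau> in V0. norm (z \<tau> - B \<tau>) \<le> \<epsilon>' / KI * norm \<tau> \<and> norm (P (q \<tau>) - P (Gi (L \<tau>))) \<le> \<epsilon>' / KI * norm \<tau> \<and>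
        z \<tau> \<in> V \<and> sub (z \<tau>) (q \<tau>)" by eventually_elim blast
    then obtain d0 where d0: "d0 > 0" "\<And>\<tau>. \<tau> \<in> V \<Longrightarrow> norm \<tau> < d0 \<Longrightarrow> norm (z \<tau> - B \<tau>) \<le> \<epsilon>' / KI * norm \<tau> \<and>
        norm (P (q \<tau>) - P (Gi (L \<tau>))) \<le> \<epsilon>' / KI * norm \<tau> \<and> z \<tau> \<in> V \<and> sub (z \<tau>) (q \<tau>)"
      unfolding eventually_V0 by blast
    have "\<exists>b\<in>V. \<exists>q. sub b q \<and> norm (b - x) \<le> \<epsilon>' * norm x \<and> norm (q - D x) \<le> \<epsilon>' * norm x"
      if x: "x \<in> V" "norm x < d0 / KI" for x
    proof -
      \<comment> \<open>This displacement aims at x: its nearest point has z = B \<tau> + o(\<tau>)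
        = x + o(x).\<close>
      define \<tau> where "\<tau> = Bi x"
      have \<tau>V: "\<tau> \<in> V" unfolding \<tau>_def by (rule BiV[OF x(1)])
      have n: "norm \<tau> \<le> KI * norm x" unfolding \<tau>_def by (rule KI(2))
      also have "\<dots> < d0" using x(2) KI(1) by (simp add: field_simps)
      finally have nd: "norm \<tau> < d0" .
      have le: "\<epsilon>' / KI * norm \<tau> \<le> \<epsilon>' * norm x"
        using mult_left_mono[OF n, of "\<epsilon>' / KI"] e1 KI(1) by simp
      note h = d0(2)[OF \<tau>V nd]
      have "q \<tau> \<in> V" using h unfolding proximal_subgradient_def by blast
      then have "P (q \<tau>) = q \<tau>" by (rule P_id)
      then have "norm (q \<tau> - D x) \<le> \<epsilon>' * norm x" using h le unfolding D_def \<tau>_def[symmetric] by simp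
      moreover have "norm (z \<tau> - x) \<le> \<epsilon>' * norm x" using h le Bi(3)[of x] unfolding \<tau>_def[symmetric] by simp
      ultimately show ?thesis using h by blast
    qed
    then show ?thesis using d0(1) KI(1) by (intro exI[of _ "d0 / KI"]) auto
  qed
  obtain Rs where Rs: "Rs > 0" "\<And>z. z \<in> V \<Longrightarrow> norm z < Rs \<Longrightarrow> \<exists>q. sub z q" using sub_ex by blast
  \<comment> \<open>\<open>subgradient_expansion_of_approx\<close> excludes z = 0, where the
    estimate demands p 0 = D 0 = 0; \<open>sub_zero\<close> permits this choice.\<close>
  define p where "p x = (if x = 0 then 0 else (SOME q. sub x q))" for x
  have p: "sub x (p x)" if "x \<in> V" "norm x < Rs" for x
    using sub_zero someI_ex[OF Rs(2)[OF that]] by (auto simp: p_def)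
  have pD: "\<exists>\<delta>>0. \<forall>x\<in>V. norm x < \<delta> \<longrightarrow> norm (p x - D x) \<le> \<epsilon>' * norm x" if e': "\<epsilon>' > 0" for \<epsilon>'
  proof -
    obtain d1 where d1: "d1 > 0" "\<And>x p. x \<in> V \<Longrightarrow> x \<noteq> 0 \<Longrightarrow> norm x < d1 \<Longrightarrow> sub x p \<Longrightarrow> norm (p - D x) \<le> \<epsilon>' * norm x"
      using subgradient_expansion_of_approx[OF subspace_V linD DV kap approx e'] by blast
    have "norm (p x - D x) \<le> \<epsilon>' * norm x" if "x \<in> V" "norm x < min d1 Rs" for x
    proof (cases "x = 0")
      case True
      then show ?thesis using linear_0[OF linD] by (simp add: p_def)
    next
      case False
      then show ?thesis using d1(2)[OF that(1) False _ p[OF that(1)]] that(2) by simp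
    qed
    then show ?thesis using d1(1) Rs(1) by (intro exI[of _ "min d1 Rs"]) auto
  qed
  have so: "\<exists>\<delta>>0. \<forall>z\<in>V. norm z < \<delta> \<longrightarrow> \<bar>F z - D z \<bullet> z / 2\<bar> \<le> \<epsilon>' * (norm z)\<^sup>2" if "\<epsilon>' > 0" for \<epsilon>'
    by (rule second_order_of_subgradients[OF subspace_V linD kap _ Rs(1) p pD that]) (use fa in auto)
  show ?thesis by (rule that[OF linD so])
qed

end

section \<open>Normals of the epigraph and the second derivative of f\<close>

context epigraph_point
begin

lemma second_order_symmetricE:
  assumes "second_order_at (hplane a u) f a L Q"
  obtains D where "linear D" "\<And>z. D z \<bullet> u = 0"
    "\<And>x z. x \<in> V \<Longrightarrow> z \<in> V \<Longrightarrow> D x \<bullet> z = Q x z"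
    "\<And>x z. x \<in> V \<Longrightarrow> z \<in> V \<Longrightarrow> D x \<bullet> z = D z \<bullet> x"
    "\<And>\<epsilon>. \<epsilon> > 0 \<Longrightarrow> \<exists>\<delta>>0. \<forall>z\<in>V. norm z < \<delta> \<longrightarrow> \<bar>F z - D z \<bullet> z / 2\<bar> \<le> \<epsilon> * (norm z)\<^sup>2"
proof -
  have sym: "Q x y = Q y x" for x y using assms by (simp add: second_order_at_def)
  obtain D where D: "linear D" "\<And>z. D z \<bullet> u = 0"
    "\<And>x z. x \<bullet> u = 0 \<Longrightarrow> z \<bullet> u = 0 \<Longrightarrow> D x \<bullet> z = Q x z"
    "\<And>\<epsilon>. \<epsilon> > 0 \<Longrightarrow> \<exists>\<delta>>0. \<forall>z\<in>V. norm z < \<delta> \<longrightarrow> \<bar>F z - D z \<bullet> z / 2\<bar> \<le> \<epsilon> * (norm z)\<^sup>2"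
    using second_order_atD[OF u1 assms fa der] by blast
  show ?thesis
    by (rule that[OF D(1,2) _ _ D(4)]) (use D(3) sym in auto)
qed

lemma aNor_n_iff: "(a, g u) \<in> aNor_n \<phi> A \<longleftrightarrow> pt_twice_diff (hplane a u) f a"
proof
  assume "(a, g u) \<in> aNor_n \<phi> A"
  then obtain D where D: "linear D"
    "\<And>\<epsilon>. \<epsilon> > 0 \<Longrightarrow> \<exists>\<delta>>0. \<forall>z\<in>V. norm z < \<delta> \<longrightarrow> \<bar>F z - D z \<bullet> z / 2\<bar> \<le> \<epsilon> * (norm z)\<^sup>2"
    by (rule aNor_n_imp_second_order) blast
  show "pt_twice_diff (hplane a u) f a"
    unfolding pt_twice_diff_def using second_order_atI[OF u1 D(1) fa D(2)] by blast
next
  assume "pt_twice_diff (hplane a u) f a"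
  then obtain L Q where "second_order_at (hplane a u) f a L Q" by (auto simp: pt_twice_diff_def)
  then obtain D where D: "linear D" "\<And>z. D z \<bullet> u = 0" "\<And>x z. x \<in> V \<Longrightarrow> z \<in> V \<Longrightarrow> D x \<bullet> z = D z \<bullet> x"
    "\<And>\<epsilon>. \<epsilon> > 0 \<Longrightarrow> \<exists>\<delta>>0. \<forall>z\<in>V. norm z < \<delta> \<longrightarrow> \<bar>F z - D z \<bullet> z / 2\<bar> \<le> \<epsilon> * (norm z)\<^sup>2"
    by (rule second_order_symmetricE) blast
  show "(a, g u) \<in> aNor_n \<phi> A" by (rule second_order_imp_aNor_n[OF D])
qed

text \<open>Each normal of the epigraph yields a proximal subgradient q, which
  \<open>subgradient_expansion\<close> differentiates; \<nu> - u - q is quadratic in q, so the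
  normals inherit the derivative D.\<close>

lemma normal_selection_derivative:
  assumes D: "linear D" "\<And>z. D z \<bullet> u = 0" and sym: "\<And>x z. x \<in> V \<Longrightarrow> z \<in> V \<Longrightarrow> D x \<bullet> z = D z \<bullet> x"
    and ex: "\<And>\<epsilon>. \<epsilon> > 0 \<Longrightarrow> \<exists>\<delta>>0. \<forall>z\<in>V. norm z < \<delta> \<longrightarrow> \<bar>F z - D z \<bullet> z / 2\<bar> \<le> \<epsilon> * (norm z)\<^sup>2"
    and \<nu>: "\<And>b. b \<in> hplane a u \<Longrightarrow> \<nu> b \<in> normal_fibre (fepi a u f) (b - f b *\<^sub>R u)"
  shows "\<nu> a = u" and "(\<nu> has_derivative D) (at a within hplane a u)"
proof -
  have DV: "D z \<in> V" if "z \<in> V" for z using D(2) by simp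
  define q where "q z = (1 / (\<nu> (a + z) \<bullet> u)) *\<^sub>R \<nu> (a + z) - u" for z
  have sb: "sub z (q z) \<and> norm (\<nu> (a + z) - u - q z) \<le> (norm (q z))\<^sup>2" if z: "z \<in> V" for z
  proof -
    have b: "a + z \<in> hplane a u" using z by (simp add: plane_iff)
    obtain s where s: "norm (\<nu> (a + z)) = 1" "s > 0" "\<And>y. y \<in> fepi a u f \<Longrightarrow>
        2 * s * (\<nu> (a + z) \<bullet> (y - (a + z - F z *\<^sub>R u))) \<le> (norm (y - (a + z - F z *\<^sub>R u)))\<^sup>2"
      using \<nu>[OF b] unfolding normal_fibre_iff by blast
    have E: "x - t *\<^sub>R u \<in> fepi a u f" if "x \<in> hplane a u" "norm (x - (a + z)) < 1" "f x \<le> t" "t < f x + 1" for x t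
      using that unfolding fepi_def by blast
    note * = proximal_subgradient_of_normal[OF u1 s(1) cvx kap lip b zero_less_one E s(2,3)]
    have vu: "\<nu> (a + z) \<bullet> u > 0" by (rule *(1))
    show ?thesis using *(2) normal_slope_bounds(2)[OF u1 s(1) vu] unfolding q_def by simp
  qed
  obtain K' where K': "K' > 0" "\<And>x. norm (D x) \<le> K' * norm x" using linear_normE[OF D(1)] by blast
  have key: "\<exists>d>0. \<forall>z\<in>V. norm z < d \<longrightarrow> norm (\<nu> (a + z) - u - D z) \<le> e * norm z" if e: "e > 0" for e
  proof -
    define e1 where "e1 = min (e / 2) 1"
    have e1: "e1 > 0" "e1 \<le> e / 2" "e1 \<le> 1" using e by (auto simp: e1_def)
    obtain d1 where d1: "d1 > 0" "\<And>z q. z \<in> V \<Longrightarrow> norm z < d1 \<Longrightarrow> sub z q \<Longrightarrow> norm (q - D z) \<le> e1 * norm z"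
      using subgradient_expansion[OF subspace_V D(1) DV sym kap ex e1(1)] by blast
    \<comment> \<open>Makes the quadratic term |q|^2 \<le> (K' + 1)^2 |z|^2 at most e/2 |z|.\<close>
    define d2 where "d2 = e / (2 * (K' + 1)\<^sup>2)"
    have d2: "d2 > 0" using e K' by (simp add: d2_def)
    have "norm (\<nu> (a + z) - u - D z) \<le> e * norm z" if z: "z \<in> V" "norm z < min d1 d2" for z
    proof -
      have qD: "norm (q z - D z) \<le> e1 * norm z" using d1(2)[OF z(1)] z(2) sb[OF z(1)] by simp
      have "norm (q z) \<le> e1 * norm z + K' * norm z"
        using norm_triangle_ineq[of "q z - D z" "D z"] qD K'(2)[of z] by simp
      also have "\<dots> \<le> 1 * norm z + K' * norm z" using e1 by (intro add_mono mult_right_mono) auto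
      finally have "norm (q z) \<le> (K' + 1) * norm z" by (simp add: algebra_simps)
      then have "(norm (q z))\<^sup>2 \<le> ((K' + 1) * norm z)\<^sup>2" by (intro power_mono) auto
      also have "\<dots> = ((K' + 1)\<^sup>2 * norm z) * norm z" by (simp add: power2_eq_square mult_ac)
      also have "\<dots> \<le> (e / 2) * norm z"
      proof (rule mult_right_mono)
        have "(K' + 1)\<^sup>2 * norm z \<le> (K' + 1)\<^sup>2 * d2" using z(2) by (intro mult_left_mono) auto
        also have "\<dots> = e / 2" using K' by (simp add: d2_def)
        finally show "(K' + 1)\<^sup>2 * norm z \<le> e / 2" .
      qed simp
      finally have 1: "(norm (q z))\<^sup>2 \<le> e / 2 * norm z" .
      have 2: "e1 * norm z \<le> e / 2 * norm z" using e1 by (intro mult_right_mono) auto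
      have "norm (\<nu> (a + z) - u - D z) \<le> norm (\<nu> (a + z) - u - q z) + norm (q z - D z)"
        using norm_triangle_ineq[of "\<nu> (a + z) - u - q z" "q z - D z"] by simp
      then show ?thesis using sb[OF z(1)] 1 2 qD by linarith
    qed
    then show ?thesis using d1(1) d2 by (intro exI[of _ "min d1 d2"]) auto
  qed
  obtain d where d0: "d > 0" "\<forall>z\<in>V. norm z < d \<longrightarrow> norm (\<nu> (a + z) - u - D z) \<le> 1 * norm z"
    using key[OF zero_less_one] by blast
  \<comment> \<open>At z = 0 the right side of the estimate is 0, which identifies \<nu> a with
    u.\<close>
  have "norm (\<nu> (a + 0) - u - D 0) \<le> 1 * norm (0::'a)"
    by (rule bspec[OF d0(2), THEN mp]) (use d0(1) in simp_all)
  then show \<nu>a: "\<nu> a = u" using linear_0[OF D(1)] by simp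
  show "(\<nu> has_derivative D) (at a within hplane a u)"
    unfolding has_derivative_within_alt
  proof (intro conjI allI impI)
    show "bounded_linear D" using D(1) by (simp add: linear_conv_bounded_linear)
    fix e :: real assume "e > 0"
    from key[OF this] obtain d where d: "d > 0" "\<And>z. z \<in> V \<Longrightarrow> norm z < d \<Longrightarrow> norm (\<nu> (a + z) - u - D z) \<le> e * norm z"
      by blast
    show "\<exists>d>0. \<forall>y\<in>hplane a u. norm (y - a) < d \<longrightarrow> norm (\<nu> y - \<nu> a - D (y - a)) \<le> e * norm (y - a)"
    proof (intro exI[of _ d] conjI d(1) ballI impI)
      fix y assume "y \<in> hplane a u" "norm (y - a) < d"
      then show "norm (\<nu> y - \<nu> a - D (y - a)) \<le> e * norm (y - a)"
        using d(2)[of "y - a"] unfolding \<nu>a plane_iff by simp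
    qed
  qed
qed

text \<open>Both maps differentiate the same subgradients, and \<open>sub_ex\<close> provides one at
  every point near 0. Uniqueness matters because the final relation is claimed for every second
  order expansion.\<close>

lemma second_order_unique:
  assumes D: "linear D" "\<And>z. D z \<bullet> u = 0" and sym: "\<And>x z. x \<in> V \<Longrightarrow> z \<in> V \<Longrightarrow> D x \<bullet> z = D z \<bullet> x"
    and ex: "\<And>\<epsilon>. \<epsilon> > 0 \<Longrightarrow> \<exists>\<delta>>0. \<forall>z\<in>V. norm z < \<delta> \<longrightarrow> \<bar>F z - D z \<bullet> z / 2\<bar> \<le> \<epsilon> * (norm z)\<^sup>2"
    and D': "linear D'" "\<And>z. D' z \<bullet> u = 0" and sym': "\<And>x z. x \<in> V \<Longrightarrow> z \<in> V \<Longrightarrow> D' x \<bullet> z = D' z \<bullet> x"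
    and ex': "\<And>\<epsilon>. \<epsilon> > 0 \<Longrightarrow> \<exists>\<delta>>0. \<forall>z\<in>V. norm z < \<delta> \<longrightarrow> \<bar>F z - D' z \<bullet> z / 2\<bar> \<le> \<epsilon> * (norm z)\<^sup>2"
    and h: "h \<in> V"
  shows "D h = D' h"
proof -
  have DV: "D z \<in> V" and DV': "D' z \<in> V" if "z \<in> V" for z using D(2) D'(2) by simp_all
  have lin: "linear (\<lambda>x. D x - D' x)" using D(1) D'(1) by (rule linear_compose_sub)
  have "little_o V0 (\<lambda>x. D x - D' x) norm"
    unfolding little_o_def
  proof (intro allI impI)
    fix e :: real assume "e > 0"
    then have e: "e / 2 > 0" by simp
    obtain d1 where d1: "d1 > 0" "\<And>z q. z \<in> V \<Longrightarrow> norm z < d1 \<Longrightarrow> sub z q \<Longrightarrow> norm (q - D z) \<le> e / 2 * norm z"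
      using subgradient_expansion[OF subspace_V D(1) DV sym kap ex e] by blast
    obtain d2 where d2: "d2 > 0" "\<And>z q. z \<in> V \<Longrightarrow> norm z < d2 \<Longrightarrow> sub z q \<Longrightarrow> norm (q - D' z) \<le> e / 2 * norm z"
      using subgradient_expansion[OF subspace_V D'(1) DV' sym' kap ex' e] by blast
    obtain d3 where d3: "d3 > 0" "\<And>z. z \<in> V \<Longrightarrow> norm z < d3 \<Longrightarrow> \<exists>q. sub z q" using sub_ex by blast
    have "norm (D x - D' x) \<le> e * norm x" if x: "x \<in> V" "norm x < min d1 (min d2 d3)" for x
    proof -
      obtain q where q: "sub x q" using d3(2)[OF x(1)] x(2) by auto
      have "norm (q - D x) \<le> e / 2 * norm x" "norm (q - D' x) \<le> e / 2 * norm x"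
        using d1(2)[OF x(1) _ q] d2(2)[OF x(1) _ q] x(2) by auto
      then show ?thesis using norm_triangle_ineq4[of "q - D' x" "q - D x"] by simp
    qed
    then show "\<forall>\<^sub>F x in V0. norm (D x - D' x) \<le> e * norm x"
      unfolding eventually_V0 using d1(1) d2(1) d3(1) by (intro exI[of _ "min d1 (min d2 d3)"]) auto
  qed
  from linear_little_o_zero[OF lin this h] show ?thesis by simp
qed

text \<open>M is \<open>Dg u\<close> after D, by the chain rule at \<nu> a = u; symmetry of
  \<open>Dg u\<close> moves it to the other argument of the form.\<close>

lemma second_order_normal_relation:
  assumes N: "(a, g u) \<in> aNor_n \<phi> A"
    and \<nu>: "\<And>b. b \<in> hplane a u \<Longrightarrow> \<nu> b \<in> normal_fibre (fepi a u f) (b - f b *\<^sub>R u)"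
  shows "\<exists>L\<nu> M. (\<nu> has_derivative L\<nu>) (at a within hplane a u) \<and>
     ((g \<circ> \<nu>) has_derivative M) (at a within hplane a u) \<and>
     (\<forall>L Q. second_order_at (hplane a u) f a L Q \<longrightarrow>
        (\<forall>\<tau>1 \<tau>2. \<tau>1 \<bullet> u = 0 \<and> \<tau>2 \<bullet> u = 0 \<longrightarrow> Q \<tau>1 (blinfun_apply (Dg u) \<tau>2) = M \<tau>1 \<bullet> \<tau>2))"
proof -
  obtain L0 Q0 where "second_order_at (hplane a u) f a L0 Q0"
    using N aNor_n_iff by (auto simp: pt_twice_diff_def)
  then obtain D where D: "linear D" "\<And>z. D z \<bullet> u = 0" "\<And>x z. x \<in> V \<Longrightarrow> z \<in> V \<Longrightarrow> D x \<bullet> z = D z \<bullet> x"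
    "\<And>\<epsilon>. \<epsilon> > 0 \<Longrightarrow> \<exists>\<delta>>0. \<forall>z\<in>V. norm z < \<delta> \<longrightarrow> \<bar>F z - D z \<bullet> z / 2\<bar> \<le> \<epsilon> * (norm z)\<^sup>2"
    by (rule second_order_symmetricE) blast
  have \<nu>a: "\<nu> a = u" by (rule normal_selection_derivative(1)[OF D \<nu>])
  have \<nu>': "(\<nu> has_derivative D) (at a within hplane a u)"
    by (rule normal_selection_derivative(2)[OF D \<nu>])
  have "(g has_derivative blinfun_apply (Dg u)) (at (\<nu> a))" using g_deriv[OF u0] by (simp only: \<nu>a)
  from has_derivative_compose[OF \<nu>' this]
  have M: "((g \<circ> \<nu>) has_derivative (\<lambda>h. Dg u (D h))) (at a within hplane a u)" by (simp add: o_def)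
  have "Q \<tau>1 (Dg u \<tau>2) = Dg u (D \<tau>1) \<bullet> \<tau>2"
    if so: "second_order_at (hplane a u) f a L Q" and t: "\<tau>1 \<bullet> u = 0 \<and> \<tau>2 \<bullet> u = 0" for L Q \<tau>1 \<tau>2
  proof -
    obtain D' where D': "linear D'" "\<And>z. D' z \<bullet> u = 0" "\<And>x z. x \<in> V \<Longrightarrow> z \<in> V \<Longrightarrow> D' x \<bullet> z = Q x z"
      "\<And>x z. x \<in> V \<Longrightarrow> z \<in> V \<Longrightarrow> D' x \<bullet> z = D' z \<bullet> x"
      "\<And>\<epsilon>. \<epsilon> > 0 \<Longrightarrow> \<exists>\<delta>>0. \<forall>z\<in>V. norm z < \<delta> \<longrightarrow> \<bar>F z - D' z \<bullet> z / 2\<bar> \<le> \<epsilon> * (norm z)\<^sup>2"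
      by (rule second_order_symmetricE[OF so]) (rule that, assumption+)
    have tV: "\<tau>1 \<in> V" using t by simp
    have "Q \<tau>1 (Dg u \<tau>2) = D' \<tau>1 \<bullet> Dg u \<tau>2" using D'(3)[OF tV Dg_V] by simp
    also have "D' \<tau>1 = D \<tau>1" by (rule second_order_unique[OF D'(1,2,4,5) D tV])
    also have "D \<tau>1 \<bullet> Dg u \<tau>2 = Dg u (D \<tau>1) \<bullet> \<tau>2"
      using Dg_symmetric[OF u0, of \<tau>2 "D \<tau>1"] by (simp add: inner_commute)
    finally show ?thesis .
  qed
  with \<nu>' M show ?thesis by blast
qed

end

theorem theorem5p7:
  fixes A :: "'a::euclidean_space set" and a u :: 'a
    and \<phi> :: "'a \<Rightarrow> real" and g :: "'a \<Rightarrow> 'a" and Dg :: "'a \<Rightarrow> 'a \<Rightarrow>\<^sub>L 'a"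
  assumes dim: "DIM('a) \<ge> 2"
    and phi: "admissible_norm \<phi> g Dg"
    and closedA: "closed A"
    and reachA: "reach A > 0"
    and av: "a \<in> vfrontier A"
    and Nu: "normal_fibre A a = {u}"
  shows
    "(\<exists>\<epsilon>>0. \<exists>\<delta>>0. \<exists>f.
        semiconvex_on (hplane a u) a f \<and> (\<exists>K. K-lipschitz_on (hplane a u) f) \<and>
        f a = 0 \<and> (f has_derivative (\<lambda>h. 0)) (at a within hplane a u) \<and>
        fgraph a u f \<inter> cyl \<epsilon> \<delta> a u = frontier A \<inter> cyl \<epsilon> \<delta> a u \<and>
        fepi a u f \<inter> cyl \<epsilon> \<delta> a u = A \<inter> cyl \<epsilon> \<delta> a u)
   \<and>
    (\<forall>\<epsilon> \<delta> f. \<epsilon> > 0 \<and> \<delta> > 0 \<and>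
        semiconvex_on (hplane a u) a f \<and> (\<exists>K. K-lipschitz_on (hplane a u) f) \<and>
        f a = 0 \<and> (f has_derivative (\<lambda>h. 0)) (at a within hplane a u) \<and>
        fgraph a u f \<inter> cyl \<epsilon> \<delta> a u = frontier A \<inter> cyl \<epsilon> \<delta> a u \<and>
        fepi a u f \<inter> cyl \<epsilon> \<delta> a u = A \<inter> cyl \<epsilon> \<delta> a u
      \<longrightarrow>
        ((a, g u) \<in> aNor_n \<phi> A \<longleftrightarrow> pt_twice_diff (hplane a u) f a) \<and>
        ((a, g u) \<in> aNor_n \<phi> A \<longrightarrow>
          (\<forall>\<nu> :: 'a \<Rightarrow> 'a.
             (\<forall>b \<in> hplane a u. \<nu> b \<in> unit_sphere \<and>
                 \<nu> b \<in> normal_fibre (fepi a u f) (b - f b *\<^sub>R u)) \<longrightarrow>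
             (\<exists>L\<nu> M. (\<nu> has_derivative L\<nu>) (at a within hplane a u) \<and>
                ((g \<circ> \<nu>) has_derivative M) (at a within hplane a u) \<and>
                (\<forall>L Q. second_order_at (hplane a u) f a L Q \<longrightarrow>
                   (\<forall>\<tau>1 \<tau>2. \<tau>1 \<bullet> u = 0 \<and> \<tau>2 \<bullet> u = 0 \<longrightarrow>
                      Q \<tau>1 (blinfun_apply (Dg u) \<tau>2) = M \<tau>1 \<bullet> \<tau>2))))))"
proof -
  have "a \<in> A" using Nu by (auto simp: normal_fibre_def)
  then have ne: "A \<noteq> {}" by auto
  obtain \<gamma> where \<gamma>: "\<gamma> > 0" "convex_on UNIV (\<lambda>v. \<phi> v - \<gamma> * norm v)"
    using phi unfolding admissible_norm_def by blast
  obtain \<rho> where \<rho>: "pos_reach A \<rho>" by (rule pos_reachI[OF closedA ne reachA])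
  have wn: "wulff_norm \<phi> g Dg \<gamma>" by unfold_locales (use phi \<gamma> in auto)
  then have wr: "wulff_pos_reach \<phi> g Dg \<gamma> A \<rho>" using \<rho> by (rule wulff_pos_reach.intro)
  have part_a: "\<exists>\<epsilon>>0. \<exists>\<delta>>0. \<exists>f.
        semiconvex_on (hplane a u) a f \<and> (\<exists>K. K-lipschitz_on (hplane a u) f) \<and>
        f a = 0 \<and> (f has_derivative (\<lambda>h. 0)) (at a within hplane a u) \<and>
        fgraph a u f \<inter> cyl \<epsilon> \<delta> a u = frontier A \<inter> cyl \<epsilon> \<delta> a u \<and>
        fepi a u f \<inter> cyl \<epsilon> \<delta> a u = A \<inter> cyl \<epsilon> \<delta> a u"
    by (rule pos_reach.local_epigraph[OF \<rho> Nu])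
  \<comment> \<open>Part (b) concerns every f as in (a), not only the one just built; the \<kappa>
    and K of f, together with the fixed \<gamma> and \<rho>, make it an instance of
    \<open>epigraph_point\<close>.\<close>
  have ep: "\<exists>\<kappa> K. epigraph_point \<phi> g Dg \<gamma> A \<rho> a u \<epsilon> \<delta> \<kappa> K f"
    if "\<epsilon> > 0 \<and> \<delta> > 0 \<and>
        semiconvex_on (hplane a u) a f \<and> (\<exists>K. K-lipschitz_on (hplane a u) f) \<and>
        f a = 0 \<and> (f has_derivative (\<lambda>h. 0)) (at a within hplane a u) \<and>
        fgraph a u f \<inter> cyl \<epsilon> \<delta> a u = frontier A \<inter> cyl \<epsilon> \<delta> a u \<and>
        fepi a u f \<inter> cyl \<epsilon> \<delta> a u = A \<inter> cyl \<epsilon> \<delta> a u" for \<epsilon> \<delta> f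
  proof -
    from that obtain K where "K-lipschitz_on (hplane a u) f" by blast
    moreover from that obtain \<kappa> where "\<kappa> \<ge> 0" "convex_on (hplane a u) (\<lambda>x. \<kappa> * (norm (x - a))\<^sup>2 + f x)"
      unfolding semiconvex_on_def by blast
    ultimately have "epigraph_point_axioms A a u \<epsilon> \<delta> \<kappa> K f"
      using that Nu by (intro epigraph_point_axioms.intro) auto
    with wr show ?thesis by (blast intro: epigraph_point.intro)
  qed
  show ?thesis
  proof (intro conjI[OF part_a] allI impI)
    fix \<epsilon> \<delta> f
    assume "\<epsilon> > 0 \<and> \<delta> > 0 \<and>
        semiconvex_on (hplane a u) a f \<and> (\<exists>K. K-lipschitz_on (hplane a u) f) \<and>
        f a = 0 \<and> (f has_derivative (\<lambda>h. 0)) (at a within hplane a u) \<and>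
        fgraph a u f \<inter> cyl \<epsilon> \<delta> a u = frontier A \<inter> cyl \<epsilon> \<delta> a u \<and>
        fepi a u f \<inter> cyl \<epsilon> \<delta> a u = A \<inter> cyl \<epsilon> \<delta> a u"
    then obtain \<kappa> K where ep': "epigraph_point \<phi> g Dg \<gamma> A \<rho> a u \<epsilon> \<delta> \<kappa> K f" using ep by blast
    show "((a, g u) \<in> aNor_n \<phi> A \<longleftrightarrow> pt_twice_diff (hplane a u) f a) \<and>
        ((a, g u) \<in> aNor_n \<phi> A \<longrightarrow>
          (\<forall>\<nu> :: 'a \<Rightarrow> 'a.
             (\<forall>b \<in> hplane a u. \<nu> b \<in> unit_sphere \<and>
                 \<nu> b \<in> normal_fibre (fepi a u f) (b - f b *\<^sub>R u)) \<longrightarrow>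
             (\<exists>L\<nu> M. (\<nu> has_derivative L\<nu>) (at a within hplane a u) \<and>
                ((g \<circ> \<nu>) has_derivative M) (at a within hplane a u) \<and>
                (\<forall>L Q. second_order_at (hplane a u) f a L Q \<longrightarrow>
                   (\<forall>\<tau>1 \<tau>2. \<tau>1 \<bullet> u = 0 \<and> \<tau>2 \<bullet> u = 0 \<longrightarrow>
                      Q \<tau>1 (blinfun_apply (Dg u) \<tau>2) = M \<tau>1 \<bullet> \<tau>2)))))"
    proof (intro conjI allI impI)
      show "(a, g u) \<in> aNor_n \<phi> A \<longleftrightarrow> pt_twice_diff (hplane a u) f a"
        by (rule epigraph_point.aNor_n_iff[OF ep'])
    qed (rule epigraph_point.second_order_normal_relation[OF ep'], auto)
  qed
qed

end
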